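(* Let $(V,\omega)$ be a complex symplectic vector space of dimension $2n$, and let $\lambda_1,\lambda_2,\mu_1,\mu_2$ be four Lagrangian subspaces of $V$. Then the Hörmander index $s(\lambda_1,\lambda_2;\mu_1,\mu_2)$ and the triple index $i(\cdot,\cdot,\cdot)$ satisfy $$s(\lambda_1,\lambda_2;\mu_1,\mu_2)=i(\lambda_1,\lambda_2,\mu_2)-i(\lambda_1,\lambda_2,\mu_1)=i(\lambda_1,\mu_1,\mu_2)-i(\lambda_2,\mu_1,\mu_2).$$
   Context: A symplectic form on a complex vector space $V$ is a non-degenerate skew-Hermitian (sesquilinear, linear in the first variable) form $\omega$. For a subspace $\lambda$, $\lambda^\omega:=\{x\in V:\omega(x,y)=0\ \forall y\in\lambda\}$; $\lambda$ is Lagrangian if $\lambda=\lambda^\omega$. $\mathcal L(V)$ is the (path-connected) space of Lagrangian subspaces. Maslov index. Choose an inner product $\langle\cdot,\cdot\rangle$ on $V$ (linear in the first variable) and let $J\in \mathrm{GL}(V)$ satisfy $\omega(x,y)=\langle Jx,y\rangle$; then $iJ$ is self-adjoint. Let $V^-$ (resp. $V^+$) be the span of the eigenvectors of $iJ$ with positive (resp. negative) eigenvalues. For a continuous path $(\lambda(s),\mu(s))$, $s\in[a,b]$, of pairs of Lagrangian subspaces, write $\lambda(s),\mu(s)$ as graphs of linear maps $U_\lambda(s),U_\mu(s):V^-\to V^+$. Then $U_\lambda(s)U_\mu(s)^{-1}$ is a continuous family of unitary operators on $(V^+,-i\omega|_{V^+})$, with eigenvalues (with multiplicity) $e^{i\theta_j(s)}$,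 $j=1,\dots,n$, where the $\theta_j$ are continuous real functions on $[a,b]$. With $E(x)$ the smallest integer $\ge x$, put $$\mathrm{Mas}\{\lambda,\mu\}:=\sum_{j=1}^n\Big(E\big(\tfrac{\theta_j(b)}{2\pi}\big)-E\big(\tfrac{\theta_j(a)}{2\pi}\big)\Big).$$ This is independent of all choices. A single Lagrangian in place of a path means the constant path. Hörmander index. For Lagrangian subspaces $\lambda_1,\lambda_2,\mu_1,\mu_2$ choose continuous paths $\lambda,\mu:[a,b]\to\mathcal L(V)$ with $\lambda(a)=\lambda_1,\lambda(b)=\lambda_2,\mu(a)=\mu_1,\mu(b)=\mu_2$, and set $$s(\lambda_1,\lambda_2;\mu_1,\mu_2):=\mathrm{Mas}\{\lambda,\mu_2\}-\mathrm{Mas}\{\lambda,\mu_1\}=\mathrm{Mas}\{\lambda_2,\mu\}-\mathrm{Mas}\{\lambda_1,\mu\},$$ which is independent of the paths. The form $Q$. For isotropic subspaces $\alpha,\beta,\gamma$, $Q(\alpha,\beta;\gamma)$ is the Hermitian form on $\alpha\cap(\beta+\gamma)$ given by $Q(x_1,x_2):=\omega(x_1,y_2)$, where $x_j=-y_j+z_j$ with $y_j\in\beta$, $z_j\in\gamma$. For a Hermitian form, $m^-$ denotes its Morse negative index (maximal dimension of a negative definite subspace). Triple index. For Lagrangian $\alpha,\beta,\gamma$, $$i(\alpha,\beta,\gamma):=m^-(Q(\alpha,\delta;\beta))+m^-(Q(\beta,\delta;\gamma))-m^-(Q(\alpha,\delta;\gamma)),$$ where $\delta\in\mathcal L(V)$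 is any Lagrangian subspace with $\delta\cap\alpha=\delta\cap\beta=\delta\cap\gamma=\{0\}$; this does not depend on $\delta$. *)

theory Defs
  imports Complex_Main
begin

definition sesquilinear :: "(complex \<Rightarrow> 'v::ab_group_add \<Rightarrow> 'v) \<Rightarrow> ('v \<Rightarrow> 'v \<Rightarrow> complex) \<Rightarrow> bool" where
  "sesquilinear scale f \<longleftrightarrow>
     (\<forall>x x' y. f (x + x') y = f x y + f x' y) \<and>
     (\<forall>c x y. f (scale c x) y = c * f x y) \<and>
     (\<forall>x y y'. f x (y + y') = f x y + f x y') \<and>
     (\<forall>c x y. f x (scale c y) = cnj c * f x y)"

locale complex_symplectic_space = vector_space scale
  for scale :: "complex \<Rightarrow> 'v::ab_group_add \<Rightarrow> 'v" +
  fixes \<omega> :: "'v \<Rightarrow> 'v \<Rightarrow> complex"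
  assumes finite_dim: "\<exists>B. finite B \<and> span B = UNIV"
    and omega_sesquilinear: "sesquilinear scale \<omega>"
    and omega_skew: "\<And>x y. \<omega> x y = - cnj (\<omega> y x)"
    and omega_nondegenerate: "\<And>x. (\<forall>y. \<omega> x y = 0) \<Longrightarrow> x = 0"
begin

definition annihilator :: "'v set \<Rightarrow> 'v set" where
  "annihilator L = {x. \<forall>y\<in>L. \<omega> x y = 0}"

definition lagrangian :: "'v set \<Rightarrow> bool" where
  "lagrangian L \<longleftrightarrow> subspace L \<and> L = annihilator L"

definition inner_product :: "('v \<Rightarrow> 'v \<Rightarrow> complex) \<Rightarrow> bool" where
  "inner_product h \<longleftrightarrow>
     sesquilinear scale h \<and> (\<forall>x y. h y x = cnj (h x y)) \<and> (\<forall>x. x \<noteq> 0 \<longrightarrow> 0 < Re (h x x))"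


text \<open>Paths are continuous for the usual (gap) topology on the set of Lagrangian subspaces, in
  which a subspace is identified with the orthogonal projection onto it.  As the dimension is
  finite, this is convergence of the matrix entries of the projections, and the topology does not
  depend on the inner product.\<close>

definition orth_proj :: "('v \<Rightarrow> 'v \<Rightarrow> complex) \<Rightarrow> 'v set \<Rightarrow> 'v \<Rightarrow> 'v" where
  "orth_proj h L x = (THE p. p \<in> L \<and> (\<forall>z\<in>L. h (x - p) z = 0))"

definition lagrangian_path :: "real \<Rightarrow> real \<Rightarrow> (real \<Rightarrow> 'v set) \<Rightarrow> bool" where
  "lagrangian_path a b \<Lambda> \<longleftrightarrow>
     (\<forall>s\<in>{a..b}. lagrangian (\<Lambda> s)) \<and>
     (\<forall>h. inner_product h \<longrightarrow>
        (\<forall>x y. continuous_on {a..b} (\<lambda>s. h (orth_proj h (\<Lambda> s) x) y)))"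


text \<open>In the definitions below, \<open>J\<close> is the isomorphism with \<open>\<omega> x y = h (J x) y\<close> for
  an inner product \<open>h\<close>.  Note the sign convention: \<open>V_minus\<close> belongs to the
  \<^emph>\<open>positive\<close> eigenvalues of \<open>\<i>J\<close>.\<close>

definition V_minus :: "('v \<Rightarrow> 'v) \<Rightarrow> 'v set" where
  "V_minus J = span {x. x \<noteq> 0 \<and> (\<exists>c::real. 0 < c \<and> scale \<i> (J x) = scale (of_real c) x)}"

definition V_plus :: "('v \<Rightarrow> 'v) \<Rightarrow> 'v set" where
  "V_plus J = span {x. x \<noteq> 0 \<and> (\<exists>c::real. c < 0 \<and> scale \<i> (J x) = scale (of_real c) x)}"

definition graph_map :: "('v \<Rightarrow> 'v) \<Rightarrow> 'v set \<Rightarrow> ('v \<Rightarrow> 'v) \<Rightarrow> bool" where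
  "graph_map J L U \<longleftrightarrow>
     U ` V_minus J \<subseteq> V_plus J \<and>
     (\<forall>x\<in>V_minus J. \<forall>y\<in>V_minus J. U (x + y) = U x + U y) \<and>
     (\<forall>c. \<forall>x\<in>V_minus J. U (scale c x) = scale c (U x)) \<and>
     L = {x + U x | x. x \<in> V_minus J}"

text \<open>\<open>eigenangles J W n t\<close>: the eigenvalues of the operator \<open>W\<close> on \<open>V_plus J\<close>, counted with
  multiplicity, are \<open>cis (t j)\<close> for \<open>j < n\<close>.  It is used for unitary \<open>W\<close> only, so that
  the multiplicity of an eigenvalue is the dimension of its eigenspace.\<close>

definition eigenangles :: "('v \<Rightarrow> 'v) \<Rightarrow> ('v \<Rightarrow> 'v) \<Rightarrow> nat \<Rightarrow> (nat \<Rightarrow> real) \<Rightarrow> bool" where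
  "eigenangles J W n t \<longleftrightarrow>
     (\<forall>z. card {j\<in>{..<n}. cis (t j) = z} = dim {y\<in>V_plus J. W y = scale z y})"

text \<open>\<open>maslov_value a b \<Lambda> M k\<close>: some choice of the auxiliary data yields the value \<open>k\<close>
  for the Maslov index of the path \<open>(\<Lambda> s, M s)\<close>, \<open>s \<in> {a..b}\<close>.\<close>

definition maslov_value ::
    "real \<Rightarrow> real \<Rightarrow> (real \<Rightarrow> 'v set) \<Rightarrow> (real \<Rightarrow> 'v set) \<Rightarrow> int \<Rightarrow> bool" where
  "maslov_value a b \<Lambda> M k \<longleftrightarrow>
     (\<exists>h J U\<^sub>\<Lambda> U\<^sub>M (\<theta> :: nat \<Rightarrow> real \<Rightarrow> real). let n = dim UNIV div 2 in
        inner_product h \<and>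
        Vector_Spaces.linear scale scale J \<and> bij J \<and> (\<forall>x y. \<omega> x y = h (J x) y) \<and>
        (\<forall>s\<in>{a..b}. graph_map J (\<Lambda> s) (U\<^sub>\<Lambda> s) \<and> graph_map J (M s) (U\<^sub>M s)) \<and>
        (\<forall>j<n. continuous_on {a..b} (\<theta> j)) \<and>
        (\<forall>s\<in>{a..b}.
           eigenangles J (U\<^sub>\<Lambda> s \<circ> inv_into (V_minus J) (U\<^sub>M s)) n (\<lambda>j. \<theta> j s)) \<and>
        k = (\<Sum>j<n. \<lceil>\<theta> j b / (2 * pi)\<rceil> - \<lceil>\<theta> j a / (2 * pi)\<rceil>))"

definition maslov_index ::
    "real \<Rightarrow> real \<Rightarrow> (real \<Rightarrow> 'v set) \<Rightarrow> (real \<Rightarrow> 'v set) \<Rightarrow> int" where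
  "maslov_index a b \<Lambda> M = (THE k. maslov_value a b \<Lambda> M k)"

definition hormander_index :: "'v set \<Rightarrow> 'v set \<Rightarrow> 'v set \<Rightarrow> 'v set \<Rightarrow> int" where
  "hormander_index L\<^sub>1 L\<^sub>2 M\<^sub>1 M\<^sub>2 =
     (THE k. \<exists>a b \<Lambda> M. a < b \<and> lagrangian_path a b \<Lambda> \<and> lagrangian_path a b M \<and>
        \<Lambda> a = L\<^sub>1 \<and> \<Lambda> b = L\<^sub>2 \<and> M a = M\<^sub>1 \<and> M b = M\<^sub>2 \<and>
        k = maslov_index a b \<Lambda> (\<lambda>_. M\<^sub>2) - maslov_index a b \<Lambda> (\<lambda>_. M\<^sub>1) \<and>
        k = maslov_index a b (\<lambda>_. L\<^sub>2) M - maslov_index a b (\<lambda>_. L\<^sub>1) M)"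


definition Q_dom :: "'v set \<Rightarrow> 'v set \<Rightarrow> 'v set \<Rightarrow> 'v set" where
  "Q_dom A B C = A \<inter> {y + z | y z. y \<in> B \<and> z \<in> C}"

definition Q_form :: "'v set \<Rightarrow> 'v set \<Rightarrow> 'v set \<Rightarrow> 'v \<Rightarrow> 'v \<Rightarrow> complex" where
  "Q_form A B C x\<^sub>1 x\<^sub>2 =
     (THE c. \<exists>y\<^sub>2\<in>B. \<exists>z\<^sub>2\<in>C. x\<^sub>2 = - y\<^sub>2 + z\<^sub>2 \<and> c = \<omega> x\<^sub>1 y\<^sub>2)"

definition morse_neg :: "'v set \<Rightarrow> ('v \<Rightarrow> 'v \<Rightarrow> complex) \<Rightarrow> nat" where
  "morse_neg D q = Max {dim W | W. subspace W \<and> W \<subseteq> D \<and> (\<forall>x\<in>W. x \<noteq> 0 \<longrightarrow> Re (q x x) < 0)}"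

definition m_Q :: "'v set \<Rightarrow> 'v set \<Rightarrow> 'v set \<Rightarrow> nat" where
  "m_Q A B C = morse_neg (Q_dom A B C) (Q_form A B C)"

definition triple_index :: "'v set \<Rightarrow> 'v set \<Rightarrow> 'v set \<Rightarrow> int" where
  "triple_index A B C =
     (THE k. \<exists>D. lagrangian D \<and> D \<inter> A = {0} \<and> D \<inter> B = {0} \<and> D \<inter> C = {0} \<and>
        k = int (m_Q A D B) + int (m_Q B D C) - int (m_Q A D C))"

end

end

theory Submission
  imports Defs "HOL-Analysis.Elementary_Normed_Spaces" "HOL-Combinatorics.Permutations"
    "HOL-Computational_Algebra.Fundamental_Theorem_Algebra" "Jordan_Normal_Form.Determinant"
begin

text \<open>
  Put \<open>gap t = \<lceil>t / (2 * pi)\<rceil> - t / (2 * pi)\<close>, and for a pair of Lagrangian subspaces \<open>\<lambda>, \<mu>\<close> let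
  \<open>\<tau>(\<lambda>, \<mu>)\<close> be the sum of \<open>gap\<close> over the eigenangles of the unitary operator
  \<open>U\<^sub>\<lambda> U\<^sub>\<mu>\<^sup>-\<^sup>1\<close>. For a fixed inner product it depends on the pair only, so a Maslov index is the increment of \<open>\<tau>\<close> along the
  path plus \<open>1 / (2 * pi)\<close> times the increment of the total eigenangle. The total angle is an argument
  of the determinant, and the determinant of \<open>U\<^sub>\<lambda> U\<^sub>\<mu>\<^sup>-\<^sup>1\<close> is multiplicative, so in the
  Hoermander index the total angles cancel and
  \<open>s(\<lambda>\<^sub>1, \<lambda>\<^sub>2; \<mu>\<^sub>1, \<mu>\<^sub>2) = \<tau>(\<lambda>\<^sub>2, \<mu>\<^sub>2) - \<tau>(\<lambda>\<^sub>1, \<mu>\<^sub>2) - \<tau>(\<lambda>\<^sub>2, \<mu>\<^sub>1) + \<tau>(\<lambda>\<^sub>1, \<mu>\<^sub>1)\<close>.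

  If \<open>\<delta>\<close> is transversal to \<open>\<alpha>\<close> and \<open>\<beta>\<close>, then \<open>U\<^sub>\<alpha> U\<^sub>\<delta>\<^sup>-\<^sup>1\<close> and \<open>U\<^sub>\<delta> U\<^sub>\<beta>\<^sup>-\<^sup>1\<close> are
  Cayley transforms of Hermitian operators \<open>H\<close> and \<open>K\<close>, the form \<open>Q(\<alpha>, \<delta>; \<beta>)\<close> is congruent to a
  positive multiple of \<open>H + K\<close>, and
  \<open>\<tau>(\<alpha>, \<delta>) + \<tau>(\<delta>, \<beta>) - \<tau>(\<alpha>, \<beta>) = n - m\<^sup>-(Q(\<alpha>, \<delta>; \<beta>))\<close>. In the triple index the terms containing
  \<open>\<delta>\<close> cancel up to \<open>\<tau>(\<beta>, \<delta>) + \<tau>(\<delta>, \<beta>) = n\<close>, which leaves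
  \<open>i(\<alpha>, \<beta>, \<gamma>) = \<tau>(\<alpha>, \<beta>) + \<tau>(\<beta>, \<gamma>) - \<tau>(\<alpha>, \<gamma>)\<close>, and both equalities follow. The same
  formula shows that the Maslov index does not depend on the inner product: locally along a path it
  differs by a constant from \<open>m\<^sup>-(Q(\<lambda>(s), \<delta>; \<mu>(s)))\<close>, in which no inner product occurs.
\<close>

section \<open>Continuous eigenangles\<close>

text \<open>The obstacle is that eigenangles come as an unordered family modulo full turns, while
  ceilings need continuous labelled angles. Labels are recovered from the characteristic polynomial,
  whose continuity is easy to check: away from one avoided direction the circle is an interval, and
  there the angles can be sorted. A ceiling can jump only at an angle in 2 pi Z, that is, at the
  eigenvalue 1, and this eigenvalue occurs exactly when the two Lagrangian subspaces meet. As long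
  as its multiplicity is constant, the sum of the ceilings does not move. This principle is used for
  the deformation that relates \<open>tau\<close> to signs of eigenvalues, and, through a
  transversal subspace, for the independence of the Maslov index from the inner product. Removing
  the linear part of the ceiling makes \<open>tau\<close> a function of the operator alone, at the
  price of real values; integers return only in combinations in which the total angles cancel. Since
  the indices are definite descriptions, independence of choices and existence of paths and of
  transversal subspaces have to be proved on the way.\<close>

lemma prod_linear_eq_imp_mset_eq:
  fixes x y :: "nat \<Rightarrow> complex"
  assumes "\<And>z. (\<Prod>j<n. z - x j) = (\<Prod>j<m. z - y j)"
  shows "image_mset x (mset_set {..<n}) = image_mset y (mset_set {..<m})"
proof -
  have "(\<Prod>j<n. [:- x j, 1:]) = (\<Prod>j<m. [:- y j, 1:])"
    by (rule poly_ext) (use assms in \<open>simp only: poly_prod poly_pCons poly_0 mult_zero_right mult_1_right add_0_right uminus_add_conv_diff\<close>)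
  moreover have *: "proots (\<Prod>j<k. [:- f j, 1:]) = image_mset f (mset_set {..<k})" for k and f :: "nat \<Rightarrow> complex"
  proof (induction k)
    case (Suc k)
    have "proots ((\<Prod>j<k. [:- f j, 1:]) * [:- f k, 1:]) = proots (\<Prod>j<k. [:- f j, 1:]) + {#f k#}"
      by (subst proots_mult) (simp_all only: proots_linear_factor minus_minus prod_zero_iff finite_lessThan, auto)
    then show ?case using Suc by (simp only: prod.lessThan_Suc lessThan_Suc) simp
  qed simp
  ultimately show ?thesis using *[of x n] *[of y m] by simp
qed

lemma prod_linear_eq_imp_permutes:
  fixes x y :: "nat \<Rightarrow> complex"
  assumes "\<And>z. (\<Prod>j<n. z - x j) = (\<Prod>j<n. z - y j)"
  obtains p where "p permutes {..<n}" "\<And>j. j < n \<Longrightarrow> x j = y (p j)"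
  using image_mset_eq_implies_permutes[OF _ prod_linear_eq_imp_mset_eq[OF assms]] by (metis finite_lessThan lessThan_iff)

lemma cis_eq_iff: "cis x = cis y \<longleftrightarrow> (\<exists>k::int. x = y + 2 * pi * of_int k)"
proof
  assume "cis x = cis y"
  then have "cos x = cos y \<and> sin x = sin y" by (simp add: complex_eq_iff)
  then obtain k::int where "x = y + 2 * pi * k" using sin_cos_eq_iff[of x y] by metis
  then show "\<exists>k::int. x = y + 2 * pi * of_int k" by blast
next
  assume "\<exists>k::int. x = y + 2 * pi * of_int k"
  then obtain k::int where "x = y + 2 * pi * k" by blast
  then show "cis x = cis y"
    using cis_multiple_2pi[of k] by (simp add: cis_mult[symmetric])
qed

lemma inj_on_cis: "inj_on cis {\<phi><..<\<phi> + 2 * pi}"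
proof (rule inj_onI)
  fix x y assume *: "x \<in> {\<phi><..<\<phi> + 2 * pi}" "y \<in> {\<phi><..<\<phi> + 2 * pi}" "cis x = cis y"
  then obtain k::int where k: "x = y + 2 * pi * k" using cis_eq_iff by blast
  have "\<bar>2 * pi * k\<bar> < 2 * pi" using * k by auto
  then have "\<bar>of_int k :: real\<bar> < 1" by (simp add: abs_mult)
  then show "x = y" using k by auto
qed

lemma cis_representative: "\<exists>y. \<phi> \<le> y \<and> y < \<phi> + 2 * pi \<and> cis y = cis x"
proof -
  define k where "k = \<lfloor>(x - \<phi>) / (2 * pi)\<rfloor>"
  have "k \<le> (x - \<phi>) / (2*pi)" "(x - \<phi>) / (2*pi) < k + 1" unfolding k_def by linarith+
  then have "k * (2*pi) \<le> x - \<phi>" "x - \<phi> < (k+1) * (2*pi)" by (simp_all add: field_simps)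
  then have "\<phi> \<le> x - 2*pi*k" "x - 2*pi*k < \<phi> + 2*pi" by (simp_all add: algebra_simps)
  moreover have "cis (x - 2*pi*k) = cis x" unfolding cis_eq_iff by (rule exI[of _ "-k"]) simp
  ultimately show ?thesis by blast
qed

text \<open>Cutting the circle at \<open>cis \<phi>\<close> leaves an arc on which angles are
  ordered real numbers. Sorting them gives a labelling free of choices, available as long as the
  direction \<open>cis \<phi>\<close> is avoided.\<close>

lemma sorted_angles_exist:
  fixes t :: "nat \<Rightarrow> real"
  assumes "\<And>j. j < n \<Longrightarrow> cis (t j) \<noteq> cis \<phi>"
  shows "\<exists>u. (\<forall>i j. i \<le> j \<longrightarrow> j < n \<longrightarrow> u i \<le> u j) \<and> (\<forall>j<n. u j \<in> {\<phi><..<\<phi> + 2 * pi}) \<and>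
    (\<forall>z. (\<Prod>j<n. z - cis (u j)) = (\<Prod>j<n. z - cis (t j)))"
proof -
  obtain v where v: "\<And>x. \<phi> \<le> v x \<and> v x < \<phi> + 2 * pi \<and> cis (v x) = cis x"
    using cis_representative[of \<phi>] by metis
  define l where "l = sort (map (\<lambda>j. v (t j)) [0..<n])"
  have len: "length l = n" and sorted: "sorted l" by (auto simp: l_def)
  have "v (t j) \<in> {\<phi><..<\<phi> + 2 * pi}" if "j < n" for j
    using assms[OF that] v[of "t j"] by (cases "v (t j) = \<phi>") auto
  then have "set l \<subseteq> {\<phi><..<\<phi> + 2 * pi}" by (auto simp: l_def)
  then have rng: "\<forall>j<n. l ! j \<in> {\<phi><..<\<phi> + 2 * pi}" using len by (simp add: subset_code(1))
  have prd: "(\<Prod>j<n. z - cis (l ! j)) = (\<Prod>j<n. z - cis (t j))" for z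
  proof -
    have "(\<Prod>j<n. z - cis (l ! j)) = prod_list (map (\<lambda>x. z - cis x) l)"
      using len by (simp add: prod.list_conv_set_nth atLeast0LessThan)
    also have "mset (map (\<lambda>x. z - cis x) l) = mset (map (\<lambda>j. z - cis (v (t j))) [0..<n])"
      by (simp add: l_def image_mset.compositionality o_def)
    then have "prod_list (map (\<lambda>x. z - cis x) l) = prod_list (map (\<lambda>j. z - cis (v (t j))) [0..<n])"
      by (metis prod_mset_prod_list)
    also have "\<dots> = (\<Prod>j<n. z - cis (t j))"
      using v by (simp add: prod.list_conv_set_nth atLeast0LessThan)
    finally show ?thesis .
  qed
  have "\<forall>i j. i \<le> j \<longrightarrow> j < n \<longrightarrow> l ! i \<le> l ! j" using sorted_nth_mono[OF sorted] len by blast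
  then show ?thesis using rng prd by (intro exI[of _ "\<lambda>j. l ! j"]) blast
qed

text \<open>On the cut circle \<open>cis\<close> is injective, so equal products mean equal
  multisets of angles, and a sorted list is determined by its multiset.\<close>

lemma sorted_angles_unique:
  fixes u v :: "nat \<Rightarrow> real"
  assumes "\<And>i j. i \<le> j \<Longrightarrow> j < n \<Longrightarrow> u i \<le> u j" "\<And>i j. i \<le> j \<Longrightarrow> j < n \<Longrightarrow> v i \<le> v j"
    and "\<And>j. j < n \<Longrightarrow> u j \<in> {\<phi><..<\<phi> + 2 * pi}" "\<And>j. j < n \<Longrightarrow> v j \<in> {\<phi><..<\<phi> + 2 * pi}"
    and "\<And>z. (\<Prod>j<n. z - cis (u j)) = (\<Prod>j<n. z - cis (v j))" and "j < n"
  shows "u j = v j"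
proof -
  obtain p where p: "p permutes {..<n}" "\<And>j. j < n \<Longrightarrow> cis (u j) = cis (v (p j))"
    using prod_linear_eq_imp_permutes[OF assms(5)] by blast
  have "u j = v (p j)" if "j < n" for j
  proof -
    have "p j < n" using permutes_in_image[OF p(1), of j] that by simp
    then show ?thesis by (rule inj_onD[OF inj_on_cis p(2)[OF that] assms(3)[OF that] assms(4)])
  qed
  then have "map u [0..<n] = map v (map p [0..<n])" by simp
  then have "mset (map u [0..<n]) = mset (map v (map p [0..<n]))" by (rule arg_cong)
  also have "\<dots> = image_mset v (image_mset p (mset_set {..<n}))"
    by (simp only: mset_map mset_upt atLeast0LessThan)
  also have "image_mset p (mset_set {..<n}) = mset_set {..<n}"
    using p(1) by (simp add: image_mset_mset_set permutes_inj_on permutes_image)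
  finally have *: "mset (map v [0..<n]) = mset (map u [0..<n])" by (simp only: mset_map mset_upt atLeast0LessThan)
  have srt: "sorted (map f [0..<n])" if "\<And>i j. i \<le> j \<Longrightarrow> j < n \<Longrightarrow> f i \<le> f j" for f :: "nat \<Rightarrow> real"
    unfolding sorted_iff_nth_mono using that by simp
  have "sort (map u [0..<n]) = map v [0..<n]"
    by (rule properties_for_sort[OF * srt]) (rule assms(2))
  moreover have "sort (map u [0..<n]) = map u [0..<n]" by (rule sorted_sort_id[OF srt]) (rule assms(1))
  ultimately have "map u [0..<n] = map v [0..<n]" by simp
  then have "map u [0..<n] ! j = map v [0..<n] ! j" by (rule arg_cong)
  then show ?thesis using assms(6) by simp
qed

text \<open>Sequential compactness of a box, by refining the subsequence one coordinate at a
  time.\<close>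

lemma bounded_family_subsequence:
  fixes f :: "nat \<Rightarrow> nat \<Rightarrow> real"
  assumes "\<And>k j. j < n \<Longrightarrow> f k j \<in> {c..d}"
  shows "\<exists>r v. strict_mono r \<and> (\<forall>j<n. (\<lambda>k. f (r k) j) \<longlonglongrightarrow> v j)"
  using assms
proof (induction n)
  case 0
  show ?case by (rule exI[of _ id]) (auto simp: strict_mono_def)
next
  case (Suc n)
  then obtain r v where r: "strict_mono r" "\<forall>j<n. (\<lambda>k. f (r k) j) \<longlonglongrightarrow> v j"
    using less_SucI by blast
  have "\<forall>k. f (r k) n \<in> {c..d}" using Suc.prems by auto
  then obtain l s where s: "strict_mono s" "((\<lambda>k. f (r k) n) \<circ> s) \<longlonglongrightarrow> l"
    using compact_Icc[of c d, unfolded compact_def, THEN spec, of "\<lambda>k. f (r k) n"] by blast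
  have "\<forall>j<Suc n. (\<lambda>k. f ((r \<circ> s) k) j) \<longlonglongrightarrow> (v(n := l)) j"
    using r(2) s LIMSEQ_subseq_LIMSEQ[OF _ s(1)] by (auto simp: less_Suc_eq o_def)
  then show ?case using strict_mono_o[OF r(1) s(1)] by blast
qed

text \<open>
  The angles lie in the open arc that starts at the forbidden direction \<open>cis \<phi>\<close>. By compactness a
  subsequence converges in the closed arc, and its limit is the sorted list of angles of the limit
  polynomial.
\<close>
lemma sorted_angles_continuous:
  fixes u :: "real \<Rightarrow> nat \<Rightarrow> real"
  assumes mono: "\<And>s i j. s \<in> S \<Longrightarrow> i \<le> j \<Longrightarrow> j < n \<Longrightarrow> u s i \<le> u s j"
    and range: "\<And>s j. s \<in> S \<Longrightarrow> j < n \<Longrightarrow> u s j \<in> {\<phi><..<\<phi> + 2 * pi}"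
    and cont: "\<And>z. continuous_on S (\<lambda>s. \<Prod>j<n. z - cis (u s j))"
    and i: "i < n"
  shows "continuous_on S (\<lambda>s. u s i)"
  unfolding continuous_on_sequentially
proof (intro allI ballI impI, elim conjE)
  fix x s0 assume s0: "s0 \<in> S" and x: "\<forall>n. x n \<in> S" "x \<longlonglongrightarrow> s0"
  show "((\<lambda>s. u s i) \<circ> x) \<longlonglongrightarrow> u s0 i"
  proof (rule ccontr)
    assume "\<not> ?thesis"
    then obtain e where e: "e > 0" "\<exists>\<^sub>F k in sequentially. e \<le> dist (u (x k) i) (u s0 i)"
      by (auto simp: tendsto_iff not_eventually not_less)
    then obtain r0 :: "nat \<Rightarrow> nat" where r0: "strict_mono r0" "\<And>k. e \<le> dist (u (x (r0 k)) i) (u s0 i)"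
      using infinite_enumerate[of "{k. e \<le> dist (u (x k) i) (u s0 i)}"]
      unfolding cofinite_eq_sequentially[symmetric] INFM_iff_infinite by blast
    have "u (x (r0 k)) j \<in> {\<phi>..\<phi> + 2 * pi}" if "j < n" for k j
      using range[of "x (r0 k)" j] x(1) that by auto
    then obtain r v where r: "strict_mono r" "\<And>j. j < n \<Longrightarrow> (\<lambda>k. u (x (r0 (r k))) j) \<longlonglongrightarrow> v j"
      using bounded_family_subsequence[of n "\<lambda>k. u (x (r0 k))" \<phi> "\<phi> + 2 * pi"] by auto
    have xr: "(\<lambda>k. x (r0 (r k))) \<longlonglongrightarrow> s0"
      using LIMSEQ_subseq_LIMSEQ[OF x(2) strict_mono_o[OF r0(1) r(1)]] by (simp add: o_def)
    have P: "(\<Prod>j<n. z - cis (u s0 j)) = (\<Prod>j<n. z - cis (v j))" for z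
    proof -
      have "(\<lambda>k. \<Prod>j<n. z - cis (u (x (r0 (r k))) j)) \<longlonglongrightarrow> (\<Prod>j<n. z - cis (u s0 j))"
        using cont[of z, unfolded continuous_on_sequentially] s0 x(1) xr by (auto simp: o_def)
      moreover have "(\<lambda>k. \<Prod>j<n. z - cis (u (x (r0 (r k))) j)) \<longlonglongrightarrow> (\<Prod>j<n. z - cis (v j))"
        using r(2) by (intro tendsto_intros) (auto simp: cis_conv_exp intro!: tendsto_intros)
      ultimately show ?thesis using LIMSEQ_unique by blast
    qed
    have le: "v j \<in> {\<phi>..\<phi> + 2 * pi}" if "j < n" for j
      using r(2)[OF that] range[OF _ that] x(1)
      by (intro Lim_in_closed_set[of "{\<phi>..\<phi> + 2 * pi}" "\<lambda>k. u (x (r0 (r k))) j" sequentially])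
        (auto intro!: always_eventually simp: less_imp_le)
    \<comment> \<open>At \<open>cis \<phi>\<close> the limit product takes the value belonging to
      \<open>s0\<close>, which is not 0. Hence no limit angle escapes to an endpoint of the closed
      arc.\<close>
    have ne: "cis \<phi> \<noteq> cis (v j)" if "j < n" for j
    proof -
      have "(\<Prod>j<n. cis \<phi> - cis (u s0 j)) \<noteq> 0"
      proof -
        have "cis \<phi> \<noteq> cis (u s0 j)" if j: "j < n" for j
        proof
          assume "cis \<phi> = cis (u s0 j)"
          then obtain k::int where k: "u s0 j = \<phi> + 2 * pi * k" using cis_eq_iff by metis
          then have "0 < pi * k" "pi * k < pi * 1" using range[OF s0 j] by auto
          then have "0 < k" "real_of_int k < 1" by (simp_all add: zero_less_mult_iff)
          then show False by linarith
        qed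
        then show ?thesis by auto
      qed
      then show ?thesis unfolding P using that by auto
    qed
    have "v j \<noteq> \<phi>" "v j \<noteq> \<phi> + 2 * pi" if "j < n" for j
      using ne[OF that] cis_eq_iff[of \<phi> "v j"] by (auto dest: spec[of _ "-1::int"] spec[of _ "0::int"])
    then have rv: "v j \<in> {\<phi><..<\<phi> + 2 * pi}" if "j < n" for j
      using le[OF that] that by (auto simp: order_less_le)
    have mv: "v i \<le> v j" if "i \<le> j" "j < n" for i j
      using that mono x(1) by (intro LIMSEQ_le[OF r(2) r(2)]) auto
    have "u s0 i = v i"
      by (rule sorted_angles_unique[OF mono[OF s0] mv range[OF s0] rv P i])
    then have "(\<lambda>k. u (x (r0 (r k))) i) \<longlonglongrightarrow> u s0 i" using r(2)[OF i] by simp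
    then have "\<forall>\<^sub>F k in sequentially. dist (u (x (r0 (r k))) i) (u s0 i) < e" using e(1) by (simp add: tendsto_iff)
    then obtain k where "dist (u (x (r0 (r k))) i) (u s0 i) < e" by (auto simp: eventually_sequentially)
    then show False using r0(2)[of "r k"] by linarith
  qed
qed

lemma exists_cis_avoiding:
  assumes "finite F"
  obtains \<phi> where "cis \<phi> \<notin> F"
proof -
  have "inj_on cis {0<..<0 + 2 * pi}" by (rule inj_on_cis)
  moreover have "infinite {0<..<0 + 2 * pi}" by (simp add: infinite_Ioo_iff)
  ultimately have "infinite (cis ` {0<..<0 + 2 * pi})" by (simp add: finite_image_iff)
  then have "\<not> cis ` {0<..<0 + 2 * pi} \<subseteq> F" using assms finite_subset by auto
  then show ?thesis using that by auto
qed

text \<open>Bisection. At each point some direction avoids all eigenvalues, and by continuity of the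
  product it still does so on a small interval, where sorted angles serve. Adjacent intervals are
  glued by permuting the labels and adding full turns.\<close>

lemma continuous_angles:
  fixes t :: "real \<Rightarrow> nat \<Rightarrow> real"
  assumes "a \<le> b" and cont: "\<And>z. continuous_on {a..b} (\<lambda>s. \<Prod>j<n. z - cis (t s j))"
  shows "\<exists>\<theta> :: nat \<Rightarrow> real \<Rightarrow> real. (\<forall>j<n. continuous_on {a..b} (\<theta> j)) \<and>
    (\<forall>s\<in>{a..b}. \<forall>z. (\<Prod>j<n. z - cis (\<theta> j s)) = (\<Prod>j<n. z - cis (t s j)))"
proof -
  define Q where "Q c d \<theta> \<longleftrightarrow> (\<forall>j<n. continuous_on {c..d} (\<theta> j)) \<and>
      (\<forall>s\<in>{c..d}. \<forall>z. (\<Prod>j<n. z - cis (\<theta> j s)) = (\<Prod>j<n. z - cis (t s j)))"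
    for c d and \<theta> :: "nat \<Rightarrow> real \<Rightarrow> real"
  \<comment> \<open>Intervals that stick out of \<open>{a..b}\<close> satisfy \<open>R\<close>
    vacuously, because the local condition of \<open>Bolzano\<close> tests them too.\<close>
  define R where "R c d \<longleftrightarrow> (a \<le> c \<longrightarrow> c \<le> d \<longrightarrow> d \<le> b \<longrightarrow> (\<exists>\<theta>. Q c d \<theta>))" for c d
  have "R a b"
  proof (rule Bolzano[of a b R, OF \<open>a \<le> b\<close>])
    fix c d e assume trans: "R c d" "R d e" "c \<le> d" "d \<le> e"
    show "R c e" unfolding R_def
    proof (intro impI)
      assume "a \<le> c" "c \<le> e" "e \<le> b"
      then obtain \<theta> \<theta>' where Q: "Q c d \<theta>" "Q d e \<theta>'" using trans unfolding R_def by force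
      have "(\<Prod>j<n. z - cis (\<theta> j d)) = (\<Prod>j<n. z - cis (\<theta>' j d))" for z
        using Q trans unfolding Q_def by simp
      from prod_linear_eq_imp_permutes[OF this]
      obtain p where p: "p permutes {..<n}" "\<And>j. j < n \<Longrightarrow> cis (\<theta> j d) = cis (\<theta>' (p j) d)"
        by auto
      have pn: "p j < n" if "j < n" for j using permutes_in_image[OF p(1), of j] that by simp
      have "\<exists>k::int. \<theta> j d = \<theta>' (p j) d + 2 * pi * of_int k" if "j < n" for j
        using p(2)[OF that] by (simp add: cis_eq_iff)
      then obtain k :: "nat \<Rightarrow> int" where k: "j < n \<Longrightarrow> \<theta> j d = \<theta>' (p j) d + 2 * pi * of_int (k j)" for j
        by metis
      \<comment> \<open>\<open>p\<close> matches the eigenvalues of the two pieces at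
        \<open>d\<close>, and \<open>k\<close> counts the full turns between matched angles. After
        this correction the pieces agree at \<open>d\<close>.\<close>
      define \<psi> where "\<psi> j s = (if s \<le> d then \<theta> j s else \<theta>' (p j) s + 2 * pi * of_int (k j))" for j s
      have "continuous_on {c..e} (\<psi> j)" if "j < n" for j
      proof -
        have "continuous_on ({c..d} \<union> {d..e}) (\<psi> j)"
          unfolding \<psi>_def using k[OF that] Q that pn[OF that]
          by (intro continuous_on_If continuous_intros) (auto simp: Q_def)
        then show ?thesis using trans by (simp add: ivl_disj_un_two_touch)
      qed
      moreover have "(\<Prod>j<n. z - cis (\<psi> j s)) = (\<Prod>j<n. z - cis (t s j))" if "s \<in> {c..e}" for s z
      proof (cases "s \<le> d")
        case True
        then show ?thesis using Q that unfolding Q_def \<psi>_def by auto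
      next
        case False
        then have "cis (\<psi> j s) = cis (\<theta>' (p j) s)" for j by (auto simp: \<psi>_def cis_eq_iff)
        then have "(\<Prod>j<n. z - cis (\<psi> j s)) = (\<Prod>j<n. z - cis (\<theta>' (p j) s))" by simp
        also have "\<dots> = (\<Prod>j<n. z - cis (\<theta>' j s))"
          using prod.permute[OF p(1), of "\<lambda>j. z - cis (\<theta>' j s)"] by (simp add: o_def)
        finally show ?thesis using Q that False unfolding Q_def by auto
      qed
      ultimately have "Q c e \<psi>" by (simp add: Q_def)
      then show "\<exists>\<theta>. Q c e \<theta>" by (rule exI[of "Q c e"])
    qed
  next
    fix x assume local: "a \<le> x" "x \<le> b"
    obtain \<phi> where \<phi>: "cis \<phi> \<notin> (\<lambda>j. cis (t x j)) ` {..<n}"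
      using exists_cis_avoiding[of "(\<lambda>j. cis (t x j)) ` {..<n}"] by auto
    let ?F = "\<lambda>s. \<Prod>j<n. cis \<phi> - cis (t s j)"
    have "?F x \<noteq> 0" using \<phi> by force
    moreover have "(?F \<longlongrightarrow> ?F x) (at x within {a..b})"
      using cont[of "cis \<phi>"] local by (auto simp: continuous_on_def)
    ultimately have "\<forall>\<^sub>F s in at x within {a..b}. ?F s \<noteq> 0" by (rule tendsto_imp_eventually_ne[rotated])
    then obtain d where d: "d > 0" "\<And>s. s \<in> {a..b} \<Longrightarrow> dist s x < d \<Longrightarrow> ?F s \<noteq> 0"
      using \<open>?F x \<noteq> 0\<close> unfolding eventually_at by metis
    have "R c e" if ce: "c \<le> x \<and> x \<le> e \<and> e - c < d" for c e
      unfolding R_def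
    proof (intro impI)
      assume ace: "a \<le> c" "c \<le> e" "e \<le> b"
      have "cis (t s j) \<noteq> cis \<phi>" if "s \<in> {c..e}" "j < n" for s j
      proof -
        have "\<bar>s - x\<bar> < d" using that ce by (auto simp: abs_if)
        then have "?F s \<noteq> 0" using d(2)[of s] that ace by (auto simp: dist_real_def)
        then have "cis \<phi> \<noteq> cis (t s j)" using that by simp
        then show ?thesis by (rule not_sym)
      qed
      then have "\<forall>s\<in>{c..e}. \<exists>u. (\<forall>i j. i \<le> j \<longrightarrow> j < n \<longrightarrow> u i \<le> u j) \<and> (\<forall>j<n. u j \<in> {\<phi><..<\<phi> + 2 * pi}) \<and>
          (\<forall>z. (\<Prod>j<n. z - cis (u j)) = (\<Prod>j<n. z - cis (t s j)))"
        by (intro ballI sorted_angles_exist)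
      from bchoice[OF this] obtain u where
        *: "\<forall>s\<in>{c..e}. (\<forall>i j. i \<le> j \<longrightarrow> j < n \<longrightarrow> u s i \<le> u s j) \<and> (\<forall>j<n. u s j \<in> {\<phi><..<\<phi> + 2 * pi}) \<and>
          (\<forall>z. (\<Prod>j<n. z - cis (u s j)) = (\<Prod>j<n. z - cis (t s j)))" by (elim exE)
      then have u: "\<And>s i j. s \<in> {c..e} \<Longrightarrow> i \<le> j \<Longrightarrow> j < n \<Longrightarrow> u s i \<le> u s j"
        "\<And>s j. s \<in> {c..e} \<Longrightarrow> j < n \<Longrightarrow> u s j \<in> {\<phi><..<\<phi> + 2 * pi}"
        "\<And>s z. s \<in> {c..e} \<Longrightarrow> (\<Prod>j<n. z - cis (u s j)) = (\<Prod>j<n. z - cis (t s j))"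
        by simp_all
      have ctp: "continuous_on {c..e} (\<lambda>s. \<Prod>j<n. z - cis (u s j))" for z
        using continuous_on_subset[OF cont[of z], of "{c..e}"] ace
        by (subst continuous_on_cong[OF refl u(3)]) auto
      have ct: "continuous_on {c..e} (\<lambda>s. u s j)" if "j < n" for j
        by (rule sorted_angles_continuous[of "{c..e}" n u \<phi> j, OF u(1) u(2) ctp that])
      have "Q c e (\<lambda>j s. u s j)" unfolding Q_def using u(3) ct by simp
      then show "\<exists>\<theta>. Q c e \<theta>" by (rule exI[of "Q c e"])
    qed
    then show "\<exists>d>0. \<forall>c e. c \<le> x \<and> x \<le> e \<and> e - c < d \<longrightarrow> R c e" using d(1) by auto
  qed
  then show ?thesis using \<open>a \<le> b\<close> unfolding R_def Q_def by simp
qed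

section \<open>Ceilings of angles and where they jump\<close>

definition gap :: "real \<Rightarrow> real" where
  "gap x = \<lceil>x / (2 * pi)\<rceil> - x / (2 * pi)"

text \<open>A whole number of turns changes the ceiling and the subtracted linear term by the same
  integer, so the difference sees only the point on the circle.\<close>

lemma gap_cong: "cis x = cis y \<Longrightarrow> gap x = gap y"
proof -
  assume "cis x = cis y"
  then obtain k::int where "x = y + 2 * pi * k" using cis_eq_iff by auto
  then have "x / (2*pi) = y / (2*pi) + k" by (simp add: field_simps)
  then show ?thesis unfolding gap_def by simp
qed

lemma sum_gap_cong:
  fixes t u :: "nat \<Rightarrow> real"
  assumes "\<And>z. (\<Prod>j<n. z - cis (t j)) = (\<Prod>j<n. z - cis (u j))"
  shows "(\<Sum>j<n. gap (t j)) = (\<Sum>j<n. gap (u j))"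
proof -
  from prod_linear_eq_imp_permutes[OF assms]
  obtain p where p: "p permutes {..<n}" "\<And>j. j < n \<Longrightarrow> cis (t j) = cis (u (p j))" by auto
  have "(\<Sum>j<n. gap (t j)) = (\<Sum>j<n. gap (u (p j)))"
    by (intro sum.cong[OF refl] gap_cong p(2)) simp
  also have "\<dots> = (\<Sum>j<n. gap (u j))"
    using sum.permute[OF p(1), of "\<lambda>j. gap (u j)"] by (simp add: o_def)
  finally show ?thesis .
qed

lemma sum_ceiling_eq:
  fixes t :: "nat \<Rightarrow> real"
  shows "(\<Sum>j<n. real_of_int \<lceil>t j / (2 * pi)\<rceil>) = (\<Sum>j<n. gap (t j)) + (\<Sum>j<n. t j) / (2 * pi)"
  by (simp add: gap_def sum_subtractf sum_divide_distrib)

text \<open>Eigenangles are defined by multiplicities, but it is the products that vary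
  continuously; this passes between the two.\<close>

lemma card_eq_iff_prod_linear_eq:
  fixes x y :: "nat \<Rightarrow> complex"
  shows "(\<forall>z. card {j \<in> {..<n}. x j = z} = card {j \<in> {..<n}. y j = z}) \<longleftrightarrow>
    (\<forall>z. (\<Prod>j<n. z - x j) = (\<Prod>j<n. z - y j))" (is "?C \<longleftrightarrow> ?P")
proof
  assume ?C
  then have "image_mset x (mset_set {..<n}) = image_mset y (mset_set {..<n})"
    by (intro multiset_eqI) (simp add: count_image_mset_eq_card_vimage)
  then have "image_mset (\<lambda>w. z - w) (image_mset x (mset_set {..<n})) = image_mset (\<lambda>w. z - w) (image_mset y (mset_set {..<n}))" for z
    by simp
  then show ?P by (simp add: prod_unfold_prod_mset image_mset.compositionality o_def)
next
  assume ?P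
  then have "image_mset x (mset_set {..<n}) = image_mset y (mset_set {..<n})"
    by (intro prod_linear_eq_imp_mset_eq) simp
  then have "count (image_mset x (mset_set {..<n})) z = count (image_mset y (mset_set {..<n})) z" for z
    by simp
  then show ?C by (simp add: count_image_mset_eq_card_vimage)
qed

lemma locally_constant_on_interval:
  fixes f :: "real \<Rightarrow> 'a"
  assumes "\<And>x. x \<in> {a..b} \<Longrightarrow> \<forall>\<^sub>F s in at x within {a..b}. f s = f x" and "s \<in> {a..b}"
  shows "f s = f a"
proof -
  define R where "R c d \<longleftrightarrow> (a \<le> c \<longrightarrow> c \<le> d \<longrightarrow> d \<le> b \<longrightarrow> f c = f d)" for c d
  have "R a s"
  proof (rule Bolzano[of a s R])
    show "a \<le> s" using assms(2) by simp
  next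
    fix c d e assume "R c d" "R d e" "c \<le> d" "d \<le> e"
    then show "R c e" unfolding R_def by auto
  next
    fix x assume "a \<le> x" "x \<le> s"
    then have x: "x \<in> {a..b}" using assms(2) by auto
    from assms(1)[OF x] obtain d where d: "d > 0" "\<And>s. s \<in> {a..b} \<Longrightarrow> s \<noteq> x \<Longrightarrow> dist s x < d \<Longrightarrow> f s = f x"
      unfolding eventually_at by auto
    have "R c e" if "c \<le> x \<and> x \<le> e \<and> e - c < d" for c e
      unfolding R_def
    proof (intro impI)
      assume "a \<le> c" "c \<le> e" "e \<le> b"
      then have "f c = f x" "f e = f x"
        using d(2)[of c] d(2)[of e] that by (cases "c = x"; cases "e = x"; simp add: dist_real_def)+
      then show "f c = f e" by simp
    qed
    then show "\<exists>d>0. \<forall>c e. c \<le> x \<and> x \<le> e \<and> e - c < d \<longrightarrow> R c e" using d(1) by auto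
  qed
  then show ?thesis using assms(2) unfolding R_def by auto
qed

text \<open>Values closer than pi to \<open>f x\<close> lie in an arc on which \<open>cis\<close> is
  injective.\<close>

lemma eventually_eq_of_cis_eq:
  fixes f :: "real \<Rightarrow> real"
  assumes "(f \<longlongrightarrow> f x) F" and "\<forall>\<^sub>F s in F. cis (f s) = cis (f x)"
  shows "\<forall>\<^sub>F s in F. f s = f x"
proof -
  have "\<forall>\<^sub>F s in F. dist (f s) (f x) < pi"
    using assms(1) pi_gt_zero unfolding tendsto_iff by simp
  with assms(2) show ?thesis
  proof eventually_elim
    case (elim s)
    show ?case by (rule inj_onD[OF inj_on_cis[of "f x - pi"] elim(1)]) (use elim(2) in \<open>auto simp: dist_real_def\<close>)
  qed
qed

text \<open>Determinant identities fix a combination of total angles only modulo full turns. Along a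
  continuous path this is enough to fix its increment.\<close>

lemma cis_constant_imp_constant:
  fixes f :: "real \<Rightarrow> real"
  assumes "continuous_on {a..b} f" and "\<And>s. s \<in> {a..b} \<Longrightarrow> cis (f s) = c" and "s \<in> {a..b}"
  shows "f s = f a"
proof (rule locally_constant_on_interval[OF _ assms(3)])
  fix x assume x: "x \<in> {a..b}"
  show "\<forall>\<^sub>F s in at x within {a..b}. f s = f x"
  proof (rule eventually_eq_of_cis_eq)
    show "(f \<longlongrightarrow> f x) (at x within {a..b})" using assms(1) x by (simp add: continuous_on_def)
    show "\<forall>\<^sub>F s in at x within {a..b}. cis (f s) = cis (f x)"
      using assms(2) x by (auto simp: eventually_at_filter)
  qed
qed

lemma cis_eq_1_iff: "cis x = 1 \<longleftrightarrow> (\<exists>k::int. x / (2 * pi) = of_int k)"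
  using cis_eq_iff[of x 0] by (simp add: field_simps)

lemma eventually_ceiling_eq:
  fixes f :: "real \<Rightarrow> real"
  assumes "(f \<longlongrightarrow> f x) F" and "cis (f x) \<noteq> 1"
  shows "\<forall>\<^sub>F s in F. \<lceil>f s / (2 * pi)\<rceil> = \<lceil>f x / (2 * pi)\<rceil> \<and> cis (f s) \<noteq> 1"
proof -
  let ?k = "\<lceil>f x / (2 * pi)\<rceil>"
  have lim: "((\<lambda>s. f s / (2 * pi)) \<longlongrightarrow> f x / (2 * pi)) F" by (intro tendsto_intros assms(1)) simp
  have "f x / (2 * pi) \<noteq> of_int ?k" using assms(2) unfolding cis_eq_1_iff by metis
  then have "f x / (2 * pi) < of_int ?k" by linarith
  moreover have "of_int ?k - 1 < f x / (2 * pi)" by linarith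
  ultimately have "\<forall>\<^sub>F s in F. f s / (2 * pi) < of_int ?k" "\<forall>\<^sub>F s in F. of_int ?k - 1 < f s / (2 * pi)"
    using order_tendstoD[OF lim] by blast+
  then show ?thesis
  proof eventually_elim
    case (elim s)
    have "\<lceil>f s / (2 * pi)\<rceil> = ?k" using elim by linarith
    moreover have "f s / (2 * pi) \<noteq> of_int k" for k
    proof
      assume eq: "f s / (2 * pi) = of_int k"
      have "real_of_int k < of_int ?k" "of_int (?k - 1) < real_of_int k" using elim unfolding eq by simp_all
      then show False unfolding of_int_less_iff by simp
    qed
    ultimately show ?case unfolding cis_eq_1_iff by simp
  qed
qed

text \<open>An angle off 2 pi Z keeps its ceiling and stays off for a while. As the number of angles
  in 2 pi Z cannot drop either, those that are in 2 pi Z must remain there, and by continuity they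
  do not move at all.\<close>

lemma eventually_ceiling_eq_of_card:
  fixes \<theta> :: "nat \<Rightarrow> real \<Rightarrow> real"
  assumes lim: "\<And>j. j < n \<Longrightarrow> (\<theta> j \<longlongrightarrow> \<theta> j x) (at x within S)"
    and card: "\<And>s. s \<in> S \<Longrightarrow> card {j \<in> {..<n}. cis (\<theta> j s) = 1} = m" and x: "x \<in> S"
  shows "\<forall>\<^sub>F s in at x within S. \<forall>j<n. \<lceil>\<theta> j s / (2 * pi)\<rceil> = \<lceil>\<theta> j x / (2 * pi)\<rceil>"
proof -
  let ?Z = "\<lambda>s. {j \<in> {..<n}. cis (\<theta> j s) = 1}"
  have 1: "\<forall>\<^sub>F s in at x within S. \<forall>j\<in>{..<n} - ?Z x. \<lceil>\<theta> j s / (2 * pi)\<rceil> = \<lceil>\<theta> j x / (2 * pi)\<rceil> \<and> cis (\<theta> j s) \<noteq> 1"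
    by (intro eventually_ball_finite ballI eventually_ceiling_eq lim) auto
  have "\<forall>\<^sub>F s in at x within S. s \<in> S" by (simp add: eventually_at_filter)
  with 1 have 2: "\<forall>\<^sub>F s in at x within S. ?Z s = ?Z x"
  proof eventually_elim
    case (elim s)
    have "?Z s \<subseteq> ?Z x" using elim(1) by auto
    then show ?case using card[OF x] card[OF elim(2)] by (intro card_subset_eq) auto
  qed
  have "\<forall>\<^sub>F s in at x within S. \<forall>j\<in>?Z x. \<theta> j s = \<theta> j x"
  proof (intro eventually_ball_finite ballI)
    fix j assume j: "j \<in> ?Z x"
    show "\<forall>\<^sub>F s in at x within S. \<theta> j s = \<theta> j x"
    proof (rule eventually_eq_of_cis_eq)
      show "(\<theta> j \<longlongrightarrow> \<theta> j x) (at x within S)" using lim j by simp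
      show "\<forall>\<^sub>F s in at x within S. cis (\<theta> j s) = cis (\<theta> j x)"
        using 2
      proof eventually_elim
        case (elim s)
        then have "j \<in> ?Z s" using j by simp
        then show ?case using j by simp
      qed
    qed
  qed simp
  with 1 show ?thesis
  proof eventually_elim
    case (elim s)
    show ?case
    proof (intro allI impI)
      fix j assume "j < n"
      then show "\<lceil>\<theta> j s / (2 * pi)\<rceil> = \<lceil>\<theta> j x / (2 * pi)\<rceil>"
        using elim by (cases "j \<in> ?Z x") auto
    qed
  qed
qed

lemma sum_ceiling_constant:
  fixes \<theta> :: "nat \<Rightarrow> real \<Rightarrow> real"
  assumes "\<And>j. j < n \<Longrightarrow> continuous_on {a..b} (\<theta> j)"
    and "\<And>s. s \<in> {a..b} \<Longrightarrow> card {j \<in> {..<n}. cis (\<theta> j s) = 1} = m" and "s \<in> {a..b}"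
  shows "(\<Sum>j<n. \<lceil>\<theta> j s / (2 * pi)\<rceil>) = (\<Sum>j<n. \<lceil>\<theta> j a / (2 * pi)\<rceil>)"
proof (rule locally_constant_on_interval[where f = "\<lambda>s. \<Sum>j<n. \<lceil>\<theta> j s / (2 * pi)\<rceil>", OF _ assms(3)])
  fix x assume x: "x \<in> {a..b}"
  have "\<forall>\<^sub>F s in at x within {a..b}. \<forall>j<n. \<lceil>\<theta> j s / (2 * pi)\<rceil> = \<lceil>\<theta> j x / (2 * pi)\<rceil>"
    by (rule eventually_ceiling_eq_of_card[OF _ assms(2) x]) (use assms(1) x in \<open>auto simp: continuous_on_def\<close>)
  then show "\<forall>\<^sub>F s in at x within {a..b}. (\<Sum>j<n. \<lceil>\<theta> j s / (2 * pi)\<rceil>) = (\<Sum>j<n. \<lceil>\<theta> j x / (2 * pi)\<rceil>)"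
    by eventually_elim simp
qed

section \<open>Hermitian forms and the spectral theorem\<close>

locale complex_fdvs = finite_dimensional_vector_space scale Basis
  for scale :: "complex \<Rightarrow> 'v::ab_group_add \<Rightarrow> 'v" and Basis :: "'v set"
begin

text \<open>Linearity is asked on \<open>P\<close> only, since operators such as the later
  \<open>W\<close> are built by choice and are controlled nowhere else.\<close>

definition endo :: "'v set \<Rightarrow> ('v \<Rightarrow> 'v) \<Rightarrow> bool" where
  "endo P T \<longleftrightarrow> (\<forall>x\<in>P. T x \<in> P) \<and> (\<forall>x\<in>P. \<forall>y\<in>P. T (x + y) = T x + T y) \<and>
     (\<forall>c. \<forall>x\<in>P. T (scale c x) = scale c (T x))"

lemma additive_sum:
  fixes T :: "'v \<Rightarrow> 'v"
  assumes "subspace P" "\<And>i. i \<in> A \<Longrightarrow> f i \<in> P"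
    and add: "\<And>x y. x \<in> P \<Longrightarrow> y \<in> P \<Longrightarrow> T (x + y) = T x + T y"
  shows "T (\<Sum>i\<in>A. f i) = (\<Sum>i\<in>A. T (f i))"
proof -
  have T0: "T 0 = 0" using add[of 0 0] subspace_0[OF assms(1)] by simp
  show ?thesis
  proof (cases "finite A")
    case True
    then show ?thesis using assms(2)
    proof (induction A)
      case (insert x A)
      have "(\<Sum>i\<in>A. f i) \<in> P" by (rule subspace_sum[OF assms(1)]) (simp add: insert.prems)
      then show ?case using insert add by simp
    qed (simp add: T0)
  qed (simp add: T0)
qed

lemma endo_sum:
  assumes "endo P T" "subspace P" "\<And>i. i \<in> A \<Longrightarrow> f i \<in> P"
  shows "T (\<Sum>i\<in>A. f i) = (\<Sum>i\<in>A. T (f i))"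
  using assms(1) by (intro additive_sum[OF assms(2,3)]) (simp_all add: endo_def)

lemma endo_diff: "endo P T \<Longrightarrow> subspace P \<Longrightarrow> x \<in> P \<Longrightarrow> y \<in> P \<Longrightarrow> T (x - y) = T x - T y"
  unfolding endo_def using subspace_diff by (metis diff_add_cancel add_diff_cancel_right')

text \<open>Meant for the iterates of an operator on a vector: there are more of them than the
  dimension. A repetition is treated apart, because linear dependence is a property of sets and a
  set would merge equal terms.\<close>

lemma polynomial_relation:
  fixes it :: "nat \<Rightarrow> 'v"
  obtains c :: "nat \<Rightarrow> complex" and N k
  where "k \<le> N" "c k \<noteq> 0" "(\<Sum>i\<le>N. scale (c i) (it i)) = 0"
proof (cases "inj_on it {..dim UNIV}")
  case True
  let ?N = "dim UNIV"
  have "dependent (it ` {..?N})"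
  proof (rule dependent_biggerset_general)
    have "card (it ` {..?N}) = Suc ?N" using True by (simp add: card_image)
    then show "dim (it ` {..?N}) < card (it ` {..?N})" using dim_subset_UNIV[of "it ` {..?N}"] by (simp add: dimension_def)
  qed
  then obtain u v where u: "v \<in> it ` {..?N}" "u v \<noteq> 0" "(\<Sum>v\<in>it ` {..?N}. scale (u v) v) = 0"
    by (subst (asm) dependent_finite) auto
  then obtain k where "k \<le> ?N" "v = it k" by auto
  moreover have "(\<Sum>i\<le>?N. scale (u (it i)) (it i)) = 0" using u(3) True by (simp add: sum.reindex)
  ultimately show ?thesis using u(2) by (intro that[of k ?N "\<lambda>i. u (it i)"]) simp_all
next
  case False
  then obtain i j where ij: "i \<le> dim UNIV" "j \<le> dim UNIV" "i \<noteq> j" "it i = it j" by (auto simp: inj_on_def)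
  let ?c = "\<lambda>k. if k = i then 1 else if k = j then -1 else 0 :: complex"
  have "(\<Sum>k\<le>dim UNIV. scale (?c k) (it k)) = (\<Sum>k\<in>{i, j}. scale (?c k) (it k))"
    using ij by (intro sum.mono_neutral_right) auto
  also have "\<dots> = 0" using ij by simp
  finally show ?thesis using ij(1) by (intro that[of i "dim UNIV" ?c]) simp_all
qed

text \<open>Some nonzero polynomial in \<open>T\<close> kills \<open>x0\<close>. Its linear factors
  are stripped off one by one; the first time the remaining \<open>ev q\<close> is not 0, the factor
  just removed kills it, so it is an eigenvector. It lies in \<open>P\<close> because
  \<open>P\<close> is invariant.\<close>

lemma eigenvector_exists:
  assumes P: "subspace P" and T: "endo P T" and x0: "x0 \<in> P" "x0 \<noteq> 0"
  shows "\<exists>x c. x \<in> P \<and> x \<noteq> 0 \<and> T x = scale c x"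
proof -
  define it where "it i = (T ^^ i) x0" for i
  have it_P: "it i \<in> P" for i unfolding it_def by (induction i) (use T x0 in \<open>auto simp: endo_def\<close>)
  have it_Suc: "it (Suc i) = T (it i)" for i by (simp add: it_def)
  define ev where "ev p = (\<Sum>i\<le>degree p. scale (coeff p i) (it i))" for p
  have ev_bound: "ev p = (\<Sum>i\<le>N. scale (coeff p i) (it i))" if "degree p \<le> N" for p N
    unfolding ev_def using that by (intro sum.mono_neutral_left) (auto simp: coeff_eq_0)
  have ev_P: "ev p \<in> P" for p
    unfolding ev_def by (intro subspace_sum[OF P] subspace_scale[OF P] it_P)
  have ev_pCons: "ev (pCons 0 q) = T (ev q)" for q
  proof -
    have "ev (pCons 0 q) = (\<Sum>i\<le>Suc (degree q). scale (coeff (pCons 0 q) i) (it i))"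
      by (rule ev_bound) (rule degree_pCons_le)
    also have "\<dots> = (\<Sum>i\<le>degree q. scale (coeff q i) (it (Suc i)))"
      by (subst sum.atMost_Suc_shift) simp
    also have "\<dots> = (\<Sum>i\<le>degree q. T (scale (coeff q i) (it i)))"
      using T it_P by (simp add: it_Suc endo_def)
    also have "\<dots> = T (ev q)"
      unfolding ev_def by (rule endo_sum[OF T P, symmetric]) (intro subspace_scale[OF P] it_P)
    finally show ?thesis .
  qed
  have ev_diff: "ev (p - Polynomial.smult r q) = ev p - scale r (ev q)" for p r q
  proof -
    let ?N = "max (degree p) (degree q)"
    have d: "degree (p - Polynomial.smult r q) \<le> ?N"
      by (meson degree_diff_le_max degree_smult_le max.mono order_refl order_trans)
    show ?thesis
      unfolding ev_bound[OF d] ev_bound[of p ?N, OF max.cobounded1] ev_bound[of q ?N, OF max.cobounded2]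
      by (simp add: scale_left_diff_distrib sum_subtractf scale_sum_right)
  qed
  obtain c :: "nat \<Rightarrow> complex" and N k where c: "k \<le> N" "c k \<noteq> 0" "(\<Sum>i\<le>N. scale (c i) (it i)) = 0"
    by (rule polynomial_relation[of it])
  define p where "p = (\<Sum>i\<le>N. monom (c i) i)"
  have coeff_p: "coeff p i = (if i \<le> N then c i else 0)" for i
    by (simp add: p_def coeff_sum)
  have "degree p \<le> N" by (rule degree_le) (simp add: coeff_p)
  then have p0: "ev p = 0" using c(3) by (simp add: ev_bound[of p N] coeff_p)
  have pne: "p \<noteq> 0" using c(1,2) coeff_p[of k] by auto
  have "p \<noteq> 0 \<Longrightarrow> ev p = 0 \<Longrightarrow> ?thesis" for p
  proof (induction "degree p" arbitrary: p rule: less_induct)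
    case less
    show ?case
    proof (cases "degree p = 0")
      case True
      then obtain a where a: "p = [:a:]" by (rule degree_eq_zeroE)
      then show ?thesis using less.prems x0 by (simp add: ev_def it_def)
    next
      case False
      then have "\<not> constant (poly p)" by (simp add: constant_degree)
      then obtain r where "poly p r = 0" using fundamental_theorem_of_algebra by auto
      then obtain q where q: "p = [:-r, 1:] * q" by (auto simp: poly_eq_0_iff_dvd)
      have q0: "q \<noteq> 0" using q less.prems by auto
      have "degree q < degree p" unfolding q using q0 by (subst degree_mult_eq) auto
      have "ev p = ev (pCons 0 q - Polynomial.smult r q)" unfolding q by simp
      also have "\<dots> = T (ev q) - scale r (ev q)" by (simp only: ev_diff ev_pCons)
      finally have e: "T (ev q) = scale r (ev q)" using less.prems by simp
      show ?thesis
      proof (cases "ev q = 0")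
        case True
        show ?thesis by (rule less.hyps[OF \<open>degree q < degree p\<close> q0 True])
      next
        case False
        then show ?thesis using e ev_P by (intro exI[of _ "ev q"] exI[of _ r]) simp
      qed
    qed
  qed
  then show ?thesis using p0 pne by simp
qed

end

text \<open>Positivity is not built in: the forms -i \<omega> and i \<omega> are indefinite in
  general, and each is definite on one half of a polarization. Hence \<open>positive_on\<close> is a
  property of a subspace.\<close>

locale hermitian_form = complex_fdvs scale Basis
  for scale :: "complex \<Rightarrow> 'v::ab_group_add \<Rightarrow> 'v" and Basis :: "'v set" +
  fixes g :: "'v \<Rightarrow> 'v \<Rightarrow> complex"
  assumes sesq: "sesquilinear scale g" and herm: "\<And>x y. g y x = cnj (g x y)"
begin

lemma g_add: "g (x + y) z = g x z + g y z" "g z (x + y) = g z x + g z y"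
  and g_scale: "g (scale c x) z = c * g x z" "g z (scale c x) = cnj c * g z x"
  using sesq unfolding sesquilinear_def by simp_all

lemma g_0 [simp]: "g 0 z = 0" "g z 0 = 0"
  using g_scale(1)[of 0 0 z] g_scale(2)[of z 0 0] by simp_all

lemma g_minus: "g (- x) z = - g x z" "g z (- x) = - g z x"
  using g_add(1)[of x "- x" z] g_add(2)[of z x "- x"] by (simp_all add: add_eq_0_iff)

lemma g_diff: "g (x - y) z = g x z - g y z" "g z (x - y) = g z x - g z y"
  using g_add(1)[of x "- y" z] g_add(2)[of z x "- y"] by (simp_all add: g_minus)

lemma g_sum: "g (\<Sum>i\<in>A. f i) z = (\<Sum>i\<in>A. g (f i) z)" "g z (\<Sum>i\<in>A. f i) = (\<Sum>i\<in>A. g z (f i))"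
  by (induction A rule: infinite_finite_induct) (simp_all add: g_add)

lemmas g_simps = g_add g_scale g_minus g_diff g_sum

lemma g_self_real: "g x x = of_real (Re (g x x))"
  using herm[of x x] by (simp add: complex_eq_iff)

definition orthobasis :: "'v set \<Rightarrow> (nat \<Rightarrow> 'v) \<Rightarrow> nat \<Rightarrow> bool" where
  "orthobasis P e m \<longleftrightarrow> (\<forall>i<m. \<forall>j<m. g (e i) (e j) = (if i = j then 1 else 0)) \<and> P = span (e ` {..<m})"

definition positive_on :: "'v set \<Rightarrow> bool" where
  "positive_on P \<longleftrightarrow> subspace P \<and> (\<forall>x\<in>P. x \<noteq> 0 \<longrightarrow> 0 < Re (g x x))"

lemma orthobasis_orthonormal: "orthobasis P e m \<Longrightarrow> i < m \<Longrightarrow> j < m \<Longrightarrow> g (e i) (e j) = (if i = j then 1 else 0)"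
  by (simp add: orthobasis_def)

lemma orthobasis_mem: "orthobasis P e m \<Longrightarrow> i < m \<Longrightarrow> e i \<in> P"
  by (simp add: orthobasis_def span_base)

lemma orthobasis_expand:
  assumes "orthobasis P e m" "x \<in> P"
  shows "x = (\<Sum>k<m. scale (g x (e k)) (e k))"
proof -
  let ?S = "{x. x = (\<Sum>k<m. scale (g x (e k)) (e k))}"
  have "span (e ` {..<m}) \<subseteq> ?S"
  proof (rule span_minimal)
    show "subspace ?S"
    proof (rule subspaceI)
      fix x y assume "x \<in> ?S" "y \<in> ?S"
      then have X: "(\<Sum>k<m. scale (g x (e k)) (e k)) = x" and Y: "(\<Sum>k<m. scale (g y (e k)) (e k)) = y" by simp_all
      have "(\<Sum>k<m. scale (g (x + y) (e k)) (e k)) = x + y"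
        by (simp only: g_add scale_left_distrib sum.distrib X Y)
      then show "x + y \<in> ?S" by simp
    next
      fix c x assume "x \<in> ?S"
      then have X: "(\<Sum>k<m. scale (g x (e k)) (e k)) = x" by simp
      have "(\<Sum>k<m. scale (g (scale c x) (e k)) (e k)) = scale c x"
        by (simp only: g_scale scale_scale[symmetric] scale_sum_right[symmetric] X)
      then show "scale c x \<in> ?S" by simp
    qed simp
  next
    show "e ` {..<m} \<subseteq> ?S"
    proof
    fix x assume "x \<in> e ` {..<m}"
    then obtain i where i: "i < m" "x = e i" by auto
    have "(\<Sum>k<m. scale (g (e i) (e k)) (e k)) = (\<Sum>k<m. if k = i then e k else 0)"
      using i(1) by (intro sum.cong) (auto simp: orthobasis_orthonormal[OF assms(1)])
    then show "x \<in> ?S" using i by simp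
    qed
  qed
  then show ?thesis using assms by (auto simp: orthobasis_def)
qed

lemma orthobasis_coeff:
  assumes "orthobasis P e m" "k < m"
  shows "g (\<Sum>i<m. scale (c i) (e i)) (e k) = c k"
proof -
  have "g (\<Sum>i<m. scale (c i) (e i)) (e k) = (\<Sum>i<m. if i = k then c i else 0)"
    unfolding g_simps using assms by (intro sum.cong) (auto simp: orthobasis_orthonormal)
  then show ?thesis using assms(2) by simp
qed

lemma orthobasis_inj: 
  assumes "orthobasis P e m"
  shows "inj_on e {..<m}"
proof (rule inj_onI)
  fix i j assume "i \<in> {..<m}" "j \<in> {..<m}" "e i = e j"
  then have "(if i = j then 1 else 0 :: complex) = 1"
    using orthobasis_orthonormal[OF assms, of i j] orthobasis_orthonormal[OF assms, of j j] by simp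
  then show "i = j" by (metis zero_neq_one)
qed

lemma orthobasis_independent:
  assumes "orthobasis P e m" "A \<subseteq> {..<m}"
  shows "independent (e ` A)" "dim (span (e ` A)) = card A"
proof -
  have fin: "finite A" using assms(2) finite_subset by auto
  have inj: "inj_on e A" using orthobasis_inj[OF assms(1)] assms(2) by (rule inj_on_subset)
  show "independent (e ` A)"
  proof (rule independent_if_scalars_zero)
    fix f x assume *: "(\<Sum>x\<in>e ` A. scale (f x) x) = 0" "x \<in> e ` A"
    then obtain k where k: "k \<in> A" "x = e k" by auto
    have "0 = g (\<Sum>x\<in>e ` A. scale (f x) x) (e k)" using * by simp
    also have "\<dots> = (\<Sum>i\<in>A. f (e i) * g (e i) (e k))" by (simp add: sum.reindex[OF inj] g_simps)
    also have "\<dots> = (\<Sum>i\<in>A. if i = k then f (e i) else 0)"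
      using assms k by (intro sum.cong) (auto simp: orthobasis_orthonormal subset_iff)
    also have "\<dots> = f x" using k fin by simp
    finally show "f x = 0" by simp
  qed (use fin in simp)
  then show "dim (span (e ` A)) = card A"
    by (simp add: dim_eq_card_independent card_image[OF inj])
qed

lemma orthobasis_dim: "orthobasis P e m \<Longrightarrow> dim P = m"
  using orthobasis_independent(2)[of P e m "{..<m}"] by (simp add: orthobasis_def)

lemma orthobasis_inner:
  assumes "orthobasis P e m" "x \<in> P" 
  shows "g x y = (\<Sum>k<m. g x (e k) * g (e k) y)"
  using arg_cong[OF orthobasis_expand[OF assms], of "\<lambda>z. g z y"] by (simp add: g_simps)

lemma orthobasis_eqI:
  assumes "orthobasis P e m" "x \<in> P" "y \<in> P" "\<And>k. k < m \<Longrightarrow> g x (e k) = g y (e k)"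
  shows "x = y"
  using orthobasis_expand[OF assms(1,2)] orthobasis_expand[OF assms(1,3)] assms(4) by simp

text \<open>The last assumption makes the orthogonal complement of an eigenvector invariant, which
  is what unitary and Hermitian operators have in common. Induction on the dimension then splits off
  one normalized eigenvector at a time.\<close>

lemma spectral:
  assumes "positive_on P" "endo P T"
    and "\<And>x y c. x \<in> P \<Longrightarrow> y \<in> P \<Longrightarrow> x \<noteq> 0 \<Longrightarrow> T x = scale c x \<Longrightarrow> g y x = 0 \<Longrightarrow> g (T y) x = 0"
  shows "\<exists>e r. orthobasis P e (dim P) \<and> (\<forall>k<dim P. T (e k) = scale (r k) (e k))"
proof -
  have "\<exists>m e r. orthobasis P e m \<and> (\<forall>k<m. T (e k) = scale (r k) (e k))"
    using assms
  proof (induction "dim P" arbitrary: P rule: less_induct)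
    case less
    have sub: "subspace P" using less.prems(1) by (simp add: positive_on_def)
    show ?case
    proof (cases "P = {0}")
      case True
      then have "orthobasis P (\<lambda>_. 0) 0" by (simp add: orthobasis_def)
      then show ?thesis by (intro exI[of _ 0] exI[of _ "\<lambda>_. 0"]) simp
    next
      case False
      then obtain x0 where x0: "x0 \<in> P" "x0 \<noteq> 0" using subspace_0[OF sub] by auto
      obtain x c where x: "x \<in> P" "x \<noteq> 0" "T x = scale c x"
        using eigenvector_exists[OF sub less.prems(2) x0] by auto
      define a where "a = sqrt (Re (g x x))"
      have pos: "0 < Re (g x x)" using less.prems(1) x by (simp add: positive_on_def)
      then have aa: "a * a = Re (g x x)" by (simp add: a_def)
      have a: "0 < a" "g x x = of_real (a * a)"
        using pos unfolding aa by (simp_all add: a_def g_self_real[symmetric])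
      define e0 where "e0 = scale (of_real (1 / a)) x"
      have e0: "e0 \<in> P" "g e0 e0 = 1" "T e0 = scale c e0"
        unfolding e0_def using x a sub less.prems(2)
        by (simp_all add: subspace_scale g_scale endo_def scale_left_commute mult.commute)
      then have e0_ne: "e0 \<noteq> 0" by auto
      define P' where "P' = {y \<in> P. g y e0 = 0}"
      have P': "subspace P'" "P' \<subseteq> P" unfolding P'_def using sub
        by (auto intro!: subspaceI simp: subspace_0 subspace_add subspace_scale g_simps)
      have pos': "positive_on P'" using less.prems(1) P' by (auto simp: positive_on_def)
      have endo': "endo P' T"
        using less.prems(2) less.prems(3)[OF e0(1) _ e0_ne e0(3)] unfolding endo_def P'_def by simp
      have "e0 \<notin> P'" using e0 by (simp add: P'_def)
      then have "span P' \<subset> span P" using P' sub e0(1) by (auto simp: span_eq_iff[THEN iffD2])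
      then have lt: "dim P' < dim P" by (rule dim_psubset)
      have orth': "g (T y) x = 0" if "x \<in> P'" "y \<in> P'" "x \<noteq> 0" "T x = scale c x" "g y x = 0" for x y c
        using less.prems(3)[of x y c] that P'(2) by auto
      have "\<exists>m e r. orthobasis P' e m \<and> (\<forall>k<m. T (e k) = scale (r k) (e k))"
        by (rule less.hyps[OF lt pos' endo' orth'])
      then obtain m e r where IH: "orthobasis P' e m" "\<And>k. k < m \<Longrightarrow> T (e k) = scale (r k) (e k)"
        by auto
      have mem: "e k \<in> P'" if "k < m" for k using orthobasis_mem[OF IH(1) that] .
      have "g (e k) e0 = 0" "g e0 (e k) = 0" if "k < m" for k
        using mem[OF that] herm[of "e k" e0] by (simp_all add: P'_def)
      then have on: "\<forall>i<Suc m. \<forall>j<Suc m. g ((e(m := e0)) i) ((e(m := e0)) j) = (if i = j then 1 else 0)"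
        using e0(2) orthobasis_orthonormal[OF IH(1)] by (auto simp: less_Suc_eq)
      have im: "(e(m := e0)) ` {..<Suc m} = insert e0 (e ` {..<m})"
        by (auto simp: lessThan_Suc)
      have "P = span (insert e0 (e ` {..<m}))"
      proof
        show "P \<subseteq> span (insert e0 (e ` {..<m}))"
        proof
          fix y assume y: "y \<in> P"
          have "y - scale (g y e0) e0 \<in> P'" unfolding P'_def using y e0 sub
            by (simp add: subspace_diff subspace_scale g_simps)
          then have "y - scale (g y e0) e0 \<in> span (e ` {..<m})" using IH(1) by (simp add: orthobasis_def)
          then show "y \<in> span (insert e0 (e ` {..<m}))" unfolding span_insert by auto
        qed
        show "span (insert e0 (e ` {..<m})) \<subseteq> P"
          using e0(1) mem P'(2) sub by (intro span_minimal) auto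
      qed
      then have "orthobasis P (e(m := e0)) (Suc m)" unfolding orthobasis_def im using on by simp
      moreover have "\<forall>k<Suc m. T ((e(m := e0)) k) = scale ((r(m := c)) k) ((e(m := e0)) k)"
        using IH(2) e0(3) by (auto simp: less_Suc_eq)
      ultimately show ?thesis
        by (intro exI[of _ "Suc m"] exI[of _ "e(m := e0)"] exI[of _ "r(m := c)"] conjI)
    qed
  qed
  then obtain m e r where *: "orthobasis P e m" "\<forall>k<m. T (e k) = scale (r k) (e k)" by auto
  show ?thesis using * orthobasis_dim[OF *(1)] by (intro exI[of _ e] exI[of _ r]) simp
qed

lemma orthobasis_exists: "positive_on P \<Longrightarrow> \<exists>e. orthobasis P e (dim P)"
  using spectral[of P "\<lambda>x. x"] by (auto simp: endo_def)

end

section \<open>Determinants and eigenangles of unitary operators\<close>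

locale frame = hermitian_form scale Basis g
  for scale :: "complex \<Rightarrow> 'v::ab_group_add \<Rightarrow> 'v" and Basis g +
  fixes P :: "'v set" and p :: "nat \<Rightarrow> 'v" and n :: nat
  assumes pos: "positive_on P" and ob: "orthobasis P p n"
begin

lemma sub: "subspace P" using pos by (simp add: positive_on_def)

lemma dim_P: "dim P = n" using orthobasis_dim[OF ob] .

lemmas p_mem = orthobasis_mem[OF ob]

lemma g_self_eq_0: "x \<in> P \<Longrightarrow> g x x = 0 \<Longrightarrow> x = 0"
  using pos unfolding positive_on_def by (metis less_irrefl zero_complex.simps(1))

text \<open>For an orthonormal basis \<open>b\<close> of \<open>P\<close> this is the linear
  operator on \<open>P\<close> that sends \<open>b k\<close> to \<open>c k\<close>.\<close>

definition opr :: "(nat \<Rightarrow> 'v) \<Rightarrow> (nat \<Rightarrow> 'v) \<Rightarrow> 'v \<Rightarrow> 'v" where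
  "opr b c x = (\<Sum>k<n. scale (g x (b k)) (c k))"

lemma endo_opr: "(\<And>k. k < n \<Longrightarrow> c k \<in> P) \<Longrightarrow> endo P (opr b c)"
  unfolding endo_def opr_def
  by (auto simp: g_simps scale_left_distrib sum.distrib scale_sum_right intro!: subspace_sum[OF sub] subspace_scale[OF sub])

lemma opr_basis:
  assumes "orthobasis P b n" "k < n"
  shows "opr b c (b k) = c k"
proof -
  have "opr b c (b k) = (\<Sum>i<n. if i = k then c i else 0)"
    unfolding opr_def using assms by (intro sum.cong) (auto simp: orthobasis_orthonormal)
  then show ?thesis using assms(2) by simp
qed

definition Det :: "('v \<Rightarrow> 'v) \<Rightarrow> complex" where
  "Det T = det (mat n n (\<lambda>(i, j). g (T (p j)) (p i)))"

lemma Det_cong: "(\<And>j. j < n \<Longrightarrow> S (p j) = T (p j)) \<Longrightarrow> Det S = Det T"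
  unfolding Det_def by (intro arg_cong[where f = det] cong_mat) auto

lemma entry_comp:
  assumes "endo P S" "x \<in> P"
  shows "g (S x) y = (\<Sum>k<n. g x (p k) * g (S (p k)) y)"
proof -
  have "S x = S (\<Sum>k<n. scale (g x (p k)) (p k))"
    using orthobasis_expand[OF ob assms(2)] by simp
  also have "\<dots> = (\<Sum>k<n. S (scale (g x (p k)) (p k)))"
    by (rule endo_sum[OF assms(1) sub]) (simp add: subspace_scale[OF sub] p_mem)
  also have "\<dots> = (\<Sum>k<n. scale (g x (p k)) (S (p k)))"
    using assms(1) p_mem by (intro sum.cong) (auto simp: endo_def)
  finally show ?thesis by (simp add: g_simps)
qed

lemma Det_comp:
  assumes "endo P S" "\<And>j. j < n \<Longrightarrow> T (p j) \<in> P"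
  shows "Det (\<lambda>x. S (T x)) = Det S * Det T"
proof -
  have "mat n n (\<lambda>(i, j). g (S (T (p j))) (p i)) =
    mat n n (\<lambda>(i, j). g (S (p j)) (p i)) * mat n n (\<lambda>(i, j). g (T (p j)) (p i))"
    by (rule eq_matI)
      (auto simp: scalar_prod_def entry_comp[OF assms(1) assms(2)] atLeast0LessThan mult.commute intro!: sum.cong)
  then show ?thesis unfolding Det_def by (simp add: det_mult[of _ n])
qed

lemma Det_diagonal:
  assumes "\<And>j. j < n \<Longrightarrow> T (p j) = scale (r j) (p j)"
  shows "Det T = (\<Prod>j<n. r j)"
proof -
  have "Det T = prod_list (diag_mat (mat n n (\<lambda>(i, j). g (T (p j)) (p i))))"
    unfolding Det_def using assms
    by (intro det_upper_triangular[of _ n]) (auto simp: g_simps orthobasis_orthonormal[OF ob])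
  also have "\<dots> = (\<Prod>j<n. r j)"
    unfolding prod_list_diag_prod using assms
    by (auto simp: g_simps orthobasis_orthonormal[OF ob] atLeast0LessThan intro!: prod.cong)
  finally show ?thesis .
qed

text \<open>With the change of basis E from \<open>p\<close> to \<open>e\<close> one has T E = E D,
  where D is diagonal in \<open>p\<close>. The determinant of E cancels because E has a left
  inverse.\<close>

lemma Det_eigenbasis:
  assumes T: "endo P T" and e: "orthobasis P e n" and r: "\<And>k. k < n \<Longrightarrow> T (e k) = scale (r k) (e k)"
  shows "Det T = (\<Prod>k<n. r k)"
proof -
  let ?E = "opr p e" and ?F = "opr e p" and ?D = "opr p (\<lambda>k. scale (r k) (p k))"
  have eP: "e k \<in> P" if "k < n" for k using orthobasis_mem[OF e that] .
  have E: "endo P ?E" by (rule endo_opr) (rule eP)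
  have F: "endo P ?F" by (rule endo_opr) (rule p_mem)
  have Ep: "?E (p j) = e j" and Fe: "?F (e j) = p j" and Dp: "?D (p j) = scale (r j) (p j)" if "j < n" for j
    using that opr_basis[OF ob] opr_basis[OF e] by simp_all
  have "Det ?F * Det ?E = Det (\<lambda>x. ?F (?E x))" by (rule Det_comp[OF F, symmetric]) (simp add: Ep eP)
  also have "\<dots> = (\<Prod>j<n. 1)" by (rule Det_diagonal) (simp add: Ep Fe)
  finally have nz: "Det ?E \<noteq> 0" by auto
  have "Det T * Det ?E = Det (\<lambda>x. T (?E x))" by (rule Det_comp[OF T, symmetric]) (simp add: Ep eP)
  also have "\<dots> = Det (\<lambda>x. ?E (?D x))"
    using E p_mem by (intro Det_cong) (simp add: Ep Dp r endo_def)
  also have "\<dots> = Det ?E * Det ?D" by (rule Det_comp[OF E]) (simp add: Dp subspace_scale[OF sub] p_mem)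
  also have "Det ?D = (\<Prod>j<n. r j)" by (rule Det_diagonal) (simp add: Dp)
  finally show ?thesis using nz by simp
qed

lemma dim_eigenspace:
  assumes T: "endo P T" and e: "orthobasis P e n" and r: "\<And>k. k < n \<Longrightarrow> T (e k) = scale (r k) (e k)"
  shows "dim {y \<in> P. T y = scale z y} = card {k \<in> {..<n}. r k = z}"
proof -
  let ?A = "{k \<in> {..<n}. r k = z}"
  have eP: "e k \<in> P" if "k < n" for k using orthobasis_mem[OF e that] .
  have "{y \<in> P. T y = scale z y} = span (e ` ?A)"
  proof
    show "{y \<in> P. T y = scale z y} \<subseteq> span (e ` ?A)"
    proof
      fix y assume "y \<in> {y \<in> P. T y = scale z y}"
      then have y: "y \<in> P" "T y = scale z y" by auto
      have ex: "y = (\<Sum>k<n. scale (g y (e k)) (e k))" using orthobasis_expand[OF e y(1)] .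
      have "T y = T (\<Sum>k<n. scale (g y (e k)) (e k))" using ex by simp
      also have "\<dots> = (\<Sum>k<n. T (scale (g y (e k)) (e k)))"
        by (rule endo_sum[OF T sub]) (simp add: subspace_scale[OF sub] eP)
      also have "\<dots> = (\<Sum>k<n. scale (g y (e k) * r k) (e k))"
        using T eP r by (intro sum.cong) (auto simp: endo_def)
      finally have "g (T y) (e k) = g y (e k) * r k" if "k < n" for k
        using orthobasis_coeff[OF e that] by simp
      then have "g y (e k) = 0" if "k < n" "r k \<noteq> z" for k
        using that y(2) by (auto simp: g_simps)
      then have "y = (\<Sum>k\<in>?A. scale (g y (e k)) (e k))"
        by (subst ex, intro sum.mono_neutral_right) auto
      also have "\<dots> \<in> span (e ` ?A)" by (intro span_sum span_scale span_base) simp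
      finally show "y \<in> span (e ` ?A)" .
    qed
    have "subspace {y \<in> P. T y = scale z y}"
      using T sub unfolding endo_def
      by (intro subspaceI) (auto simp: subspace_0 subspace_add subspace_scale scale_right_distrib scale_left_commute,
          metis scale_zero_left scale_zero_right subspace_0)
    then show "span (e ` ?A) \<subseteq> {y \<in> P. T y = scale z y}"
      by (intro span_minimal) (auto simp: eP r)
  qed
  then show ?thesis using orthobasis_independent(2)[OF e, of ?A] by auto
qed

definition unitary :: "('v \<Rightarrow> 'v) \<Rightarrow> bool" where
  "unitary W \<longleftrightarrow> endo P W \<and> (\<forall>x\<in>P. \<forall>y\<in>P. g (W x) (W y) = g x y)"

lemma unitary_eigenbasis:
  assumes "unitary W"
  shows "\<exists>e t. orthobasis P e n \<and> (\<forall>k<n. W (e k) = scale (cis (t k)) (e k))"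
proof -
  have W: "endo P W" "\<And>x y. x \<in> P \<Longrightarrow> y \<in> P \<Longrightarrow> g (W x) (W y) = g x y"
    using assms by (auto simp: unitary_def)
  have orth: "g (W y) x = 0" if "x \<in> P" "y \<in> P" "x \<noteq> 0" "W x = scale c x" "g y x = 0" for x y c
  proof -
    have "c \<noteq> 0" using W(2)[OF that(1,1)] that g_self_eq_0[OF that(1)] by (auto simp: g_simps)
    moreover have "cnj c * g (W y) x = 0" using W(2)[OF that(2,1)] that by (simp add: g_simps)
    ultimately show ?thesis by simp
  qed
  have "\<exists>e r. orthobasis P e (dim P) \<and> (\<forall>k<dim P. W (e k) = scale (r k) (e k))"
    by (rule spectral[OF pos W(1) orth])
  then obtain e r where e: "orthobasis P e n" "\<And>k. k < n \<Longrightarrow> W (e k) = scale (r k) (e k)"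
    unfolding dim_P by auto
  have "cis (Arg (r k)) = r k" if "k < n" for k
  proof -
    have "r k * cnj (r k) = 1"
      using W(2)[OF orthobasis_mem[OF e(1) that] orthobasis_mem[OF e(1) that]] e(2)[OF that]
        orthobasis_orthonormal[OF e(1) that that] by (simp add: g_simps mult.commute)
    then have "of_real ((norm (r k))\<^sup>2) = (1::complex)" using complex_norm_square[of "r k"] by simp
    then have "(norm (r k))\<^sup>2 = 1" by (simp only: of_real_eq_1_iff)
    then have "norm (r k) = 1" by (simp add: power2_eq_1_iff) (use norm_ge_zero[of "r k"] in linarith)
    then show ?thesis by (subst cis_Arg) (auto simp: sgn_eq)
  qed
  then show ?thesis using e by (intro exI[of _ e] exI[of _ "\<lambda>k. Arg (r k)"]) simp
qed

definition angles :: "('v \<Rightarrow> 'v) \<Rightarrow> (nat \<Rightarrow> real) \<Rightarrow> bool" where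
  "angles W t \<longleftrightarrow> (\<forall>z. card {j \<in> {..<n}. cis (t j) = z} = dim {y \<in> P. W y = scale z y})"

lemma angles_cong:
  assumes "\<And>x. x \<in> P \<Longrightarrow> V x = W x"
  shows "angles V t \<longleftrightarrow> angles W t"
proof -
  have "{y \<in> P. V y = scale z y} = {y \<in> P. W y = scale z y}" for z using assms by auto
  then show ?thesis by (simp add: angles_def)
qed

lemma angles_eigenbasis:
  assumes "endo P W" "orthobasis P e n" "\<And>k. k < n \<Longrightarrow> W (e k) = scale (cis (t k)) (e k)"
  shows "angles W t"
  unfolding angles_def using dim_eigenspace[OF assms] by simp

lemma angles_exist: "unitary W \<Longrightarrow> \<exists>t. angles W t"
  using unitary_eigenbasis[of W] angles_eigenbasis[of W] unfolding unitary_def by metis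

lemma angles_unique:
  assumes "angles W t" "angles W u"
  shows "(\<Prod>j<n. z - cis (t j)) = (\<Prod>j<n. z - cis (u j))"
  using card_eq_iff_prod_linear_eq[of n "\<lambda>j. cis (t j)" "\<lambda>j. cis (u j)"] assms unfolding angles_def by simp

text \<open>Dimensions of eigenspaces do not vary continuously, but determinants do. For a
  diagonalizable operator both carry the same information.\<close>

lemma angles_iff:
  assumes "unitary W"
  shows "angles W t \<longleftrightarrow> (\<forall>z. Det (\<lambda>x. scale z x - W x) = (\<Prod>j<n. z - cis (t j)))"
proof -
  have W: "endo P W" using assms by (simp add: unitary_def)
  obtain e u where e: "orthobasis P e n" "\<And>k. k < n \<Longrightarrow> W (e k) = scale (cis (u k)) (e k)"
    using unitary_eigenbasis[OF assms] by (elim exE conjE) auto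
  have u: "angles W u" by (rule angles_eigenbasis[OF W e])
  have *: "Det (\<lambda>x. scale z x - W x) = (\<Prod>k<n. z - cis (u k))" for z
  proof (rule Det_eigenbasis[OF _ e(1)])
    show "endo P (\<lambda>x. scale z x - W x)"
      using W unfolding endo_def
      by (auto simp: subspace_diff[OF sub] subspace_scale[OF sub] scale_right_distrib scale_right_diff_distrib scale_left_commute)
    show "scale z (e k) - W (e k) = scale (z - cis (u k)) (e k)" if "k < n" for k
      using e(2)[OF that] by (simp add: scale_left_diff_distrib)
  qed
  show ?thesis
    unfolding * using u card_eq_iff_prod_linear_eq[of n "\<lambda>j. cis (t j)" "\<lambda>j. cis (u j)"]
    unfolding angles_def by auto
qed

lemma angles_Det:
  assumes "unitary W" "angles W t"
  shows "Det W = cis (\<Sum>j<n. t j)"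
proof -
  have W: "endo P W" using assms by (simp add: unitary_def)
  obtain e u where e: "orthobasis P e n" "\<And>k. k < n \<Longrightarrow> W (e k) = scale (cis (u k)) (e k)"
    using unitary_eigenbasis[OF assms(1)] by (elim exE conjE) auto
  have "angles W u" by (rule angles_eigenbasis[OF W e])
  from angles_unique[OF this assms(2)]
  have eq: "image_mset (\<lambda>j. cis (u j)) (mset_set {..<n}) = image_mset (\<lambda>j. cis (t j)) (mset_set {..<n})"
    by (rule prod_linear_eq_imp_mset_eq)
  have "Det W = (\<Prod>k<n. cis (u k))" by (rule Det_eigenbasis[OF W e])
  also have "\<dots> = (\<Prod>k<n. cis (t k))" unfolding prod_unfold_prod_mset eq ..
  also have "\<dots> = cis (\<Sum>j<n. t j)" by (induction n) (simp_all add: cis_mult)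
  finally show ?thesis .
qed

definition tau :: "('v \<Rightarrow> 'v) \<Rightarrow> real" where
  "tau W = (\<Sum>j<n. gap ((SOME t. angles W t) j))"

lemma tau_eq: "angles W t \<Longrightarrow> tau W = (\<Sum>j<n. gap (t j))"
  unfolding tau_def by (rule sum_gap_cong, rule angles_unique, rule someI[of "angles W"])

lemma sum_ceiling_angles:
  "angles W t \<Longrightarrow> (\<Sum>j<n. real_of_int \<lceil>t j / (2 * pi)\<rceil>) = tau W + (\<Sum>j<n. t j) / (2 * pi)"
  by (simp add: sum_ceiling_eq tau_eq)

lemma tau_cong:
  assumes "\<And>x. x \<in> P \<Longrightarrow> V x = W x"
  shows "tau V = tau W"
proof -
  have "angles V = angles W" using angles_cong[OF assms] by auto
  then show ?thesis by (simp add: tau_def)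
qed

definition entries_continuous :: "real set \<Rightarrow> (real \<Rightarrow> 'v \<Rightarrow> 'v) \<Rightarrow> bool" where
  "entries_continuous S T \<longleftrightarrow> (\<forall>i<n. \<forall>j<n. continuous_on S (\<lambda>s. g (T s (p j)) (p i)))"

lemma entries_continuous_Det:
  assumes "entries_continuous S T"
  shows "continuous_on S (\<lambda>s. Det (T s))"
proof -
  have "continuous_on S (\<lambda>s. \<Sum>q\<in>{q. q permutes {0..<n}}. signof q * (\<Prod>i = 0..<n. g (T s (p (q i))) (p i)))"
    using assms unfolding entries_continuous_def
    by (intro continuous_intros) (auto dest: permutes_in_image)
  moreover have "Det (T s) = (\<Sum>q\<in>{q. q permutes {0..<n}}. signof q * (\<Prod>i = 0..<n. g (T s (p (q i))) (p i)))" for s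
    unfolding Det_def
    by (subst det_def'[of _ n]) (auto intro!: sum.cong prod.cong dest: permutes_in_image)
  ultimately show ?thesis by simp
qed

lemma entries_continuous_comp:
  assumes "entries_continuous S A" "entries_continuous S B"
    and "\<And>s. s \<in> S \<Longrightarrow> endo P (A s)" "\<And>s. s \<in> S \<Longrightarrow> endo P (B s)"
  shows "entries_continuous S (\<lambda>s x. A s (B s x))"
  unfolding entries_continuous_def
proof (intro allI impI)
  fix i j assume ij: "i < n" "j < n"
  have "continuous_on S (\<lambda>s. \<Sum>k<n. g (B s (p j)) (p k) * g (A s (p k)) (p i))"
    using assms(1,2) ij unfolding entries_continuous_def by (intro continuous_intros) auto
  moreover have "g (A s (B s (p j))) (p i) = (\<Sum>k<n. g (B s (p j)) (p k) * g (A s (p k)) (p i))" if "s \<in> S" for s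
    using assms(3,4)[OF that] p_mem ij by (intro entry_comp) (auto simp: endo_def)
  ultimately show "continuous_on S (\<lambda>s. g (A s (B s (p j))) (p i))" by (simp cong: continuous_on_cong)
qed

text \<open>Only the characteristic polynomial has to be continuous. For Cayley transforms this
  comes from a quotient of determinants, without any statement about the entries of
  \<open>W\<close>.\<close>

lemma angles_path:
  fixes a b :: real
  assumes "a \<le> b" and W: "\<And>s. s \<in> {a..b} \<Longrightarrow> unitary (W s)"
    and cont: "\<And>z. continuous_on {a..b} (\<lambda>s. Det (\<lambda>x. scale z x - W s x))"
  shows "\<exists>\<theta>. (\<forall>j<n. continuous_on {a..b} (\<theta> j)) \<and> (\<forall>s\<in>{a..b}. angles (W s) (\<lambda>j. \<theta> j s))"
proof -
  have "\<forall>s\<in>{a..b}. \<exists>t. angles (W s) t" using angles_exist[OF W] by blast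
  then have "\<exists>t. \<forall>s\<in>{a..b}. angles (W s) (t s)" by (rule bchoice)
  then obtain t where t': "\<forall>s\<in>{a..b}. angles (W s) (t s)" by (rule exE)
  then have t: "angles (W s) (t s)" if "s \<in> {a..b}" for s using that by simp
  have D: "Det (\<lambda>x. scale z x - W s x) = (\<Prod>j<n. z - cis (t s j))" if "s \<in> {a..b}" for s z
    using angles_iff[OF W[OF that]] t[OF that] by simp
  have c: "continuous_on {a..b} (\<lambda>s. \<Prod>j<n. z - cis (t s j))" for z
    using cont[of z] by (subst continuous_on_cong[OF refl D[symmetric]]) auto
  obtain \<theta> where \<theta>: "\<forall>j<n. continuous_on {a..b} (\<theta> j)"
    "\<forall>s\<in>{a..b}. \<forall>z. (\<Prod>j<n. z - cis (\<theta> j s)) = (\<Prod>j<n. z - cis (t s j))"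
    using continuous_angles[OF assms(1) c] by (elim exE conjE)
  have "angles (W s) (\<lambda>j. \<theta> j s)" if "s \<in> {a..b}" for s
    unfolding angles_iff[OF W[OF that]] using \<theta>(2) D[OF that] that by simp
  then show ?thesis using \<theta>(1) by (intro exI[of _ \<theta>]) simp
qed

lemma entries_continuous_angles:
  fixes a b :: real
  assumes "a \<le> b" and W: "\<And>s. s \<in> {a..b} \<Longrightarrow> unitary (W s)" and "entries_continuous {a..b} W"
  shows "\<exists>\<theta>. (\<forall>j<n. continuous_on {a..b} (\<theta> j)) \<and> (\<forall>s\<in>{a..b}. angles (W s) (\<lambda>j. \<theta> j s))"
proof (rule angles_path[OF assms(1) W])
  fix z
  show "continuous_on {a..b} (\<lambda>s. Det (\<lambda>x. scale z x - W s x))"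
    using assms(3) unfolding entries_continuous_def
    by (intro entries_continuous_Det) (auto simp: entries_continuous_def g_simps intro!: continuous_intros)
qed

end

section \<open>Cayley transforms\<close>

text \<open>Dividing cos + i sin by its conjugate doubles the angle. This is the Cayley transform of
  a single eigenvalue, with the cotangent of the half angle as the real parameter.\<close>

lemma cis_cot_half:
  assumes "sin (x / 2) \<noteq> 0"
  shows "cis x * (of_real (cos (x / 2) / sin (x / 2)) - \<i>) = of_real (cos (x / 2) / sin (x / 2)) + \<i>"
proof -
  have *: "cis x = cis (x / 2) * cis (x / 2)" by (simp add: cis_mult)
  have "cis (x / 2) * (of_real (cos (x / 2)) - \<i> * of_real (sin (x / 2))) = 1"
    by (simp add: complex_eq_iff flip: power2_eq_square)
  then have "cis x * (of_real (cos (x / 2)) - \<i> * of_real (sin (x / 2))) = cis (x / 2)"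
    unfolding * by (simp add: mult.assoc)
  also have "cis (x / 2) = of_real (cos (x / 2)) + \<i> * of_real (sin (x / 2))"
    by (simp add: complex_eq_iff)
  finally show ?thesis using assms by (simp add: field_simps)
qed

lemma gap_pos: "0 < x \<Longrightarrow> x \<le> 2 * pi \<Longrightarrow> gap x = 1 - x / (2 * pi)"
  and gap_pos2: "2 * pi < x \<Longrightarrow> x \<le> 4 * pi \<Longrightarrow> gap x = 2 - x / (2 * pi)"
proof -
  assume "0 < x" "x \<le> 2 * pi"
  then have "\<lceil>x / (2 * pi)\<rceil> = 1" by (intro ceiling_unique) (simp_all add: field_simps)
  then show "gap x = 1 - x / (2 * pi)" by (simp add: gap_def)
next
  assume "2 * pi < x" "x \<le> 4 * pi"
  then have "\<lceil>x / (2 * pi)\<rceil> = 2" by (intro ceiling_unique) (simp_all add: field_simps)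
  then show "gap x = 2 - x / (2 * pi)" by (simp add: gap_def)
qed

text \<open>The one-dimensional case of \<open>tau_cayley_product\<close> with H = d and K = 0; pi
  is the angle of the Cayley transform -1 of 0. The witness \<open>pi - 2 * arctan d\<close> lies
  strictly between 0 and 2 pi, and adding pi passes 2 pi exactly when d < 0. The value d = 0 lands
  on 2 pi itself and is counted as nonnegative.\<close>

lemma cayley_angle:
  fixes d :: real
  shows "\<exists>x. cis x * (of_real d - \<i>) = of_real d + \<i> \<and>
    gap x + gap pi - gap (x + pi) = (if 0 \<le> d then 1 else 0)"
proof -
  define x where "x = pi - 2 * arctan d"
  have x2: "x / 2 = pi / 2 - arctan d" by (simp add: x_def field_simps)
  have sc: "sin (x / 2) = cos (arctan d)" "cos (x / 2) = sin (arctan d)"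
    unfolding x2 by (simp_all add: sin_diff cos_diff)
  have "sin (x / 2) \<noteq> 0" unfolding sc by simp
  moreover have "cos (x / 2) / sin (x / 2) = d" unfolding sc using tan_arctan[of d] by (simp add: tan_def)
  ultimately have 1: "cis x * (of_real d - \<i>) = of_real d + \<i>" using cis_cot_half[of x] by simp
  have b: "- (pi / 2) < arctan d" "arctan d < pi / 2" using arctan_bounded by auto
  have rng: "0 < x" "x < 2 * pi" using b by (simp_all add: x_def)
  have g: "gap x = 1 - x / (2 * pi)" "gap pi = 1 / 2" using rng gap_pos[of x] gap_pos[of pi] by simp_all
  have "gap x + gap pi - gap (x + pi) = (if 0 \<le> d then 1 else 0)"
  proof (cases "0 \<le> d")
    case True
    then have "x \<le> pi" by (simp add: x_def)
    then have "gap (x + pi) = 1 - (x + pi) / (2 * pi)" using rng by (intro gap_pos) auto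
    then show ?thesis using True g by (simp add: add_divide_distrib)
  next
    case False
    then have "pi < x" by (simp add: x_def)
    then have "gap (x + pi) = 2 - (x + pi) / (2 * pi)" using rng by (intro gap_pos2) auto
    then show ?thesis using False g by (simp add: add_divide_distrib)
  qed
  with 1 show ?thesis by (intro exI[of _ x] conjI)
qed

context frame begin

lemma endo_eqI:
  assumes "endo P S" "endo P T" "orthobasis P e n" "\<And>k. k < n \<Longrightarrow> S (e k) = T (e k)" "x \<in> P"
  shows "S x = T x"
proof -
  have eP: "e k \<in> P" if "k < n" for k using orthobasis_mem[OF assms(3) that] .
  have x: "x = (\<Sum>k<n. scale (g x (e k)) (e k))" using orthobasis_expand[OF assms(3,5)] .
  have "R x = (\<Sum>k<n. scale (g x (e k)) (R (e k)))" if R: "endo P R" for R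
  proof -
    have "R x = R (\<Sum>k<n. scale (g x (e k)) (e k))" using x by simp
    also have "\<dots> = (\<Sum>k<n. R (scale (g x (e k)) (e k)))"
      by (rule endo_sum[OF R sub]) (simp add: subspace_scale[OF sub] eP)
    also have "\<dots> = (\<Sum>k<n. scale (g x (e k)) (R (e k)))"
      using R eP by (intro sum.cong) (auto simp: endo_def)
    finally show ?thesis .
  qed
  from this[OF assms(1)] this[OF assms(2)] show ?thesis using assms(4) by simp
qed

definition hermitian :: "('v \<Rightarrow> 'v) \<Rightarrow> bool" where
  "hermitian T \<longleftrightarrow> endo P T \<and> (\<forall>x\<in>P. \<forall>y\<in>P. g (T x) y = g x (T y))"

lemma hermitian_eigenbasis:
  assumes "hermitian T"
  shows "\<exists>e r. orthobasis P e n \<and> (\<forall>k<n. T (e k) = scale (of_real (r k)) (e k))"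
proof -
  have T: "endo P T" "\<And>x y. x \<in> P \<Longrightarrow> y \<in> P \<Longrightarrow> g (T x) y = g x (T y)"
    using assms by (auto simp: hermitian_def)
  have orth: "g (T y) x = 0" if "x \<in> P" "y \<in> P" "x \<noteq> 0" "T x = scale c x" "g y x = 0" for x y c
    using T(2)[OF that(2,1)] that by (simp add: g_simps)
  have "\<exists>e r. orthobasis P e (dim P) \<and> (\<forall>k<dim P. T (e k) = scale (r k) (e k))"
    by (rule spectral[OF pos T(1) orth])
  then obtain e r where e: "orthobasis P e n" "\<And>k. k < n \<Longrightarrow> T (e k) = scale (r k) (e k)"
    unfolding dim_P by auto
  have "of_real (Re (r k)) = r k" if "k < n" for k
  proof -
    have "r k = cnj (r k)"
      using T(2)[OF orthobasis_mem[OF e(1) that] orthobasis_mem[OF e(1) that]] e(2)[OF that]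
        orthobasis_orthonormal[OF e(1) that that] by (simp add: g_simps)
    then show ?thesis by (simp add: complex_eq_iff)
  qed
  then show ?thesis using e by (intro exI[of _ e] exI[of _ "\<lambda>k. Re (r k)"]) simp
qed

definition diag :: "(nat \<Rightarrow> 'v) \<Rightarrow> (nat \<Rightarrow> complex) \<Rightarrow> 'v \<Rightarrow> 'v" where
  "diag e c = opr e (\<lambda>k. scale (c k) (e k))"

lemma endo_diag: "orthobasis P e n \<Longrightarrow> endo P (diag e c)"
  unfolding diag_def by (rule endo_opr) (simp add: subspace_scale[OF sub] orthobasis_mem)

lemma diag_basis: "orthobasis P e n \<Longrightarrow> k < n \<Longrightarrow> diag e c (e k) = scale (c k) (e k)"
  unfolding diag_def by (rule opr_basis)

lemma g_diag: "orthobasis P e n \<Longrightarrow> k < n \<Longrightarrow> g (diag e c x) (e k) = c k * g x (e k)"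
  using orthobasis_coeff[of P e n k "\<lambda>k. g x (e k) * c k"] by (simp add: diag_def opr_def mult.commute)

lemma g_diag2: "orthobasis P e n \<Longrightarrow> k < n \<Longrightarrow> g (e k) (diag e c x) = cnj (c k) * g (e k) x"
  using arg_cong[OF g_diag[of e k c x], of cnj] by (simp flip: herm)

lemma unitary_diag:
  assumes e: "orthobasis P e n" and "\<And>k. k < n \<Longrightarrow> norm (c k) = 1"
  shows "unitary (diag e c)"
proof -
  have "g (diag e c x) (diag e c y) = g x y" if "x \<in> P" "y \<in> P" for x y
  proof -
    have "diag e c x \<in> P" using endo_diag[OF e] that by (simp add: endo_def)
    then have "g (diag e c x) (diag e c y) = (\<Sum>k<n. (c k * cnj (c k)) * (g x (e k) * g (e k) y))"
      using orthobasis_inner[OF e, of "diag e c x" "diag e c y"] by (simp add: g_diag[OF e] g_diag2[OF e] mult_ac)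
    also have "\<dots> = (\<Sum>k<n. g x (e k) * g (e k) y)"
      using assms(2) by (intro sum.cong) (auto simp: complex_norm_square[symmetric])
    also have "\<dots> = g x y" using orthobasis_inner[OF e that(1), of y] by simp
    finally show ?thesis .
  qed
  then show ?thesis using endo_diag[OF e] by (simp add: unitary_def)
qed

lemma hermitian_diag:
  assumes e: "orthobasis P e n"
  shows "hermitian (diag e (\<lambda>k. of_real (r k)))"
proof -
  let ?T = "diag e (\<lambda>k. of_real (r k))"
  have "g (?T x) y = g x (?T y)" if "x \<in> P" "y \<in> P" for x y
  proof -
    have "?T x \<in> P" using endo_diag[OF e] that by (simp add: endo_def)
    then show ?thesis
      using orthobasis_inner[OF e, of "?T x" y] orthobasis_inner[OF e that(1), of "?T y"]
      by (simp add: g_diag[OF e] g_diag2[OF e] mult_ac)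
  qed
  then show ?thesis using endo_diag[OF e] by (simp add: hermitian_def)
qed

definition shift :: "('v \<Rightarrow> 'v) \<Rightarrow> complex \<Rightarrow> 'v \<Rightarrow> 'v" where
  "shift H c u = H u + scale c u"

lemma endo_shift: "endo P H \<Longrightarrow> endo P (shift H c)"
  unfolding endo_def shift_def
  by (auto simp: subspace_add[OF sub] subspace_scale[OF sub] scale_right_distrib scale_left_commute)

lemma endo_comp: "endo P S \<Longrightarrow> endo P T \<Longrightarrow> endo P (\<lambda>x. S (T x))"
  unfolding endo_def by simp

lemma endo_0: "endo P T \<Longrightarrow> T 0 = 0"
  unfolding endo_def using subspace_0[OF sub] by (metis scale_zero_left)

text \<open>In an eigenbasis of \<open>H\<close> the operator \<open>shift H c\<close> is diagonal
  with entries r + c, and these do not vanish because r is real and c is not.\<close>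

lemma resolvent:
  assumes H: "hermitian H" and c: "Im c \<noteq> 0"
  shows "\<And>x. x \<in> P \<Longrightarrow> \<exists>u\<in>P. shift H c u = x"
    and "\<And>u. u \<in> P \<Longrightarrow> shift H c u = 0 \<Longrightarrow> u = 0"
    and "Det (shift H c) \<noteq> 0"
proof -
  obtain e r where e: "orthobasis P e n" and r: "\<forall>k<n. H (e k) = scale (of_real (r k)) (e k)"
    using hermitian_eigenbasis[OF H] by (elim exE conjE)
  have endo: "endo P (shift H c)" using H by (simp add: hermitian_def endo_shift)
  have ev: "shift H c (e k) = scale (of_real (r k) + c) (e k)" if "k < n" for k
    using r that by (simp add: shift_def scale_left_distrib)
  have nz: "of_real (r k) + c \<noteq> 0" for k using c by (auto simp: complex_eq_iff)
  let ?R = "diag e (\<lambda>k. 1 / (of_real (r k) + c))"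
  have R: "endo P ?R" by (rule endo_diag[OF e])
  have SR: "shift H c (?R x) = x" if "x \<in> P" for x
  proof (rule endo_eqI[OF endo_comp[OF endo R] _ e _ that])
    show "endo P (\<lambda>x. x)" by (simp add: endo_def)
    show "shift H c (?R (e k)) = e k" if "k < n" for k
      using endo orthobasis_mem[OF e that] nz[of k] by (simp add: diag_basis[OF e that] endo_def ev[OF that])
  qed
  have RS: "?R (shift H c x) = x" if "x \<in> P" for x
  proof (rule endo_eqI[OF endo_comp[OF R endo] _ e _ that])
    show "endo P (\<lambda>x. x)" by (simp add: endo_def)
    show "?R (shift H c (e k)) = e k" if "k < n" for k
      using R orthobasis_mem[OF e that] nz[of k] by (simp add: diag_basis[OF e that] endo_def ev[OF that])
  qed
  show "\<exists>u\<in>P. shift H c u = x" if "x \<in> P" for x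
    using SR[OF that] R that by (intro bexI[of _ "?R x"]) (auto simp: endo_def)
  show "u = 0" if "u \<in> P" "shift H c u = 0" for u
    using RS[OF that(1)] that(2) by (simp add: diag_def opr_def)
  have "Det (shift H c) = (\<Prod>k<n. of_real (r k) + c)" by (rule Det_eigenbasis[OF endo e ev])
  then show "Det (shift H c) \<noteq> 0" using nz by simp
qed

text \<open>W = (H + i) (H - i)^(-1), written without an inverse. The two equations put the factor H
  - i on the right and on the left of W, so that denominators can be cleared on either side of a
  product.\<close>

definition cayley :: "('v \<Rightarrow> 'v) \<Rightarrow> ('v \<Rightarrow> 'v) \<Rightarrow> bool" where
  "cayley H W \<longleftrightarrow> hermitian H \<and> unitary W \<and>
     (\<forall>u\<in>P. W (shift H (-\<i>) u) = shift H \<i> u) \<and> (\<forall>u\<in>P. shift H (-\<i>) (W u) = shift H \<i> u)"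

lemma cayley_of_eigenbasis:
  assumes e: "orthobasis P e n" and "hermitian H" "unitary W"
    and H: "\<And>k. k < n \<Longrightarrow> H (e k) = scale (of_real (r k)) (e k)"
    and W: "\<And>k. k < n \<Longrightarrow> W (e k) = scale (w k) (e k)"
    and rw: "\<And>k. k < n \<Longrightarrow> w k * (of_real (r k) - \<i>) = of_real (r k) + \<i>"
  shows "cayley H W"
proof -
  have endo: "endo P H" "endo P W" using assms(2,3) by (simp_all add: hermitian_def unitary_def)
  have sh: "shift H c (e k) = scale (of_real (r k) + c) (e k)" if "k < n" for k c
    using H[OF that] by (simp add: shift_def scale_left_distrib)
  have 1: "W (shift H (-\<i>) u) = shift H \<i> u" if "u \<in> P" for u
  proof (rule endo_eqI[OF endo_comp[OF endo(2) endo_shift[OF endo(1)]] endo_shift[OF endo(1)] e _ that])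
    fix k assume k: "k < n"
    show "W (shift H (-\<i>) (e k)) = shift H \<i> (e k)"
      using endo(2) orthobasis_mem[OF e k] rw[OF k] by (simp add: sh[OF k] W[OF k] endo_def mult.commute)
  qed
  have 2: "shift H (-\<i>) (W u) = shift H \<i> u" if "u \<in> P" for u
  proof (rule endo_eqI[OF endo_comp[OF endo_shift[OF endo(1)] endo(2)] endo_shift[OF endo(1)] e _ that])
    fix k assume k: "k < n"
    show "shift H (-\<i>) (W (e k)) = shift H \<i> (e k)"
      using endo_shift[OF endo(1), of "-\<i>"] orthobasis_mem[OF e k] rw[OF k]
      by (simp add: sh[OF k] W[OF k] endo_def)
  qed
  show ?thesis using 1 2 assms(2,3) by (simp add: cayley_def)
qed

lemma cayley_exists:
  assumes "hermitian H"
  shows "\<exists>W. cayley H W"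
proof -
  obtain e r where e: "orthobasis P e n" and r: "\<forall>k<n. H (e k) = scale (of_real (r k)) (e k)"
    using hermitian_eigenbasis[OF assms] by (elim exE conjE)
  have "\<exists>x. cis x * (of_real (r k) - \<i>) = of_real (r k) + \<i>" for k
    using cayley_angle[of "r k"] by (elim exE conjE) (rule exI)
  then obtain x where x: "\<And>k. cis (x k) * (of_real (r k) - \<i>) = of_real (r k) + \<i>" by metis
  have "cayley H (diag e (\<lambda>k. cis (x k)))"
    by (rule cayley_of_eigenbasis[OF e assms unitary_diag[OF e] _ diag_basis[OF e], where r = r]) (use r x in simp_all)
  then show ?thesis by blast
qed

text \<open>On the real line (r + i) / (r - i) misses only the point 1 of the unit circle, so an
  operator without fixed vectors can be inverted eigenvalue by eigenvalue, by the cotangent of the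
  half angle.\<close>

lemma cayley_inverse:
  assumes W: "unitary W" and nofix: "\<And>x. x \<in> P \<Longrightarrow> W x = x \<Longrightarrow> x = 0"
  shows "\<exists>H. cayley H W"
proof -
  obtain e t where e: "orthobasis P e n" and t: "\<forall>k<n. W (e k) = scale (cis (t k)) (e k)"
    using unitary_eigenbasis[OF W] by (elim exE conjE)
  define r where "r k = cos (t k / 2) / sin (t k / 2)" for k
  have rw: "cis (t k) * (of_real (r k) - \<i>) = of_real (r k) + \<i>" if k: "k < n" for k
    unfolding r_def
  proof (rule cis_cot_half)
    show "sin (t k / 2) \<noteq> 0"
    proof
      assume "sin (t k / 2) = 0"
      then obtain i :: int where "t k / 2 = of_int i * pi" by (auto simp: sin_zero_iff_int2)
      then have "cis (t k) = 1" unfolding cis_eq_1_iff by (intro exI[of _ i]) (simp add: field_simps)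
      then have "e k = 0" using nofix[OF orthobasis_mem[OF e k]] t k by simp
      then show False using orthobasis_orthonormal[OF e k k] by simp
    qed
  qed
  have "cayley (diag e (\<lambda>k. of_real (r k))) W"
    by (rule cayley_of_eigenbasis[OF e hermitian_diag[OF e] W diag_basis[OF e], where w = "\<lambda>k. cis (t k)"])
      (use t rw in simp_all)
  then show ?thesis by blast
qed

lemma dim_image_injective:
  assumes add: "\<And>x y. x \<in> P \<Longrightarrow> y \<in> P \<Longrightarrow> T (x + y) = T x + T y"
    and scale: "\<And>c x. x \<in> P \<Longrightarrow> T (scale c x) = scale c (T x)"
    and S: "subspace S" "S \<subseteq> P" and inj: "\<And>u. u \<in> P \<Longrightarrow> T u = 0 \<Longrightarrow> u = 0"
  shows "dim (T ` S) = dim S"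
proof -
  interpret pair: finite_dimensional_vector_space_pair scale Basis scale Basis ..
  \<comment> \<open>\<open>T\<close> is linear on \<open>P\<close> only. \<open>?L\<close> agrees
    with it there and is linear on the whole space, as the dimension formula for linear maps
    requires.\<close>
  let ?L = "opr p (\<lambda>k. T (p k))"
  have L: "?L x = T x" if "x \<in> P" for x
  proof -
    have "T x = T (\<Sum>k<n. scale (g x (p k)) (p k))"
      by (rule arg_cong[where f = T]) (rule orthobasis_expand[OF ob that])
    also have "\<dots> = (\<Sum>k<n. T (scale (g x (p k)) (p k)))"
      by (rule additive_sum[OF sub _ add]) (simp add: subspace_scale[OF sub] p_mem)
    also have "\<dots> = ?L x" by (simp add: opr_def scale p_mem)
    finally show ?thesis by simp
  qed
  have lin: "Vector_Spaces.linear scale scale ?L"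
    by unfold_locales (simp_all add: opr_def g_simps scale_left_distrib sum.distrib scale_sum_right)
  have "inj_on ?L S"
  proof (rule inj_onI)
    fix x y assume xy: "x \<in> S" "y \<in> S" "?L x = ?L y"
    then have P: "x \<in> P" "y \<in> P" using S(2) by auto
    have "T ((x - y) + y) = T (x - y) + T y" by (rule add[OF subspace_diff[OF sub P] P(2)])
    then have "T (x - y) = 0" using xy(3) L[OF P(1)] L[OF P(2)] by simp
    then have "x - y = 0" using inj[OF subspace_diff[OF sub P]] by simp
    then show "x = y" by simp
  qed
  then have "dim (?L ` S) = dim S"
    using lin S(1) by (intro pair.dim_image_eq) (simp_all add: span_eq_iff[THEN iffD2])
  moreover have "?L ` S = T ` S" using L S(2) by (intro image_cong) auto
  ultimately show ?thesis by simp
qed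

lemma cayley_fixed:
  assumes "cayley H W" "x \<in> P" "W x = x"
  shows "x = 0"
proof -
  have H: "hermitian H" using assms(1) by (simp add: cayley_def)
  obtain u where u: "u \<in> P" "shift H (-\<i>) u = x" using resolvent(1)[OF H, of "-\<i>" x] assms(2) by auto
  then have "shift H \<i> u = shift H (-\<i>) u" using assms(1,3) by (auto simp: cayley_def)
  then have "scale \<i> u = scale (-\<i>) u" by (simp add: shift_def)
  then have "scale (\<i> - (-\<i>)) u = 0" by (simp only: scale_left_diff_distrib) simp
  then have "u = 0" by (simp only: scale_eq_0_iff) (auto simp: complex_eq_iff)
  then show ?thesis using u H endo_0[of H] by (simp add: shift_def hermitian_def)
qed

end

section \<open>Products of two Cayley transforms\<close>

context frame begin

lemma cayley_fixed_dim:
  assumes "cayley H W"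
  shows "dim {y \<in> P. W y = y} = 0"
proof -
  have "{y \<in> P. W y = y} \<subseteq> {0}" using cayley_fixed[OF assms] by blast
  then have "dim {y \<in> P. W y = y} \<le> dim {0}" by (rule dim_subset)
  then show ?thesis by simp
qed

text \<open>Put y = (K - i) u. Then A B y = y amounts to (H + i) (K + i) u = (H - i) (K - i) u, and
  the difference of the two sides is 2 i (H + K) u.\<close>

lemma cayley_product_fixed_dim:
  assumes A: "cayley H A" and B: "cayley K B"
  shows "dim {y \<in> P. A (B y) = y} = dim {u \<in> P. H u + K u = 0}"
proof -
  let ?X = "shift H (-\<i>)" and ?Z = "shift H \<i>" and ?Y = "shift K (-\<i>)" and ?V = "shift K \<i>"
  have H: "hermitian H" and K: "hermitian K" using A B by (simp_all add: cayley_def)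
  have eH: "endo P H" and eK: "endo P K" using H K by (simp_all add: hermitian_def)
  have mem: "H u \<in> P" "K u \<in> P" "scale c u \<in> P" if "u \<in> P" for u c
    using that eH eK by (simp_all add: endo_def subspace_scale[OF sub])
  have uA: "A y \<in> P" if "y \<in> P" for y using that A by (simp add: cayley_def unitary_def endo_def)
  have diff: "?Z (?V u) - ?X (?Y u) = scale (2 * \<i>) (H u + K u)" if "u \<in> P" for u
  proof -
    have 1: "H (K u + scale c u) = H (K u) + scale c (H u)" for c
      using eH mem[OF that] that by (simp add: endo_def)
    have 2: "scale (2 * \<i>) x = scale \<i> x + scale \<i> x" for x by (simp flip: scale_left_distrib)
    show ?thesis unfolding shift_def 1 2
      by (simp add: scale_right_distrib scale_right_diff_distrib algebra_simps)
  qed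
  have inj: "x = y" if xy: "x \<in> P" "y \<in> P" and "?X x = ?X y" for x y
  proof -
    have "?X (x - y) = 0" using endo_diff[OF endo_shift[OF eH] sub xy] that(3) by simp
    then have "x - y = 0" using resolvent(2)[OF H _ subspace_diff[OF sub xy], of "-\<i>"] by simp
    then show ?thesis by simp
  qed
  have iff: "A (B (?Y u)) = ?Y u \<longleftrightarrow> H u + K u = 0" if u: "u \<in> P" for u
  proof -
    have P: "?Y u \<in> P" "?V u \<in> P" using endo_shift[OF eK] u by (auto simp: endo_def)
    have "A (B (?Y u)) = ?Y u \<longleftrightarrow> A (?V u) = ?Y u" using B u by (simp add: cayley_def)
    also have "\<dots> \<longleftrightarrow> ?X (A (?V u)) = ?X (?Y u)" using inj[OF uA[OF P(2)] P(1)] by auto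
    also have "\<dots> \<longleftrightarrow> ?Z (?V u) = ?X (?Y u)" using A P by (simp add: cayley_def)
    also have "\<dots> \<longleftrightarrow> scale (2 * \<i>) (H u + K u) = 0" using diff[OF u] by auto
    also have "\<dots> \<longleftrightarrow> H u + K u = 0" by simp
    finally show ?thesis .
  qed
  let ?S = "{u \<in> P. H u + K u = 0}"
  have "{y \<in> P. A (B y) = y} = ?Y ` ?S"
  proof
    show "{y \<in> P. A (B y) = y} \<subseteq> ?Y ` ?S"
    proof
      fix y assume y: "y \<in> {y \<in> P. A (B y) = y}"
      then obtain u where "u \<in> P" "?Y u = y" using resolvent(1)[OF K, of "-\<i>" y] by auto
      then show "y \<in> ?Y ` ?S" using iff y by (intro image_eqI[of _ _ u]) auto
    qed
    show "?Y ` ?S \<subseteq> {y \<in> P. A (B y) = y}" using iff endo_shift[OF eK] by (auto simp: endo_def)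
  qed
  moreover have "dim (?Y ` ?S) = dim ?S"
  proof (rule dim_image_injective)
    show "?Y (x + y) = ?Y x + ?Y y" if "x \<in> P" "y \<in> P" for x y
      using endo_shift[OF eK] that by (simp add: endo_def)
    show "?Y (scale c x) = scale c (?Y x)" if "x \<in> P" for c x
      using endo_shift[OF eK] that by (simp add: endo_def)
    show "subspace ?S"
    proof (rule subspaceI)
      show "0 \<in> ?S" using subspace_0[OF sub] endo_0[OF eH] endo_0[OF eK] by simp
      fix x y assume xy: "x \<in> ?S" "y \<in> ?S"
      then have xyP: "x \<in> P" "y \<in> P" by simp_all
      have "H (x + y) + K (x + y) = (H x + K x) + (H y + K y)" using xyP eH eK by (simp add: endo_def add_ac)
      then show "x + y \<in> ?S" using xy subspace_add[OF sub] by simp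
      fix c
      have "H (scale c x) + K (scale c x) = scale c (H x + K x)" using xyP eH eK by (simp add: endo_def scale_right_distrib)
      then show "scale c x \<in> ?S" using xy mem(3) by simp
    qed
    show "?S \<subseteq> P" by auto
    show "u = 0" if "u \<in> P" "?Y u = 0" for u using resolvent(2)[OF K _ that] by simp
  qed
  ultimately show ?thesis by simp
qed

text \<open>Multiplying by the determinants of H - i and K - i clears the denominators. What remains
  on the right is polynomial in the entries of \<open>H\<close> and \<open>K\<close>, hence
  continuous along paths of such operators.\<close>

lemma cayley_char:
  assumes A: "cayley H A" and B: "cayley K B"
  shows "Det (shift H (-\<i>)) * Det (\<lambda>x. scale z x - A (B x)) * Det (shift K (-\<i>)) =
    Det (\<lambda>u. scale z (shift H (-\<i>) (shift K (-\<i>) u)) - shift H \<i> (shift K \<i> u))"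
    and "Det (shift H (-\<i>)) * Det (\<lambda>x. scale z x - A x) =
    Det (\<lambda>u. scale z (shift H (-\<i>) u) - shift H \<i> u)"
proof -
  let ?X = "shift H (-\<i>)" and ?Y = "shift K (-\<i>)" and ?V = "shift K \<i>"
  have X: "endo P ?X" and Y: "endo P ?Y" and V: "endo P ?V"
    using A B by (simp_all add: cayley_def hermitian_def endo_shift)
  have eA: "endo P A" and eB: "endo P B" using A B by (simp_all add: cayley_def unitary_def)
  have zA: "endo P (\<lambda>x. scale z x - T x)" if "endo P T" for T
    using that unfolding endo_def
    by (auto simp: subspace_diff[OF sub] subspace_scale[OF sub] scale_right_distrib scale_right_diff_distrib scale_left_commute)
  have X_diff: "?X (scale z x - y) = scale z (?X x) - ?X y" if "x \<in> P" "y \<in> P" for x y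
    using endo_diff[OF X sub, of "scale z x" y] that X by (simp add: subspace_scale[OF sub] endo_def)
  have AB: "endo P (\<lambda>x. A (B x))" using eA eB by (rule endo_comp)
  have Yp: "?Y (p j) \<in> P" "?V (p j) \<in> P" if "j < n" for j using Y V p_mem[OF that] by (simp_all add: endo_def)
  have "Det ?X * Det (\<lambda>x. scale z x - A (B x)) * Det ?Y =
    Det ?X * Det (\<lambda>u. scale z (?Y u) - A (B (?Y u)))"
    using Det_comp[OF zA[OF AB], of ?Y] Yp by simp
  also have "\<dots> = Det (\<lambda>u. ?X (scale z (?Y u) - A (B (?Y u))))"
    using zA[OF AB] Yp by (intro Det_comp[OF X, symmetric]) (auto simp: endo_def)
  also have "\<dots> = Det (\<lambda>u. scale z (?X (?Y u)) - shift H \<i> (?V u))"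
  proof (rule Det_cong)
    fix j assume j: "j < n"
    have "B (?Y (p j)) = ?V (p j)" using B p_mem[OF j] by (simp add: cayley_def)
    then show "?X (scale z (?Y (p j)) - A (B (?Y (p j)))) = scale z (?X (?Y (p j))) - shift H \<i> (?V (p j))"
      using X_diff[OF Yp(1)[OF j], of "A (?V (p j))"] eA Yp(2)[OF j] A by (simp add: endo_def cayley_def)
  qed
  finally show "Det ?X * Det (\<lambda>x. scale z x - A (B x)) * Det ?Y =
    Det (\<lambda>u. scale z (?X (?Y u)) - shift H \<i> (?V u))" .
  have "Det ?X * Det (\<lambda>x. scale z x - A x) = Det (\<lambda>u. ?X (scale z u - A u))"
    using zA[OF eA] p_mem by (intro Det_comp[OF X, symmetric]) (auto simp: endo_def)
  also have "\<dots> = Det (\<lambda>u. scale z (?X u) - shift H \<i> u)"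
    using X_diff p_mem eA A by (intro Det_cong) (simp add: endo_def cayley_def)
  finally show "Det ?X * Det (\<lambda>x. scale z x - A x) = Det (\<lambda>u. scale z (?X u) - shift H \<i> u)" .
qed

lemma cayley_angles_path:
  fixes a b :: real
  assumes "a \<le> b" and A: "\<And>s. s \<in> {a..b} \<Longrightarrow> cayley (H s) (A s)" and H: "entries_continuous {a..b} H"
  shows "\<exists>\<theta>. (\<forall>j<n. continuous_on {a..b} (\<theta> j)) \<and> (\<forall>s\<in>{a..b}. angles (A s) (\<lambda>j. \<theta> j s))"
proof (rule angles_path[OF assms(1)])
  show "unitary (A s)" if "s \<in> {a..b}" for s using A[OF that] by (simp add: cayley_def)
  have c: "continuous_on {a..b} (\<lambda>s. g (H s (p j)) (p i))" if "i < n" "j < n" for i j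
    using H that by (simp add: entries_continuous_def)
  fix z
  have 1: "continuous_on {a..b} (\<lambda>s. Det (shift (H s) (-\<i>)))"
    by (intro entries_continuous_Det) (auto simp: entries_continuous_def shift_def g_simps intro!: continuous_intros c)
  have 2: "continuous_on {a..b} (\<lambda>s. Det (\<lambda>u. scale z (shift (H s) (-\<i>) u) - shift (H s) \<i> u))"
    by (intro entries_continuous_Det) (auto simp: entries_continuous_def shift_def g_simps intro!: continuous_intros c)
  have nz: "Det (shift (H s) (-\<i>)) \<noteq> 0" if "s \<in> {a..b}" for s
    using A[OF that] by (intro resolvent(3)) (simp_all add: cayley_def)
  have eq: "Det (\<lambda>x. scale z x - A s x) =
      Det (\<lambda>u. scale z (shift (H s) (-\<i>) u) - shift (H s) \<i> u) / Det (shift (H s) (-\<i>))" if "s \<in> {a..b}" for s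
    using cayley_char(2)[OF A[OF that] A[OF that], of z] nz[OF that] by (simp add: field_simps)
  have "continuous_on {a..b} (\<lambda>s. Det (\<lambda>u. scale z (shift (H s) (-\<i>) u) - shift (H s) \<i> u) / Det (shift (H s) (-\<i>)))"
    using 1 2 nz by (intro continuous_on_divide) auto
  then show "continuous_on {a..b} (\<lambda>s. Det (\<lambda>x. scale z x - A s x))"
    by (subst continuous_on_cong[OF refl eq]) auto
qed

lemma cayley_product_angles_path:
  fixes a b :: real
  assumes "a \<le> b" and A: "\<And>s. s \<in> {a..b} \<Longrightarrow> cayley (H s) (A s)" and H: "entries_continuous {a..b} H"
    and B: "\<And>s. s \<in> {a..b} \<Longrightarrow> cayley (K s) (B s)" and K: "entries_continuous {a..b} K"
  shows "\<exists>\<theta>. (\<forall>j<n. continuous_on {a..b} (\<theta> j)) \<and> (\<forall>s\<in>{a..b}. angles (\<lambda>x. A s (B s x)) (\<lambda>j. \<theta> j s))"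
proof (rule angles_path[OF assms(1)])
  show "unitary (\<lambda>x. A s (B s x))" if "s \<in> {a..b}" for s
    using A[OF that] B[OF that] by (simp add: cayley_def unitary_def endo_def)
  have eH: "endo P (H s)" and eK: "endo P (K s)" if "s \<in> {a..b}" for s
    using A[OF that] B[OF that] by (simp_all add: cayley_def hermitian_def)
  have cH: "entries_continuous {a..b} (\<lambda>s. shift (H s) c)" for c
    using H unfolding entries_continuous_def shift_def by (auto simp: g_simps intro!: continuous_intros)
  have cK: "entries_continuous {a..b} (\<lambda>s. shift (K s) c)" for c
    using K unfolding entries_continuous_def shift_def by (auto simp: g_simps intro!: continuous_intros)
  have cHK: "entries_continuous {a..b} (\<lambda>s x. shift (H s) c (shift (K s) d x))" for c d
    by (rule entries_continuous_comp[OF cH cK]) (simp_all add: endo_shift eH eK)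
  fix z
  let ?N = "\<lambda>s u. scale z (shift (H s) (-\<i>) (shift (K s) (-\<i>) u)) - shift (H s) \<i> (shift (K s) \<i> u)"
  have N: "continuous_on {a..b} (\<lambda>s. Det (?N s))"
    using cHK unfolding entries_continuous_def
    by (intro entries_continuous_Det) (auto simp: entries_continuous_def g_simps intro!: continuous_intros)
  have nz: "Det (shift (H s) (-\<i>)) \<noteq> 0" "Det (shift (K s) (-\<i>)) \<noteq> 0" if "s \<in> {a..b}" for s
    using resolvent(3)[of "H s" "-\<i>"] resolvent(3)[of "K s" "-\<i>"] A[OF that] B[OF that] by (simp_all add: cayley_def)
  have eq: "Det (\<lambda>x. scale z x - A s (B s x)) =
      Det (?N s) / (Det (shift (H s) (-\<i>)) * Det (shift (K s) (-\<i>)))" if "s \<in> {a..b}" for s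
    using cayley_char(1)[OF A[OF that] B[OF that], of z] nz[OF that] by (simp add: field_simps)
  have "continuous_on {a..b} (\<lambda>s. Det (?N s) / (Det (shift (H s) (-\<i>)) * Det (shift (K s) (-\<i>))))"
    by (intro continuous_on_divide continuous_on_mult N entries_continuous_Det[OF cH] entries_continuous_Det[OF cK])
      (simp add: nz)
  then show "continuous_on {a..b} (\<lambda>s. Det (\<lambda>x. scale z x - A s (B s x)))"
    by (subst continuous_on_cong[OF refl eq]) auto
qed

text \<open>
  The deformation of \<open>(H, K)\<close> to \<open>(H + K, 0)\<close> keeps \<open>H + K\<close> fixed. Hence the multiplicity of the
  eigenvalue 1 stays constant for the product, as well as for the two factors, where it is 0. So
  the three sums of ceilings do not change, and the total angles cancel because the determinant
  is multiplicative.
\<close>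
lemma tau_cayley_product:
  assumes A: "cayley H A" and B: "cayley K B"
    and e: "orthobasis P e n" and d: "\<And>k. k < n \<Longrightarrow> H (e k) + K (e k) = scale (of_real (d k)) (e k)"
  shows "tau A + tau B - tau (\<lambda>x. A (B x)) = card {k \<in> {..<n}. 0 \<le> d k}"
proof -
  have hH: "hermitian H" and hK: "hermitian K" using A B by (simp_all add: cayley_def)
  have eH: "endo P H" and eK: "endo P K" using hH hK by (simp_all add: hermitian_def)
  have mem: "H u \<in> P" "K u \<in> P" if "u \<in> P" for u using that eH eK by (simp_all add: endo_def)
  define Ks where "Ks s x = scale (of_real s) (K x)" for s :: real and x
  define Hs where "Hs s x = H x + K x - scale (of_real s) (K x)" for s :: real and x
  have hHs: "hermitian (Hs s)" for s
    using hH hK unfolding hermitian_def endo_def Hs_def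
    by (auto simp: g_simps subspace_add[OF sub] subspace_diff[OF sub] subspace_scale[OF sub]
        scale_right_distrib scale_right_diff_distrib scale_left_commute)
  have hKs: "hermitian (Ks s)" for s
    using hK unfolding hermitian_def endo_def Ks_def
    by (auto simp: g_simps subspace_scale[OF sub] scale_right_distrib scale_left_commute)
  obtain As0 where As0: "\<And>s. cayley (Hs s) (As0 s)" using cayley_exists[OF hHs] by metis
  obtain Bs0 where Bs0: "\<And>s. cayley (Ks s) (Bs0 s)" using cayley_exists[OF hKs] by metis
  \<comment> \<open>The transforms picked by choice need not be literally \<open>A\<close> and
    \<open>B\<close> at \<open>s = 1\<close>, so they are replaced there. The angles still form
    continuous paths, since these are obtained from the continuity of \<open>Hs\<close> and
    \<open>Ks\<close>.\<close>
  define As where "As s = (if s = 1 then A else As0 s)" for s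
  define Bs where "Bs s = (if s = 1 then B else Bs0 s)" for s
  have "Hs 1 = H" "Ks 1 = K" by (auto simp: Hs_def Ks_def)
  then have As: "cayley (Hs s) (As s)" and Bs: "cayley (Ks s) (Bs s)" for s
    using As0 Bs0 A B by (auto simp: As_def Bs_def)
  have cH: "entries_continuous {0..1} Hs" and cK: "entries_continuous {0..1} Ks"
    unfolding entries_continuous_def Hs_def Ks_def by (auto simp: g_simps intro!: continuous_intros)
  obtain \<theta>1 where \<theta>1: "\<forall>j<n. continuous_on {0..1} (\<theta>1 j)" "\<forall>s\<in>{0..1}. angles (As s) (\<lambda>j. \<theta>1 j s)"
    using cayley_angles_path[OF zero_le_one As cH] by (elim exE conjE)
  obtain \<theta>2 where \<theta>2: "\<forall>j<n. continuous_on {0..1} (\<theta>2 j)" "\<forall>s\<in>{0..1}. angles (Bs s) (\<lambda>j. \<theta>2 j s)"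
    using cayley_angles_path[OF zero_le_one Bs cK] by (elim exE conjE)
  obtain \<theta>3 where \<theta>3: "\<forall>j<n. continuous_on {0..1} (\<theta>3 j)"
      "\<forall>s\<in>{0..1}. angles (\<lambda>x. As s (Bs s x)) (\<lambda>j. \<theta>3 j s)"
    using cayley_product_angles_path[OF zero_le_one As cH Bs cK] by (elim exE conjE)
  have fixed: "card {j \<in> {..<n}. cis (t j) = 1} = dim {y \<in> P. W y = y}" if "angles W t" for W t
    using that unfolding angles_def by (metis (no_types, lifting) Collect_cong scale_one)
  have c1: "(\<Sum>j<n. \<lceil>\<theta>1 j 1 / (2 * pi)\<rceil>) = (\<Sum>j<n. \<lceil>\<theta>1 j 0 / (2 * pi)\<rceil>)"
  proof (rule sum_ceiling_constant)
    show "card {j \<in> {..<n}. cis (\<theta>1 j s) = 1} = 0" if "s \<in> {0..1}" for s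
      by (rule trans[OF fixed[OF \<theta>1(2)[rule_format, OF that]] cayley_fixed_dim[OF As]])
  qed (use \<theta>1(1) in auto)
  have c2: "(\<Sum>j<n. \<lceil>\<theta>2 j 1 / (2 * pi)\<rceil>) = (\<Sum>j<n. \<lceil>\<theta>2 j 0 / (2 * pi)\<rceil>)"
  proof (rule sum_ceiling_constant)
    show "card {j \<in> {..<n}. cis (\<theta>2 j s) = 1} = 0" if "s \<in> {0..1}" for s
      by (rule trans[OF fixed[OF \<theta>2(2)[rule_format, OF that]] cayley_fixed_dim[OF Bs]])
  qed (use \<theta>2(1) in auto)
  have c3: "(\<Sum>j<n. \<lceil>\<theta>3 j 1 / (2 * pi)\<rceil>) = (\<Sum>j<n. \<lceil>\<theta>3 j 0 / (2 * pi)\<rceil>)"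
  proof (rule sum_ceiling_constant)
    show "card {j \<in> {..<n}. cis (\<theta>3 j s) = 1} = dim {u \<in> P. H u + K u = 0}" if "s \<in> {0..1}" for s
    proof -
      have "Hs s u + Ks s u = H u + K u" for u by (simp add: Hs_def Ks_def)
      then show ?thesis
        using fixed[of "\<lambda>x. As s (Bs s x)"] \<theta>3(2) that cayley_product_fixed_dim[OF As Bs, of s] by simp
    qed
  qed (use \<theta>3(1) in auto)
  define F where "F s = (\<Sum>j<n. \<theta>1 j s) + (\<Sum>j<n. \<theta>2 j s) - (\<Sum>j<n. \<theta>3 j s)" for s
  have "F 1 = F 0"
  proof (rule cis_constant_imp_constant[where f = F and a = 0 and b = 1 and c = 1 and s = 1])
    show "continuous_on {0..1} F" unfolding F_def using \<theta>1(1) \<theta>2(1) \<theta>3(1) by (intro continuous_intros) auto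
    fix s :: real assume s: "s \<in> {0..1}"
    have u: "unitary (As s)" "unitary (Bs s)" using As Bs by (simp_all add: cayley_def)
    then have u3: "unitary (\<lambda>x. As s (Bs s x))" by (simp add: unitary_def endo_def)
    have "Det (\<lambda>x. As s (Bs s x)) = Det (As s) * Det (Bs s)"
      using u p_mem by (intro Det_comp) (auto simp: unitary_def endo_def)
    then have "cis (\<Sum>j<n. \<theta>3 j s) = cis (\<Sum>j<n. \<theta>1 j s) * cis (\<Sum>j<n. \<theta>2 j s)"
      using angles_Det[OF u(1), of "\<lambda>j. \<theta>1 j s"] angles_Det[OF u(2), of "\<lambda>j. \<theta>2 j s"]
        angles_Det[OF u3, of "\<lambda>j. \<theta>3 j s"] \<theta>1(2) \<theta>2(2) \<theta>3(2) s by simp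
    then show "cis (F s) = 1" unfolding F_def by (simp add: cis_divide[symmetric] cis_mult[symmetric])
  qed simp
  then have Feq: "(\<Sum>j<n. \<theta>1 j 1) + (\<Sum>j<n. \<theta>2 j 1) - (\<Sum>j<n. \<theta>3 j 1)
      = (\<Sum>j<n. \<theta>1 j 0) + (\<Sum>j<n. \<theta>2 j 0) - (\<Sum>j<n. \<theta>3 j 0)" by (simp add: F_def)
  define G where "G s = tau (As s) + tau (Bs s) - tau (\<lambda>x. As s (Bs s x))" for s
  have G: "G s = of_int ((\<Sum>j<n. \<lceil>\<theta>1 j s / (2 * pi)\<rceil>) + (\<Sum>j<n. \<lceil>\<theta>2 j s / (2 * pi)\<rceil>) - (\<Sum>j<n. \<lceil>\<theta>3 j s / (2 * pi)\<rceil>))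
      - ((\<Sum>j<n. \<theta>1 j s) + (\<Sum>j<n. \<theta>2 j s) - (\<Sum>j<n. \<theta>3 j s)) / (2 * pi)" if "s \<in> {0..1}" for s
    using sum_ceiling_angles[of "As s" "\<lambda>j. \<theta>1 j s"] sum_ceiling_angles[of "Bs s" "\<lambda>j. \<theta>2 j s"]
      sum_ceiling_angles[of "\<lambda>x. As s (Bs s x)" "\<lambda>j. \<theta>3 j s"] \<theta>1(2) \<theta>2(2) \<theta>3(2) that
    by (simp add: G_def diff_divide_distrib add_divide_distrib)
  have "G 1 = G 0" using G[of 0] G[of 1] c1 c2 c3 Feq by simp
  moreover have "G 1 = tau A + tau B - tau (\<lambda>x. A (B x))" by (simp add: G_def As_def Bs_def)
  \<comment> \<open>At \<open>s = 0\<close> the second operator is the Cayley transform -1 of 0, and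
    the first is the Cayley transform of H + K. Everything is diagonal in \<open>e\<close>, and
    \<open>cayley_angle\<close> evaluates each term.\<close>
  moreover have "G 0 = card {k \<in> {..<n}. 0 \<le> d k}"
  proof -
    have "\<exists>x. cis x * (of_real (d k) - \<i>) = of_real (d k) + \<i> \<and>
        gap x + gap pi - gap (x + pi) = (if 0 \<le> d k then 1 else 0)" for k by (rule cayley_angle)
    then obtain x where x: "\<And>k. cis (x k) * (of_real (d k) - \<i>) = of_real (d k) + \<i>"
      "\<And>k. gap (x k) + gap pi - gap (x k + pi) = (if 0 \<le> d k then 1 else 0)" by metis
    have endoA: "endo P (As 0)" and endoB: "endo P (Bs 0)" using As[of 0] Bs[of 0] by (simp_all add: cayley_def unitary_def)
    \<comment> \<open>With \<open>Ks 0 = 0\<close> the argument \<i> y is chosen so that the two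
      shifts become y and - y.\<close>
    have Bm: "Bs 0 y = - y" if "y \<in> P" for y
    proof -
      have "Bs 0 (shift (Ks 0) (-\<i>) (scale \<i> y)) = shift (Ks 0) \<i> (scale \<i> y)"
        using Bs[of 0] that by (simp add: cayley_def subspace_scale[OF sub])
      then show ?thesis by (simp add: shift_def Ks_def)
    qed
    have Ae: "As 0 (e k) = scale (cis (x k)) (e k)" if k: "k < n" for k
    proof -
      have nz: "of_real (d k) - \<i> \<noteq> 0" by (simp add: complex_eq_iff)
      have sh: "shift (Hs 0) c (e k) = scale (of_real (d k) + c) (e k)" for c
        using d[OF k] by (simp add: shift_def Hs_def scale_left_distrib)
      have "As 0 (shift (Hs 0) (-\<i>) (e k)) = shift (Hs 0) \<i> (e k)"
        using As[of 0] orthobasis_mem[OF e k] by (simp add: cayley_def)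
      then have "scale (of_real (d k) - \<i>) (As 0 (e k)) = scale (cis (x k) * (of_real (d k) - \<i>)) (e k)"
        using endoA orthobasis_mem[OF e k] unfolding sh x(1) by (simp add: endo_def)
      then have "scale (of_real (d k) - \<i>) (As 0 (e k)) = scale (of_real (d k) - \<i>) (scale (cis (x k)) (e k))"
        by (simp add: mult.commute)
      then show ?thesis using nz by (simp only: scale_cancel_left) simp
    qed
    have a1: "angles (As 0) x" by (rule angles_eigenbasis[OF endoA e Ae])
    have a2: "angles (Bs 0) (\<lambda>_. pi)"
      by (rule angles_eigenbasis[OF endoB e]) (simp add: Bm orthobasis_mem[OF e])
    have a3: "angles (\<lambda>y. As 0 (Bs 0 y)) (\<lambda>k. x k + pi)"
    proof (rule angles_eigenbasis[OF endo_comp[OF endoA endoB] e])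
      fix k assume k: "k < n"
      have "As 0 (- e k) = - As 0 (e k)"
        using endo_diff[OF endoA sub subspace_0[OF sub] orthobasis_mem[OF e k]] endo_0[OF endoA] by simp
      then show "As 0 (Bs 0 (e k)) = scale (cis (x k + pi)) (e k)"
        by (simp add: Bm orthobasis_mem[OF e k] Ae[OF k] cis_mult[symmetric])
    qed
    have "G 0 = (\<Sum>k<n. gap (x k) + gap pi - gap (x k + pi))"
      unfolding G_def tau_eq[OF a1] tau_eq[OF a2] tau_eq[OF a3] by (simp add: sum.distrib sum_subtractf)
    also have "\<dots> = card {k \<in> {..<n}. 0 \<le> d k}" unfolding x(2) by (simp add: sum.If_cases Int_def)
    finally show ?thesis .
  qed
  ultimately show ?thesis by simp
qed

end

section \<open>Lagrangian subspaces as graphs\<close>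

context hermitian_form begin

lemma orthogonal_decomposition:
  assumes "positive_on S"
  shows "\<exists>s\<in>S. \<forall>u\<in>S. g (x - s) u = 0"
proof -
  obtain e where e: "orthobasis S e (dim S)" using orthobasis_exists[OF assms] by (rule exE)
  let ?s = "\<Sum>k<dim S. scale (g x (e k)) (e k)"
  have S: "subspace S" using assms by (simp add: positive_on_def)
  have s: "?s \<in> S" by (intro subspace_sum[OF S] subspace_scale[OF S]) (simp add: orthobasis_mem[OF e])
  have 0: "g (x - ?s) (e k) = 0" if "k < dim S" for k
    using orthobasis_coeff[OF e that, of "\<lambda>k. g x (e k)"] by (simp add: g_diff)
  have "g (x - ?s) u = 0" if "u \<in> S" for u
    using 0 orthobasis_inner[OF e that, of "x - ?s"] herm[of u "x - ?s"] herm[of "x - ?s" "e k" for k] by simp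
  then show ?thesis using s by blast
qed

end

context complex_symplectic_space begin

lemma omega_add: "\<omega> (x + y) z = \<omega> x z + \<omega> y z" "\<omega> z (x + y) = \<omega> z x + \<omega> z y"
  and omega_scale: "\<omega> (scale c x) z = c * \<omega> x z" "\<omega> z (scale c x) = cnj c * \<omega> z x"
  using omega_sesquilinear unfolding sesquilinear_def by simp_all

lemma omega_0 [simp]: "\<omega> 0 z = 0" "\<omega> z 0 = 0"
  using omega_scale(1)[of 0 0 z] omega_scale(2)[of z 0 0] by simp_all

lemma omega_minus: "\<omega> (- x) z = - \<omega> x z" "\<omega> z (- x) = - \<omega> z x"
  using omega_add(1)[of x "- x" z] omega_add(2)[of z x "- x"] by (simp_all add: add_eq_0_iff)

lemma omega_diff: "\<omega> (x - y) z = \<omega> x z - \<omega> y z" "\<omega> z (x - y) = \<omega> z x - \<omega> z y"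
  using omega_add(1)[of x "- y" z] omega_add(2)[of z x "- y"] by (simp_all add: omega_minus)

lemmas omega_simps = omega_add omega_scale omega_minus omega_diff

definition herm_pos :: "'v \<Rightarrow> 'v \<Rightarrow> complex" where
  "herm_pos x y = - \<i> * \<omega> x y"

definition herm_neg :: "'v \<Rightarrow> 'v \<Rightarrow> complex" where
  "herm_neg x y = \<i> * \<omega> x y"

lemma lagrangian_subspace: "lagrangian L \<Longrightarrow> subspace L"
  by (simp add: lagrangian_def)

lemma lagrangian_isotropic: "lagrangian L \<Longrightarrow> x \<in> L \<Longrightarrow> y \<in> L \<Longrightarrow> \<omega> x y = 0"
  unfolding lagrangian_def annihilator_def by blast

lemma lagrangian_maximal: "lagrangian L \<Longrightarrow> (\<And>y. y \<in> L \<Longrightarrow> \<omega> x y = 0) \<Longrightarrow> x \<in> L"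
  unfolding lagrangian_def annihilator_def by blast

lemma omega_swap_0: "\<omega> x y = 0 \<Longrightarrow> \<omega> y x = 0"
  using omega_skew[of y x] by simp

end

locale symplectic_fdvs = complex_symplectic_space scale \<omega> + complex_fdvs scale Basis
  for scale :: "complex \<Rightarrow> 'v::ab_group_add \<Rightarrow> 'v" and \<omega> Basis
begin

sublocale pos_form: hermitian_form scale Basis herm_pos
proof
  show "sesquilinear scale herm_pos"
    by (simp add: sesquilinear_def herm_pos_def omega_simps algebra_simps)
  show "herm_pos y x = cnj (herm_pos x y)" for x y using omega_skew[of y x] by (simp add: herm_pos_def)
qed

sublocale neg_form: hermitian_form scale Basis herm_neg
proof
  show "sesquilinear scale herm_neg"
    by (simp add: sesquilinear_def herm_neg_def omega_simps algebra_simps)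
  show "herm_neg y x = cnj (herm_neg x y)" for x y using omega_skew[of y x] by (simp add: herm_neg_def)
qed

end

text \<open>The properties of \<open>V_minus J\<close> and \<open>V_plus J\<close> on which the
  argument rests, freed from the inner product and from \<open>J\<close>. This allows two
  polarizations of the same space side by side, as \<open>maslov_unique\<close> requires. The value
  \<i> in \<open>p_orth\<close> says that \<open>p\<close> is orthonormal for -i \<omega>.\<close>

locale polarization = symplectic_fdvs scale \<omega> Basis
  for scale :: "complex \<Rightarrow> 'v::ab_group_add \<Rightarrow> 'v" and \<omega> Basis +
  fixes N P :: "'v set" and p :: "nat \<Rightarrow> 'v" and n :: nat
  assumes N: "subspace N" and P: "subspace P"
    and decomposition: "\<And>x. \<exists>u\<in>N. \<exists>v\<in>P. x = u + v"
    and omega_NP: "\<And>u v. u \<in> N \<Longrightarrow> v \<in> P \<Longrightarrow> \<omega> u v = 0"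
    and omega_P: "\<And>v. v \<in> P \<Longrightarrow> v \<noteq> 0 \<Longrightarrow> 0 < Im (\<omega> v v)"
    and omega_N: "\<And>u. u \<in> N \<Longrightarrow> u \<noteq> 0 \<Longrightarrow> Im (\<omega> u u) < 0"
    and p_span: "P = span (p ` {..<n})"
    and p_orth: "\<And>i j. i < n \<Longrightarrow> j < n \<Longrightarrow> \<omega> (p i) (p j) = (if i = j then \<i> else 0)"
begin

sublocale frame scale Basis herm_pos P p n
proof
  show "pos_form.positive_on P" using P omega_P by (simp add: pos_form.positive_on_def herm_pos_def)
  show "pos_form.orthobasis P p n" using p_span p_orth by (auto simp: pos_form.orthobasis_def herm_pos_def)
qed

lemma omega_PN: "u \<in> N \<Longrightarrow> v \<in> P \<Longrightarrow> \<omega> v u = 0"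
  using omega_NP omega_swap_0 by blast

lemma P_definite: "v \<in> P \<Longrightarrow> \<omega> v v = 0 \<Longrightarrow> v = 0"
  using omega_P[of v] by fastforce

lemma N_definite: "u \<in> N \<Longrightarrow> \<omega> u u = 0 \<Longrightarrow> u = 0"
  using omega_N[of u] by fastforce

lemma NP_trivial: "x \<in> N \<Longrightarrow> x \<in> P \<Longrightarrow> x = 0"
  using omega_NP[of x x] P_definite by blast

lemma positive_on_N: "S \<subseteq> N \<Longrightarrow> subspace S \<Longrightarrow> neg_form.positive_on S"
  using omega_N by (auto simp: neg_form.positive_on_def herm_neg_def)

lemma positive_on_P: "S \<subseteq> P \<Longrightarrow> subspace S \<Longrightarrow> pos_form.positive_on S"
  using omega_P by (auto simp: pos_form.positive_on_def herm_pos_def)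

text \<open>Let S be the projection of \<open>L\<close> to \<open>A\<close> along \<open>B\<close>,
  and s the orthogonal projection of x to S. Then x - s annihilates \<open>L\<close>, so it lies in
  \<open>L\<close> by maximality; being isotropic in the definite half \<open>A\<close>, it is 0.
  Abstract halves are used so that the lemma applies with \<open>N\<close> and \<open>P\<close> in
  either role.\<close>

lemma lagrangian_projects_onto:
  assumes L: "lagrangian L" and A: "subspace A" and B: "subspace B" and x: "x \<in> A"
    and dec: "\<And>x. \<exists>u\<in>A. \<exists>v\<in>B. x = u + v" and AB: "\<And>u v. u \<in> A \<Longrightarrow> v \<in> B \<Longrightarrow> \<omega> u v = 0"
    and definite: "\<And>u. u \<in> A \<Longrightarrow> \<omega> u u = 0 \<Longrightarrow> u = 0"
    and proj: "\<And>S. S \<subseteq> A \<Longrightarrow> subspace S \<Longrightarrow> \<exists>s\<in>S. \<forall>u\<in>S. \<omega> (x - s) u = 0"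
  shows "\<exists>y\<in>B. x + y \<in> L"
proof -
  have sL: "subspace L" using L by (rule lagrangian_subspace)
  let ?S = "{u \<in> A. \<exists>v\<in>B. u + v \<in> L}"
  have "subspace ?S"
  proof (rule subspaceI)
    show "0 \<in> ?S" using subspace_0[OF A] subspace_0[OF B] subspace_0[OF sL] by force
    fix x y assume "x \<in> ?S" "y \<in> ?S"
    then obtain v w where *: "x \<in> A" "y \<in> A" "v \<in> B" "w \<in> B" "x + v \<in> L" "y + w \<in> L" by auto
    have "(x + v) + (y + w) \<in> L" by (rule subspace_add[OF sL *(5,6)])
    then have "(x + y) + (v + w) \<in> L" by (simp add: algebra_simps)
    then show "x + y \<in> ?S" using * subspace_add[OF A] subspace_add[OF B] by blast
    fix c
    have "scale c (x + v) \<in> L" using * by (intro subspace_scale[OF sL])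
    then have "scale c x + scale c v \<in> L" by (simp add: scale_right_distrib)
    then show "scale c x \<in> ?S" using * subspace_scale[OF A] subspace_scale[OF B] by blast
  qed
  then have "\<exists>s\<in>?S. \<forall>u\<in>?S. \<omega> (x - s) u = 0" by (intro proj) auto
  then obtain s where s: "s \<in> ?S" "\<forall>u\<in>?S. \<omega> (x - s) u = 0" by (elim bexE)
  have d: "x - s \<in> A" using x s subspace_diff[OF A] by simp
  have "x - s \<in> L"
  proof (rule lagrangian_maximal[OF L])
    fix l assume l: "l \<in> L"
    obtain u v where uv: "u \<in> A" "v \<in> B" "l = u + v" using dec[of l] by blast
    then have "u \<in> ?S" using l by blast
    then have "\<omega> (x - s) u = 0" using s(2) by blast
    then show "\<omega> (x - s) l = 0" using uv AB[OF d] by (simp add: omega_add)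
  qed
  then have "x - s = 0" using definite[OF d] lagrangian_isotropic[OF L] by blast
  then show ?thesis using s(1) by simp
qed

lemma lagrangian_graph_N:
  assumes L: "lagrangian L" and x: "x \<in> N"
  shows "\<exists>y\<in>P. x + y \<in> L"
proof (rule lagrangian_projects_onto[OF L N P x decomposition omega_NP N_definite])
  fix S assume "S \<subseteq> N" "subspace S"
  then show "\<exists>s\<in>S. \<forall>u\<in>S. \<omega> (x - s) u = 0"
    using neg_form.orthogonal_decomposition[OF positive_on_N, of S x] by (simp add: herm_neg_def)
qed

lemma lagrangian_graph_P:
  assumes L: "lagrangian L" and x: "x \<in> P"
  shows "\<exists>y\<in>N. y + x \<in> L"
proof -
  have "\<exists>y\<in>N. x + y \<in> L"
  proof (rule lagrangian_projects_onto[OF L P N x _ omega_PN P_definite])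
    show "\<exists>u\<in>P. \<exists>v\<in>N. z = u + v" for z using decomposition[of z] add.commute by blast
    fix S assume "S \<subseteq> P" "subspace S"
    then show "\<exists>s\<in>S. \<forall>u\<in>S. \<omega> (x - s) u = 0"
      using pos_form.orthogonal_decomposition[OF positive_on_P, of S x] by (simp add: herm_pos_def)
  qed
  then show ?thesis by (simp add: add.commute)
qed

definition U :: "'v set \<Rightarrow> 'v \<Rightarrow> 'v" where
  "U L x = (SOME y. y \<in> P \<and> x + y \<in> L)"

text \<open>The inverse of \<open>U L\<close>, obtained by reading the same graph over the other
  half.\<close>

definition V :: "'v set \<Rightarrow> 'v \<Rightarrow> 'v" where
  "V L y = (SOME x. x \<in> N \<and> x + y \<in> L)"

lemma U: assumes "lagrangian L" "x \<in> N" shows "U L x \<in> P" "x + U L x \<in> L"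
  using someI_ex[of "\<lambda>y. y \<in> P \<and> x + y \<in> L"] lagrangian_graph_N[OF assms] unfolding U_def by blast+

lemma V: assumes "lagrangian L" "y \<in> P" shows "V L y \<in> N" "V L y + y \<in> L"
  using someI_ex[of "\<lambda>x. x \<in> N \<and> x + y \<in> L"] lagrangian_graph_P[OF assms] unfolding V_def by blast+

lemma U_unique:
  assumes L: "lagrangian L" and x: "x \<in> N" and y: "y \<in> P" and xy: "x + y \<in> L"
  shows "U L x = y"
proof -
  have P': "y - U L x \<in> P" using subspace_diff[OF P y U(1)[OF L x]] .
  have "(x + y) - (x + U L x) \<in> L" by (rule subspace_diff[OF lagrangian_subspace[OF L] xy U(2)[OF L x]])
  then have "y - U L x \<in> L" by simp
  then have "y - U L x = 0" using P_definite[OF P'] lagrangian_isotropic[OF L] by blast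
  then show ?thesis by simp
qed

lemma V_unique:
  assumes L: "lagrangian L" and x: "x \<in> N" and y: "y \<in> P" and xy: "x + y \<in> L"
  shows "V L y = x"
proof -
  have N': "x - V L y \<in> N" using subspace_diff[OF N x V(1)[OF L y]] .
  have "(x + y) - (V L y + y) \<in> L" by (rule subspace_diff[OF lagrangian_subspace[OF L] xy V(2)[OF L y]])
  then have "x - V L y \<in> L" by simp
  then have "x - V L y = 0" using N_definite[OF N'] lagrangian_isotropic[OF L] by blast
  then show ?thesis by simp
qed

lemma UV [simp]: "lagrangian L \<Longrightarrow> y \<in> P \<Longrightarrow> U L (V L y) = y"
  using U_unique[of L "V L y" y] V[of L y] by simp

lemma VU [simp]: "lagrangian L \<Longrightarrow> x \<in> N \<Longrightarrow> V L (U L x) = x"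
  using V_unique[of L x "U L x"] U[of L x] by simp

lemma lagrangian_eq_graph: "lagrangian L \<Longrightarrow> L = {x + U L x | x. x \<in> N}"
proof
  assume L: "lagrangian L"
  show "L \<subseteq> {x + U L x | x. x \<in> N}"
  proof
    fix l assume l: "l \<in> L"
    obtain u v where uv: "u \<in> N" "v \<in> P" "l = u + v" using decomposition[of l] by blast
    then have "U L u = v" using U_unique[OF L] l by simp
    then show "l \<in> {x + U L x | x. x \<in> N}" using uv by auto
  qed
  show "{x + U L x | x. x \<in> N} \<subseteq> L" using U(2)[OF L] by auto
qed

lemma U_add: "lagrangian L \<Longrightarrow> x \<in> N \<Longrightarrow> y \<in> N \<Longrightarrow> U L (x + y) = U L x + U L y"
  and U_scale: "lagrangian L \<Longrightarrow> x \<in> N \<Longrightarrow> U L (scale c x) = scale c (U L x)"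
proof -
  assume L: "lagrangian L" and x: "x \<in> N"
  note Ux = U[OF L x] and sL = lagrangian_subspace[OF L]
  show "U L (scale c x) = scale c (U L x)"
    using subspace_scale[OF sL Ux(2), of c] subspace_scale[OF N x] subspace_scale[OF P Ux(1)]
    by (intro U_unique[OF L]) (simp_all add: scale_right_distrib)
  assume y: "y \<in> N"
  note Uy = U[OF L y]
  show "U L (x + y) = U L x + U L y"
    using subspace_add[OF sL Ux(2) Uy(2)] subspace_add[OF N x y] subspace_add[OF P Ux(1) Uy(1)]
    by (intro U_unique[OF L]) (simp_all add: algebra_simps)
qed

lemma V_add: "lagrangian L \<Longrightarrow> x \<in> P \<Longrightarrow> y \<in> P \<Longrightarrow> V L (x + y) = V L x + V L y"
  and V_scale: "lagrangian L \<Longrightarrow> x \<in> P \<Longrightarrow> V L (scale c x) = scale c (V L x)"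
proof -
  assume L: "lagrangian L" and x: "x \<in> P"
  note Vx = V[OF L x]
  show "V L (scale c x) = scale c (V L x)"
    using U_scale[OF L Vx(1), of c] VU[OF L subspace_scale[OF N Vx(1)], of c] L x by simp
  assume y: "y \<in> P"
  note Vy = V[OF L y]
  show "V L (x + y) = V L x + V L y"
    using U_add[OF L Vx(1) Vy(1)] VU[OF L subspace_add[OF N Vx(1) Vy(1)]] L x y by simp
qed

text \<open>This is the isotropy of the graph: the mixed terms vanish because the two halves are
  \<omega>-orthogonal.\<close>

lemma U_isometry: "lagrangian L \<Longrightarrow> x \<in> N \<Longrightarrow> y \<in> N \<Longrightarrow> \<omega> (U L x) (U L y) = - \<omega> x y"
proof -
  assume L: "lagrangian L" and x: "x \<in> N" and y: "y \<in> N"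
  have "\<omega> (x + U L x) (y + U L y) = 0" using lagrangian_isotropic[OF L] U[OF L] x y by blast
  then show ?thesis using omega_NP[OF x U(1)[OF L y]] omega_PN[OF y U(1)[OF L x]]
    by (simp add: omega_add add_eq_0_iff)
qed

lemma V_isometry: "lagrangian L \<Longrightarrow> x \<in> P \<Longrightarrow> y \<in> P \<Longrightarrow> \<omega> (V L x) (V L y) = - \<omega> x y"
  using U_isometry[of L "V L x" "V L y"] V[of L] by simp

text \<open>Isotropy of the graph is the isometry property. Surjectivity gives maximality: for u + v
  in the annihilator, v - F u is orthogonal to every F w, hence to all of \<open>P\<close>, and
  vanishes by definiteness.\<close>

lemma graph_lagrangian:
  assumes F: "\<And>x. x \<in> N \<Longrightarrow> F x \<in> P" "\<And>x y. x \<in> N \<Longrightarrow> y \<in> N \<Longrightarrow> F (x + y) = F x + F y"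
    "\<And>c x. x \<in> N \<Longrightarrow> F (scale c x) = scale c (F x)" "\<And>x y. x \<in> N \<Longrightarrow> y \<in> N \<Longrightarrow> \<omega> (F x) (F y) = - \<omega> x y"
    and surj: "\<And>y. y \<in> P \<Longrightarrow> \<exists>x\<in>N. F x = y"
  shows "lagrangian {x + F x | x. x \<in> N}" "\<And>x. x \<in> N \<Longrightarrow> U {x + F x | x. x \<in> N} x = F x"
proof -
  let ?L = "{x + F x | x. x \<in> N}"
  have "subspace ?L"
  proof (rule subspaceI)
    have "F 0 = 0" using F(3)[of 0 0] subspace_0[OF N] by simp
    then show "0 \<in> ?L" using subspace_0[OF N] by force
    fix x y assume "x \<in> ?L" "y \<in> ?L"
    then obtain u v where *: "u \<in> N" "v \<in> N" "x = u + F u" "y = v + F v" by auto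
    then have "x + y = (u + v) + F (u + v)" using F(2) by simp
    then show "x + y \<in> ?L" using * subspace_add[OF N] by blast
    fix c
    have "scale c x = scale c u + F (scale c u)" using * F(3) by (simp add: scale_right_distrib)
    then show "scale c x \<in> ?L" using * subspace_scale[OF N] by blast
  qed
  moreover have "?L = annihilator ?L"
  proof
    show "?L \<subseteq> annihilator ?L"
    proof
      fix x assume "x \<in> ?L"
      then obtain u where u: "u \<in> N" "x = u + F u" by auto
      have "\<omega> x y = 0" if "y \<in> ?L" for y
      proof -
        from that obtain v where v: "v \<in> N" "y = v + F v" by auto
        show ?thesis using u v F(1,4) omega_NP omega_PN by (simp add: omega_add)
      qed
      then show "x \<in> annihilator ?L" unfolding annihilator_def by simp
    qed
    show "annihilator ?L \<subseteq> ?L"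
    proof
      fix x assume x: "x \<in> annihilator ?L"
      obtain u v where uv: "u \<in> N" "v \<in> P" "x = u + v" using decomposition[of x] by blast
      have d: "v - F u \<in> P" using uv F(1) subspace_diff[OF P] by simp
      have "\<omega> (v - F u) y = 0" if y: "y \<in> P" for y
      proof -
        obtain w where w: "w \<in> N" "F w = y" using surj[OF y] by blast
        then have "w + F w \<in> ?L" by blast
        then have "\<omega> x (w + F w) = 0" using x unfolding annihilator_def by blast
        then have "\<omega> u w + \<omega> v (F w) = 0"
          using omega_NP[OF uv(1) y] omega_PN[OF w(1) uv(2)] by (simp add: uv(3) w(2) omega_add)
        then show ?thesis using F(4)[OF uv(1) w(1)] w(2) by (simp add: omega_diff add_eq_0_iff)
      qed
      then have "v - F u = 0" using P_definite[OF d] d by blast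
      then have "x = u + F u" using uv by simp
      then show "x \<in> ?L" using uv(1) by blast
    qed
  qed
  ultimately show L: "lagrangian ?L" unfolding lagrangian_def by simp
  show "U ?L x = F x" if "x \<in> N" for x
    using F(1) that by (intro U_unique[OF L]) auto
qed

definition W :: "'v set \<Rightarrow> 'v set \<Rightarrow> 'v \<Rightarrow> 'v" where
  "W L M y = U L (V M y)"

lemma unitary_W:
  assumes "lagrangian L" "lagrangian M"
  shows "unitary (W L M)"
  unfolding unitary_def endo_def W_def herm_pos_def
  using assms U V by (simp add: U_add U_scale V_add V_scale U_isometry V_isometry)

lemma W_mem: "lagrangian L \<Longrightarrow> lagrangian M \<Longrightarrow> y \<in> P \<Longrightarrow> W L M y \<in> P"
  using unitary_W by (simp add: unitary_def endo_def)

lemma endo_W: "lagrangian L \<Longrightarrow> lagrangian M \<Longrightarrow> endo P (W L M)"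
  using unitary_W by (simp add: unitary_def)

lemma W_comp: "lagrangian M \<Longrightarrow> lagrangian K \<Longrightarrow> y \<in> P \<Longrightarrow> W L M (W M K y) = W L K y"
  using V by (simp add: W_def)

lemma W_refl: "lagrangian L \<Longrightarrow> y \<in> P \<Longrightarrow> W L L y = y"
  by (simp add: W_def)

text \<open>A common vector u + v has v as its image under both graph maps, so v is fixed by
  \<open>W L M\<close>; conversely a fixed vector gives a point over which the graphs meet.\<close>

lemma transversal_iff:
  assumes L: "lagrangian L" and M: "lagrangian M"
  shows "L \<inter> M = {0} \<longleftrightarrow> (\<forall>y\<in>P. W L M y = y \<longrightarrow> y = 0)"
proof
  assume *: "L \<inter> M = {0}"
  show "\<forall>y\<in>P. W L M y = y \<longrightarrow> y = 0"
  proof (intro ballI impI)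
    fix y assume y: "y \<in> P" "W L M y = y"
    have "V M y + y \<in> L" using U(2)[OF L V(1)[OF M y(1)]] y(2) by (simp add: W_def)
    then have "V M y + y \<in> L \<inter> M" using V(2)[OF M y(1)] by simp
    then have "V M y + y = 0" using * by blast
    then have "y = - V M y" by (simp add: eq_neg_iff_add_eq_0 add.commute)
    moreover have "- V M y \<in> N" using subspace_neg[OF N V(1)[OF M y(1)]] .
    ultimately show "y = 0" using NP_trivial[of y] y(1) by simp
  qed
next
  assume *: "\<forall>y\<in>P. W L M y = y \<longrightarrow> y = 0"
  have "x = 0" if "x \<in> L" "x \<in> M" for x
  proof -
    obtain u v where uv: "u \<in> N" "v \<in> P" "x = u + v" using decomposition[of x] by blast
    have "W L M v = v" using U_unique[OF L uv(1,2)] V_unique[OF M uv(1,2)] that uv(3) by (simp add: W_def)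
    then have v: "v = 0" using * uv(2) by blast
    then have "u \<in> L" using uv that by simp
    then have "u = 0" using N_definite[OF uv(1)] lagrangian_isotropic[OF L] by blast
    then show ?thesis using v uv by simp
  qed
  then show "L \<inter> M = {0}" using subspace_0[OF lagrangian_subspace[OF L]] subspace_0[OF lagrangian_subspace[OF M]] by blast
qed

text \<open>Composing a graph map with a unitary operator moves a Lagrangian subspace at will. A
  scalar produces transversal subspaces, and a one-parameter family of rotations produces
  paths.\<close>

lemma twisted_lagrangian:
  assumes L: "lagrangian L" and F: "unitary F" and surj: "\<And>y. y \<in> P \<Longrightarrow> \<exists>x\<in>P. F x = y"
  shows "\<exists>D. lagrangian D \<and> D = {x + F (U L x) | x. x \<in> N} \<and> (\<forall>M y. lagrangian M \<longrightarrow> y \<in> P \<longrightarrow> W D M y = F (W L M y))"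
proof -
  let ?D = "{x + F (U L x) | x. x \<in> N}"
  have F': "endo P F" "\<And>x y. x \<in> P \<Longrightarrow> y \<in> P \<Longrightarrow> \<omega> (F x) (F y) = \<omega> x y"
    using F by (auto simp: unitary_def herm_pos_def)
  have s: "\<exists>x\<in>N. F (U L x) = y" if y: "y \<in> P" for y
  proof -
    obtain z where "z \<in> P" "F z = y" using surj[OF y] by blast
    then show ?thesis using V(1)[OF L, of z] L by (intro bexI[of _ "V L z"]) simp_all
  qed
  have g: "F (U L x) \<in> P" "F (U L (scale c x)) = scale c (F (U L x))"
    "y \<in> N \<Longrightarrow> F (U L (x + y)) = F (U L x) + F (U L y)"
    "y \<in> N \<Longrightarrow> \<omega> (F (U L x)) (F (U L y)) = - \<omega> x y" if "x \<in> N" for x y c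
    using F' that U(1)[OF L] by (simp_all add: endo_def U_add[OF L] U_scale[OF L] U_isometry[OF L])
  have D: "lagrangian ?D" "U ?D x = F (U L x)" if "x \<in> N" for x
    using graph_lagrangian[of "\<lambda>x. F (U L x)", OF g(1) g(3) g(2) g(4) s] that by simp_all
  have "W ?D M y = F (W L M y)" if "lagrangian M" "y \<in> P" for M y
    using D(2)[OF V(1)[OF that]] by (simp add: W_def)
  then show ?thesis using D(1)[OF subspace_0[OF N]] by (intro exI[of _ ?D]) simp
qed

text \<open>
  Multiplying \<open>U L0\<close> by a scalar of modulus one rotates all eigenvalues of \<open>W L0 L\<close> at once, so
  that they avoid 1 for the finitely many \<open>L\<close>.
\<close>
lemma transversal_exists:
  assumes "finite S" "S \<noteq> {}" and S: "\<And>L. L \<in> S \<Longrightarrow> lagrangian L"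
  shows "\<exists>D. lagrangian D \<and> (\<forall>L\<in>S. D \<inter> L = {0})"
proof -
  obtain L0 where L0: "L0 \<in> S" using assms(2) by blast
  note l0 = S[OF L0]
  have "\<forall>L\<in>S. \<exists>t. angles (W L0 L) t" using angles_exist unitary_W l0 S by blast
  then have "\<exists>t. \<forall>L\<in>S. angles (W L0 L) (t L)" by (rule bchoice)
  then obtain t where t: "\<forall>L\<in>S. angles (W L0 L) (t L)" by (rule exE)
  have "finite (\<Union>L\<in>S. (\<lambda>j. cis (t L j)) ` {..<n})" using assms(1) by simp
  then obtain \<phi> where \<phi>: "cis \<phi> \<notin> (\<Union>L\<in>S. (\<lambda>j. cis (t L j)) ` {..<n})" by (rule exists_cis_avoiding)
  have nz: "cis \<phi> * cis (- \<phi>) = 1" by (simp add: cis_mult)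
  have u: "unitary (scale (cis (- \<phi>)))"
    unfolding unitary_def endo_def by (auto simp: herm_pos_def omega_scale scale_right_distrib scale_left_commute subspace_scale[OF P]
      cis_cnj cis_mult mult.assoc[symmetric])
  have sur: "\<exists>x\<in>P. scale (cis (- \<phi>)) x = y" if "y \<in> P" for y
    using that by (intro bexI[of _ "scale (cis \<phi>) y"]) (simp_all add: cis_mult subspace_scale[OF P])
  obtain D where D: "lagrangian D" "\<forall>M y. lagrangian M \<longrightarrow> y \<in> P \<longrightarrow> W D M y = scale (cis (- \<phi>)) (W L0 M y)"
    using twisted_lagrangian[OF l0 u sur] by blast
  have "D \<inter> L = {0}" if L: "L \<in> S" for L
    unfolding transversal_iff[OF D(1) S[OF L]]
  proof (intro ballI impI)
    fix y assume y: "y \<in> P" "W D L y = y"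
    have "scale (cis \<phi>) y = scale (cis \<phi>) (scale (cis (- \<phi>)) (W L0 L y))" using D(2) S[OF L] y by simp
    then have "W L0 L y = scale (cis \<phi>) y" by (simp add: nz)
    moreover have e: "{j \<in> {..<n}. cis (t L j) = cis \<phi>} = {}" using \<phi> L by force
    have "angles (W L0 L) (t L)" using t L by simp
    then have "card {j \<in> {..<n}. cis (t L j) = cis \<phi>} = dim {y \<in> P. W L0 L y = scale (cis \<phi>) y}"
      by (simp only: angles_def)
    then have "dim {y \<in> P. W L0 L y = scale (cis \<phi>) y} = 0" unfolding e by simp
    then have "{y \<in> P. W L0 L y = scale (cis \<phi>) y} \<subseteq> {0}" by (simp only: dim_eq_0)
    ultimately show "y = 0" using y(1) by blast
  qed
  then show ?thesis using D(1) by blast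
qed

end

section \<open>The triple index\<close>

context polarization begin

lemma hermitian_quadratic:
  assumes D: "endo P D" and e: "pos_form.orthobasis P e n"
    and d: "\<And>k. k < n \<Longrightarrow> D (e k) = scale (of_real (d k)) (e k)" and u: "u \<in> P"
  shows "Re (herm_pos u (D u)) = (\<Sum>k<n. d k * (norm (herm_pos u (e k)))\<^sup>2)"
proof -
  have Du: "D u = diag e (\<lambda>k. of_real (d k)) u"
    by (rule endo_eqI[OF D endo_diag[OF e] e _ u]) (simp add: d diag_basis[OF e])
  have "herm_pos u (D u) = (\<Sum>k<n. herm_pos u (e k) * herm_pos (e k) (D u))"
    by (rule pos_form.orthobasis_inner[OF e u])
  also have "\<dots> = (\<Sum>k<n. of_real (d k * (norm (herm_pos u (e k)))\<^sup>2))"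
  proof (rule sum.cong[OF refl])
    fix k assume "k \<in> {..<n}"
    then have "herm_pos (e k) (D u) = of_real (d k) * cnj (herm_pos u (e k))"
      using g_diag2[OF e, of k "\<lambda>k. of_real (d k)" u] pos_form.herm[of "e k" u] unfolding Du by simp
    then show "herm_pos u (e k) * herm_pos (e k) (D u) = of_real (d k * (norm (herm_pos u (e k)))\<^sup>2)"
      unfolding of_real_mult complex_norm_square by (simp add: mult_ac)
  qed
  finally show ?thesis by simp
qed

text \<open>Sylvester's law of inertia, transported from \<open>P\<close> by the injection
  \<open>\<phi>\<close>. The span of the negative eigenvectors attains the count. A negative
  definite subspace meets the span of the other eigenvectors only in 0, so a dimension count bounds
  it.\<close>

lemma morse_neg_diagonal:
  assumes add: "\<And>x y. x \<in> P \<Longrightarrow> y \<in> P \<Longrightarrow> \<phi> (x + y) = \<phi> x + \<phi> y"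
    and scl: "\<And>c x. x \<in> P \<Longrightarrow> \<phi> (scale c x) = scale c (\<phi> x)"
    and inj: "\<And>u. u \<in> P \<Longrightarrow> \<phi> u = 0 \<Longrightarrow> u = 0"
    and D: "endo P D" and e: "pos_form.orthobasis P e n"
    and d: "\<And>k. k < n \<Longrightarrow> D (e k) = scale (of_real (d k)) (e k)"
    and q: "\<And>u. u \<in> P \<Longrightarrow> Re (q (\<phi> u) (\<phi> u)) = 2 * Re (herm_pos u (D u))"
  shows "morse_neg (\<phi> ` P) q = card {k \<in> {..<n}. d k < 0}"
proof -
  let ?M = "{dim R | R. subspace R \<and> R \<subseteq> \<phi> ` P \<and> (\<forall>x\<in>R. x \<noteq> 0 \<longrightarrow> Re (q x x) < 0)}"
  let ?neg = "{k \<in> {..<n}. d k < 0}" and ?nn = "{k \<in> {..<n}. 0 \<le> d k}"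
  have phi0: "\<phi> 0 = 0" using scl[of 0 0] subspace_0[OF P] by simp
  have eP: "e k \<in> P" if "k < n" for k using pos_form.orthobasis_mem[OF e that] .
  have qd: "Re (q (\<phi> u) (\<phi> u)) = 2 * (\<Sum>k<n. d k * (norm (herm_pos u (e k)))\<^sup>2)" if "u \<in> P" for u
    using q[OF that] hermitian_quadratic[OF D e d that] by simp
  have coeff0: "herm_pos u (e k) = 0" if "u \<in> span (e ` A)" "A \<subseteq> {..<n}" "k < n" "k \<notin> A" for u A k
  proof -
    have "subspace {u. herm_pos u (e k) = 0}" by (rule subspaceI) (simp_all add: pos_form.g_simps)
    moreover have "e ` A \<subseteq> {u. herm_pos u (e k) = 0}"
      using that by (auto simp: pos_form.orthobasis_orthonormal[OF e] subset_iff)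
    ultimately show ?thesis using span_minimal[of "e ` A"] that(1) by blast
  qed
  have spanP: "span (e ` A) \<subseteq> P" if "A \<subseteq> {..<n}" for A
    using that eP P by (intro span_minimal) auto
  show ?thesis unfolding morse_neg_def
  proof (rule Max_eqI)
    have "?M \<subseteq> {..dimension}" using dim_subset_UNIV by auto
    then show "finite ?M" by (rule finite_subset) simp
  next
    let ?S = "span (e ` ?neg)"
    have SP: "?S \<subseteq> P" by (rule spanP) auto
    have "dim (\<phi> ` ?S) = dim ?S" by (rule dim_image_injective[OF add scl subspace_span SP inj])
    also have "\<dots> = card ?neg" by (rule pos_form.orthobasis_independent(2)[OF e]) auto
    finally have "dim (\<phi> ` ?S) = card ?neg" .
    moreover have "subspace (\<phi> ` ?S)"
    proof (rule subspaceI)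
      show "0 \<in> \<phi> ` ?S" using phi0 span_zero by (metis image_eqI)
      fix x y assume "x \<in> \<phi> ` ?S" "y \<in> \<phi> ` ?S"
      then obtain u v where uv: "u \<in> ?S" "v \<in> ?S" "x = \<phi> u" "y = \<phi> v" by blast
      have uvP: "u \<in> P" "v \<in> P" using uv SP by blast+
      have "x + y = \<phi> (u + v)" using uv add[OF uvP] by simp
      then show "x + y \<in> \<phi> ` ?S" using span_add[OF uv(1,2)] by blast
      fix c
      have "scale c x = \<phi> (scale c u)" using uv scl[OF uvP(1)] by simp
      then show "scale c x \<in> \<phi> ` ?S" using span_scale[OF uv(1)] by blast
    qed
    moreover have "Re (q x x) < 0" if x: "x \<in> \<phi> ` ?S" "x \<noteq> 0" for x
    proof -
      obtain u where u: "u \<in> ?S" "x = \<phi> u" using x(1) by blast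
      have uP: "u \<in> P" using SP u(1) by blast
      have une: "u \<noteq> 0" using x(2) u(2) phi0 by auto
      obtain k where k: "k < n" "herm_pos u (e k) \<noteq> 0"
        using pos_form.orthobasis_eqI[OF e uP subspace_0[OF P]] une by auto
      have dk: "d k < 0" using coeff0[OF u(1) _ k(1)] k by fastforce
      have "0 < (\<Sum>k<n. - (d k * (norm (herm_pos u (e k)))\<^sup>2))"
      proof (rule sum_pos2[of _ k])
        show "0 < - (d k * (norm (herm_pos u (e k)))\<^sup>2)"
          using dk k by (simp add: mult_less_0_iff)
        fix j assume "j \<in> {..<n}"
        then show "0 \<le> - (d j * (norm (herm_pos u (e j)))\<^sup>2)"
          using coeff0[OF u(1), of j] by (cases "d j < 0") (auto simp: mult_le_0_iff)
      qed (use k in auto)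
      then show ?thesis using qd[OF uP] u(2) by (simp add: sum_negf)
    qed
    ultimately show "card ?neg \<in> ?M" using SP by (intro CollectI exI[of _ "\<phi> ` ?S"]) auto
  next
    fix m assume "m \<in> ?M"
    then obtain R where R: "m = dim R" "subspace R" "R \<subseteq> \<phi> ` P" "\<forall>x\<in>R. x \<noteq> 0 \<longrightarrow> Re (q x x) < 0" by blast
    let ?S = "{u \<in> P. \<phi> u \<in> R}" and ?T = "span (e ` ?nn)"
    have S: "subspace ?S"
      using subspace_0[OF P] subspace_0[OF R(2)] subspace_add[OF P] subspace_add[OF R(2)]
        subspace_scale[OF P] subspace_scale[OF R(2)]
      by (intro subspaceI) (auto simp: phi0 add scl)
    have subnn: "?nn \<subseteq> {..<n}" by auto
    have TP: "?T \<subseteq> P" by (rule spanP[OF subnn])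
    have RS: "R = \<phi> ` ?S" using R(3) by blast
    have SP: "?S \<subseteq> P" by blast
    have "dim (\<phi> ` ?S) = dim ?S" by (rule dim_image_injective[OF add scl S SP inj])
    then have "dim R = dim ?S" using RS by simp
    moreover have "dim ?T = card ?nn" by (rule pos_form.orthobasis_independent(2)[OF e subnn])
    moreover have "?S \<inter> ?T = {0}"
    proof -
      have "u = 0" if u: "u \<in> ?S" "u \<in> ?T" for u
      proof (rule ccontr)
        assume "u \<noteq> 0"
        then have "\<phi> u \<noteq> 0" using inj u(1) by blast
        then have "Re (q (\<phi> u) (\<phi> u)) < 0" using R(4) u(1) by blast
        moreover have "0 \<le> (\<Sum>k<n. d k * (norm (herm_pos u (e k)))\<^sup>2)"
        proof (rule sum_nonneg)
          fix j assume "j \<in> {..<n}"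
          then show "0 \<le> d j * (norm (herm_pos u (e j)))\<^sup>2"
            using coeff0[OF u(2) subnn, of j] by (cases "0 \<le> d j") auto
        qed
        ultimately show False using qd u(1) by simp
      qed
      then show ?thesis using subspace_0[OF S] span_zero by blast
    qed
    moreover have "dim {x + y |x y. x \<in> ?S \<and> y \<in> ?T} \<le> dim P"
      using TP subspace_add[OF P] by (intro dim_subset) blast
    moreover have "card ?neg + card ?nn = n"
    proof -
      have "card (?neg \<union> ?nn) = card ?neg + card ?nn" by (rule card_Un_disjoint) auto
      moreover have "?neg \<union> ?nn = {..<n}" by auto
      ultimately show ?thesis by simp
    qed
    ultimately show "m \<le> card ?neg"
      using dim_sums_Int[OF S, of ?T] R(1) dim_P by simp
  qed
qed

text \<open>Both sides count signs of the eigenvalues of the same operator H + K: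
  \<open>tau_cayley_product\<close> counts the nonnegative ones, \<open>morse_neg_diagonal\<close>
  the negative ones.\<close>

lemma m_Q_eq:
  assumes A: "lagrangian A" and D: "lagrangian D" and B: "lagrangian B"
    and DA: "D \<inter> A = {0}" and DB: "D \<inter> B = {0}"
  shows "real (m_Q A D B) = n - (tau (W A D) + tau (W D B) - tau (W A B))"
proof -
  have "\<forall>y\<in>P. W A D y = y \<longrightarrow> y = 0" using transversal_iff[OF A D] DA by (simp add: Int_commute)
  then obtain H where H: "cayley H (W A D)" using cayley_inverse[OF unitary_W[OF A D]] by blast
  have "\<forall>y\<in>P. W D B y = y \<longrightarrow> y = 0" using transversal_iff[OF D B] DB by simp
  then obtain K where K: "cayley K (W D B)" using cayley_inverse[OF unitary_W[OF D B]] by blast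
  have hH: "hermitian H" and hK: "hermitian K" using H K by (simp_all add: cayley_def)
  have eH: "endo P H" and eK: "endo P K" using hH hK by (simp_all add: hermitian_def)
  let ?S = "\<lambda>u. H u + K u"
  have hS: "hermitian ?S"
    using hH hK unfolding hermitian_def endo_def
    by (auto simp: pos_form.g_simps subspace_add[OF P] scale_right_distrib add_ac)
  obtain e d where e: "pos_form.orthobasis P e n" and d: "\<forall>k<n. ?S (e k) = scale (of_real (d k)) (e k)"
    using hermitian_eigenbasis[OF hS] by (elim exE conjE)
  have tauS: "tau (W A D) + tau (W D B) - tau (W A B) = card {k \<in> {..<n}. 0 \<le> d k}"
  proof -
    have "tau (W A B) = tau (\<lambda>x. W A D (W D B x))" by (rule tau_cong) (simp add: W_comp[OF D B])
    then show ?thesis using tau_cayley_product[OF H K e] d by simp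
  qed
  let ?X = "shift H (-\<i>)" and ?Z = "shift H \<i>" and ?Y = "shift K (-\<i>)" and ?V = "shift K \<i>"
  have endos: "endo P ?X" "endo P ?Z" "endo P ?Y" "endo P ?V" using eH eK by (simp_all add: endo_shift)
  have mem: "?X u \<in> P" "?Z u \<in> P" "?Y u \<in> P" "?V u \<in> P" "?S u \<in> P" if "u \<in> P" for u
    using that endos hS by (simp_all add: endo_def hermitian_def)
  \<comment> \<open>\<open>\<phi>\<close> parametrizes \<open>A\<close> by \<open>P\<close> and turns \<open>Q\<close> into a positive multiple of \<open>u \<mapsto> \<langle>u, (H + K) u\<rangle>\<close>;
    \<open>\<phi> u = - y u + z u\<close> is the decomposition in the definition of \<open>Q\<close>.\<close>
  define \<phi> where "\<phi> u = V D (?X u) + ?Z u" for u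
  define y where "y u = - (V D (?S u) + ?S u)" for u
  define z where "z u = - (V D (?V u) + ?Y u)" for u
  have phi_A: "\<phi> u \<in> A" if "u \<in> P" for u
  proof -
    have "U A (V D (?X u)) = ?Z u" using H that by (simp add: cayley_def W_def)
    then show ?thesis using U(2)[OF A V(1)[OF D mem(1)[OF that]]] by (simp add: \<phi>_def)
  qed
  have y_D: "y u \<in> D" if "u \<in> P" for u
    unfolding y_def by (rule subspace_neg[OF lagrangian_subspace[OF D]]) (rule V(2)[OF D mem(5)[OF that]])
  have z_B: "z u \<in> B" if "u \<in> P" for u
  proof -
    have "W D B (?Y u) = ?V u" using K that by (simp add: cayley_def)
    then have "W B D (?V u) = ?Y u"
      using W_comp[OF D B mem(3)[OF that], of B] W_refl[OF B mem(3)[OF that]] by simp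
    then have "V D (?V u) + ?Y u \<in> B" using U(2)[OF B V(1)[OF D mem(4)[OF that]]] by (simp add: W_def)
    then show ?thesis unfolding z_def by (rule subspace_neg[OF lagrangian_subspace[OF B]])
  qed
  \<comment> \<open>The shifts by i and -i cancel, so H u + K u equals both
    \<open>?X u + ?V u\<close> and \<open>?Z u + ?Y u\<close>. The first identity matches the
    components in \<open>N\<close>, the second those in \<open>P\<close>.\<close>
  have phi_yz: "\<phi> u = - y u + z u" if u: "u \<in> P" for u
  proof -
    have 1: "?S u = ?X u + ?V u" "?S u = ?Z u + ?Y u" by (simp_all add: shift_def)
    have "V D (?S u) = V D (?X u) + V D (?V u)"
      using V_add[OF D mem(1)[OF u] mem(4)[OF u]] 1(1) by simp
    then show ?thesis unfolding \<phi>_def y_def z_def using 1(2) by simp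
  qed
  have phi_add: "\<phi> (u + v) = \<phi> u + \<phi> v" if "u \<in> P" "v \<in> P" for u v
    using endos(1,2) V_add[OF D mem(1)[OF that(1)] mem(1)[OF that(2)]] that by (simp add: \<phi>_def endo_def add_ac)
  have phi_scale: "\<phi> (scale c u) = scale c (\<phi> u)" if "u \<in> P" for c u
    using endos(1,2) V_scale[OF D mem(1)[OF that]] that by (simp add: \<phi>_def endo_def scale_right_distrib)
  have phi_inj: "u = 0" if u: "u \<in> P" "\<phi> u = 0" for u
  proof -
    have "?Z u = - V D (?X u)" using u(2) by (simp add: \<phi>_def eq_neg_iff_add_eq_0 add.commute)
    then have "?Z u \<in> N" using subspace_neg[OF N V(1)[OF D mem(1)[OF u(1)]]] by simp
    then have "?Z u = 0" using NP_trivial mem(2)[OF u(1)] by blast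
    then show ?thesis using resolvent(2)[OF hH _ u(1), of "\<i>"] by simp
  qed
  have phi_image: "\<phi> ` P = A"
  proof
    show "\<phi> ` P \<subseteq> A" using phi_A by blast
    show "A \<subseteq> \<phi> ` P"
    proof
      fix l assume "l \<in> A"
      then obtain x where x: "x \<in> N" "l = x + U A x" using lagrangian_eq_graph[OF A] by blast
      obtain u where u: "u \<in> P" "?X u = U D x"
        using resolvent(1)[OF hH _ U(1)[OF D x(1)], of "-\<i>"] by auto
      have "W A D (?X u) = ?Z u" using H u(1) by (simp add: cayley_def)
      then have "\<phi> u = l" using u(2) x D by (simp add: \<phi>_def W_def)
      then show "l \<in> \<phi> ` P" using u(1) by blast
    qed
  qed
  have dom: "Q_dom A D B = \<phi> ` P"
  proof -
    have "l \<in> {y + z | y z. y \<in> D \<and> z \<in> B}" if l: "l \<in> A" for l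
    proof -
      obtain u where u: "u \<in> P" "l = \<phi> u" using l phi_image by blast
      then have "l = - y u + z u" using phi_yz by simp
      moreover have "- y u \<in> D" using subspace_neg[OF lagrangian_subspace[OF D] y_D[OF u(1)]] .
      ultimately show ?thesis using z_B[OF u(1)] by blast
    qed
    then show ?thesis unfolding Q_dom_def phi_image by blast
  qed
  have ortho: "\<omega> (a + b) (- (c + d)) = - (\<omega> a c + \<omega> b d)" if "\<omega> a d = 0" "\<omega> b c = 0" for a b c d
    using that by (simp add: omega_simps)
  have form: "Q_form A D B (\<phi> u) (\<phi> u) = 2 * herm_pos u (?S u)" if u: "u \<in> P" for u
  proof -
    have "Q_form A D B (\<phi> u) (\<phi> u) = \<omega> (\<phi> u) (y u)"
      unfolding Q_form_def
    proof (rule the_equality)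
      show "\<exists>y\<^sub>2\<in>D. \<exists>z\<^sub>2\<in>B. \<phi> u = - y\<^sub>2 + z\<^sub>2 \<and> \<omega> (\<phi> u) (y u) = \<omega> (\<phi> u) y\<^sub>2"
        using y_D[OF u] z_B[OF u] phi_yz[OF u] by blast
      fix c assume "\<exists>y\<^sub>2\<in>D. \<exists>z\<^sub>2\<in>B. \<phi> u = - y\<^sub>2 + z\<^sub>2 \<and> c = \<omega> (\<phi> u) y\<^sub>2"
      then obtain y2 z2 where yz: "y2 \<in> D" "z2 \<in> B" "\<phi> u = - y2 + z2" "c = \<omega> (\<phi> u) y2" by blast
      have "- y2 + z2 = - y u + z u" using yz(3) phi_yz[OF u] by simp
      then have "y2 - y u = z2 - z u" by (simp add: algebra_simps)
      moreover have "y2 - y u \<in> D" "z2 - z u \<in> B"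
        using subspace_diff[OF lagrangian_subspace[OF D] yz(1) y_D[OF u]]
          subspace_diff[OF lagrangian_subspace[OF B] yz(2) z_B[OF u]] by simp_all
      ultimately have "y2 - y u \<in> D \<inter> B" by simp
      then have "y2 = y u" using DB by simp
      then show "c = \<omega> (\<phi> u) (y u)" using yz(4) by simp
    qed
    also have "\<dots> = - (\<omega> (V D (?X u)) (V D (?S u)) + \<omega> (?Z u) (?S u))"
      unfolding \<phi>_def y_def
      by (rule ortho[OF omega_NP[OF V(1)[OF D mem(1)[OF u]] mem(5)[OF u]] omega_PN[OF V(1)[OF D mem(5)[OF u]] mem(2)[OF u]]])
    \<comment> \<open>The anti-isometry \<open>V D\<close> moves the first term from
      \<open>N\<close> to \<open>P\<close> with a change of sign. Then only the difference of the
      two shifts is left, which is multiplication by 2 i.\<close>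
    also have "\<dots> = - \<omega> (?Z u - ?X u) (?S u)"
      using V_isometry[OF D mem(1)[OF u] mem(5)[OF u]] by (simp add: omega_diff)
    also have "?Z u - ?X u = scale (2 * \<i>) u"
      unfolding shift_def by (simp add: scale_left_distrib[symmetric])
    also have "- \<omega> (scale (2 * \<i>) u) (?S u) = 2 * herm_pos u (?S u)"
      by (simp add: omega_scale herm_pos_def)
    finally show ?thesis .
  qed
  have "m_Q A D B = card {k \<in> {..<n}. d k < 0}"
    unfolding m_Q_def dom
  proof (rule morse_neg_diagonal[OF phi_add phi_scale phi_inj _ e])
    show "endo P ?S" using hS by (simp add: hermitian_def)
    show "?S (e k) = scale (of_real (d k)) (e k)" if "k < n" for k using d that by blast
    show "Re (Q_form A D B (\<phi> u) (\<phi> u)) = 2 * Re (herm_pos u (?S u))" if "u \<in> P" for u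
      using form[OF that] by simp
  qed
  moreover have "card {k \<in> {..<n}. d k < 0} + card {k \<in> {..<n}. 0 \<le> d k} = n"
  proof -
    have "card ({k \<in> {..<n}. d k < 0} \<union> {k \<in> {..<n}. 0 \<le> d k}) = card {k \<in> {..<n}. d k < 0} + card {k \<in> {..<n}. 0 \<le> d k}"
      by (rule card_Un_disjoint) auto
    moreover have "{k \<in> {..<n}. d k < 0} \<union> {k \<in> {..<n}. 0 \<le> d k} = {..<n}" by auto
    ultimately show ?thesis by simp
  qed
  ultimately show ?thesis unfolding tauS by linarith
qed

text \<open>The two operators are inverse to each other, so the angles change sign, and
  \<open>gap t + gap (- t)\<close> is ceiling minus floor. This is 1 because transversality excludes
  the eigenvalue 1.\<close>

lemma tau_inverse:
  assumes D: "lagrangian D" and B: "lagrangian B" and DB: "D \<inter> B = {0}"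
  shows "tau (W D B) + tau (W B D) = n"
proof -
  obtain e t where e: "pos_form.orthobasis P e n" and t: "\<forall>k<n. W D B (e k) = scale (cis (t k)) (e k)"
    using unitary_eigenbasis[OF unitary_W[OF D B]] by (elim exE conjE)
  have a1: "angles (W D B) t" by (rule angles_eigenbasis[OF endo_W[OF D B] e]) (use t in simp)
  have a2: "angles (W B D) (\<lambda>k. - t k)"
  proof (rule angles_eigenbasis[OF endo_W[OF B D] e])
    fix k assume k: "k < n"
    have eP: "e k \<in> P" by (rule pos_form.orthobasis_mem[OF e k])
    have "e k = W B D (W D B (e k))" using W_comp[OF D B eP, of B] W_refl[OF B eP] by simp
    also have "\<dots> = scale (cis (t k)) (W B D (e k))"
      using t k endo_W[OF B D] eP by (simp add: endo_def)
    finally have "scale (cis (- t k)) (e k) = scale (cis (- t k)) (scale (cis (t k)) (W B D (e k)))" by simp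
    then show "W B D (e k) = scale (cis (- t k)) (e k)" by (simp add: cis_mult)
  qed
  have "gap (t k) + gap (- t k) = 1" if k: "k < n" for k
  proof -
    have "cis (t k) \<noteq> 1"
    proof
      assume "cis (t k) = 1"
      then have "W D B (e k) = e k" using t k by simp
      then have "e k = 0" using transversal_iff[OF D B] DB pos_form.orthobasis_mem[OF e k] by blast
      then show False using pos_form.orthobasis_orthonormal[OF e k k] by simp
    qed
    then have "t k / (2 * pi) \<notin> \<int>" unfolding cis_eq_1_iff by (auto elim: Ints_cases)
    then have "\<lceil>t k / (2 * pi)\<rceil> = \<lfloor>t k / (2 * pi)\<rfloor> + 1" by (simp add: ceiling_altdef) (metis Ints_of_int)
    then show ?thesis by (simp add: gap_def ceiling_minus)
  qed
  then have "(\<Sum>k<n. gap (t k) + gap (- t k)) = n" by simp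
  then show ?thesis unfolding tau_eq[OF a1] tau_eq[OF a2] by (simp add: sum.distrib)
qed

text \<open>The value computed from a transversal \<open>D\<close> does not mention
  \<open>D\<close>. This is the uniqueness that the definite description asks for; existence comes
  from \<open>transversal_exists\<close>.\<close>

lemma triple_index_eq:
  assumes A: "lagrangian A" and B: "lagrangian B" and C: "lagrangian C"
  shows "real_of_int (triple_index A B C) = tau (W A B) + tau (W B C) - tau (W A C)"
proof -
  have val: "real_of_int (int (m_Q A D B) + int (m_Q B D C) - int (m_Q A D C)) = tau (W A B) + tau (W B C) - tau (W A C)"
    if D: "lagrangian D" "D \<inter> A = {0}" "D \<inter> B = {0}" "D \<inter> C = {0}" for D
    using m_Q_eq[OF A D(1) B D(2,3)] m_Q_eq[OF B D(1) C D(3,4)] m_Q_eq[OF A D(1) C D(2,4)]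
      tau_inverse[OF D(1) B D(3)] by simp
  have "\<exists>D. lagrangian D \<and> (\<forall>L\<in>{A, B, C}. D \<inter> L = {0})"
    by (rule transversal_exists) (use A B C in auto)
  then obtain D where D: "lagrangian D" "D \<inter> A = {0}" "D \<inter> B = {0}" "D \<inter> C = {0}" by auto
  have "triple_index A B C = int (m_Q A D B) + int (m_Q B D C) - int (m_Q A D C)"
    unfolding triple_index_def
  proof (rule the_equality)
    show "\<exists>E. lagrangian E \<and> E \<inter> A = {0} \<and> E \<inter> B = {0} \<and> E \<inter> C = {0} \<and>
        int (m_Q A D B) + int (m_Q B D C) - int (m_Q A D C) = int (m_Q A E B) + int (m_Q B E C) - int (m_Q A E C)"
      using D by blast
    fix k assume "\<exists>E. lagrangian E \<and> E \<inter> A = {0} \<and> E \<inter> B = {0} \<and> E \<inter> C = {0} \<and>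
        k = int (m_Q A E B) + int (m_Q B E C) - int (m_Q A E C)"
    then obtain E where "lagrangian E" "E \<inter> A = {0}" "E \<inter> B = {0}" "E \<inter> C = {0}"
        and k: "k = int (m_Q A E B) + int (m_Q B E C) - int (m_Q A E C)" by blast
    then have "real_of_int k = real_of_int (int (m_Q A D B) + int (m_Q B D C) - int (m_Q A D C))"
      unfolding k using val[OF D] val[of E] by linarith
    then show "k = int (m_Q A D B) + int (m_Q B D C) - int (m_Q A D C)" by linarith
  qed
  then show ?thesis using val[OF D] by simp
qed

end

section \<open>Paths of Lagrangian subspaces\<close>

context hermitian_form begin

text \<open>The type of vectors carries no topology, so continuity of a moving vector means
  continuity of its products with fixed vectors. A product of two moving vectors is reduced to these
  by a fixed orthonormal basis.\<close>

lemma weakly_continuous_inner: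
  assumes "positive_on UNIV"
    and f: "\<And>y. continuous_on S (\<lambda>s. g (f s) y)" and f': "\<And>y. continuous_on S (\<lambda>s. g (f' s) y)"
  shows "continuous_on S (\<lambda>s. g (f s) (f' s))"
proof -
  obtain e where e: "orthobasis UNIV e (dim UNIV)" using orthobasis_exists[OF assms(1)] by (rule exE)
  have "g (f s) (f' s) = (\<Sum>k<dim UNIV. g (f s) (e k) * cnj (g (f' s) (e k)))" for s
    using orthobasis_inner[OF e UNIV_I, of "f s" "f' s"] by (simp flip: herm)
  moreover have "continuous_on S (\<lambda>s. \<Sum>k<dim UNIV. g (f s) (e k) * cnj (g (f' s) (e k)))"
    by (intro continuous_intros f f')
  ultimately show ?thesis by simp
qed

lemma orthogonal_span:
  assumes "x \<in> span A" "\<And>a. a \<in> A \<Longrightarrow> g y a = 0"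
  shows "g y x = 0"
proof -
  have "subspace {x. g y x = 0}" by (rule subspaceI) (simp_all add: g_simps)
  moreover have "A \<subseteq> {x. g y x = 0}" using assms(2) by auto
  ultimately have "span A \<subseteq> {x. g y x = 0}" by (intro span_minimal)
  then show ?thesis using assms(1) by auto
qed

text \<open>Gram-Schmidt with a parameter. The part \<open>r s\<close> of the next vector that is
  orthogonal to its predecessors does not vanish, by independence, so projecting to it adds a
  continuous rank one term.\<close>

lemma continuous_projection:
  fixes l :: "nat \<Rightarrow> real \<Rightarrow> 'v"
  assumes pos: "positive_on UNIV"
  shows "(\<forall>k<m. \<forall>y. continuous_on S (\<lambda>s. g (l k s) y)) \<Longrightarrow>
    (\<forall>s\<in>S. \<forall>k<m. l k s \<notin> span ((\<lambda>i. l i s) ` {..<k})) \<Longrightarrow>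
    \<exists>\<pi>. (\<forall>x y. continuous_on S (\<lambda>s. g (\<pi> s x) y)) \<and>
      (\<forall>s\<in>S. \<forall>x. \<pi> s x \<in> span ((\<lambda>i. l i s) ` {..<m}) \<and> (\<forall>k<m. g (x - \<pi> s x) (l k s) = 0))"
proof (induction m)
  case 0
  show ?case by (rule exI[of _ "\<lambda>_ _. 0"]) simp
next
  case (Suc m)
  let ?A = "\<lambda>s. (\<lambda>i. l i s) ` {..<m}"
  have "\<forall>k<m. \<forall>y. continuous_on S (\<lambda>s. g (l k s) y)" "\<forall>s\<in>S. \<forall>k<m. l k s \<notin> span ((\<lambda>i. l i s) ` {..<k})"
    using Suc.prems by simp_all
  from Suc.IH[OF this] obtain \<pi> where \<pi>: "\<forall>x y. continuous_on S (\<lambda>s. g (\<pi> s x) y)"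
    "\<forall>s\<in>S. \<forall>x. \<pi> s x \<in> span (?A s) \<and> (\<forall>k<m. g (x - \<pi> s x) (l k s) = 0)"
    by (elim exE conjE)
  have mem: "\<pi> s x \<in> span (?A s)" if "s \<in> S" for s x using \<pi>(2) that by simp
  have orth: "g (x - \<pi> s x) z = 0" if "s \<in> S" "z \<in> span (?A s)" for s x z
    using that \<pi>(2) by (intro orthogonal_span[OF that(2)]) auto
  \<comment> \<open>Self-adjointness moves the projection from the moving vector
    \<open>l m s\<close> to the fixed vector y, where its continuity is already known.\<close>
  have adj: "g (\<pi> s x) y = g x (\<pi> s y)" if "s \<in> S" for s x y
  proof -
    have "g (\<pi> s x) (y - \<pi> s y) = 0"
      using orth[OF that mem[OF that], of y x] herm[of "\<pi> s x" "y - \<pi> s y"] by simp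
    moreover have "g (x - \<pi> s x) (\<pi> s y) = 0" by (rule orth[OF that mem[OF that]])
    ultimately show ?thesis by (simp add: g_diff)
  qed
  define r where "r s = l m s - \<pi> s (l m s)" for s
  have lm: "continuous_on S (\<lambda>s. g (l m s) y)" for y using Suc.prems(1) by simp
  have r: "continuous_on S (\<lambda>s. g (r s) y)" for y
  proof -
    have "continuous_on S (\<lambda>s. g (l m s) (\<pi> s y))"
      using \<pi>(1) by (intro weakly_continuous_inner[OF pos lm]) simp
    then have "continuous_on S (\<lambda>s. g (l m s) y - g (l m s) (\<pi> s y))"
      using lm[of y] by (intro continuous_intros)
    then show ?thesis unfolding r_def
      by (subst continuous_on_cong[OF refl, of _ _ "\<lambda>s. g (l m s) y - g (l m s) (\<pi> s y)"]) (auto simp: g_diff adj)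
  qed
  have r0: "g (r s) (r s) \<noteq> 0" if s: "s \<in> S" for s
  proof -
    have "r s \<noteq> 0" using mem[OF s, of "l m s"] Suc.prems(2) s by (auto simp: r_def)
    then show ?thesis using pos unfolding positive_on_def by fastforce
  qed
  define \<rho> where "\<rho> s x = \<pi> s x + scale (g x (r s) / g (r s) (r s)) (r s)" for s x
  have "continuous_on S (\<lambda>s. g (\<rho> s x) y)" for x y
  proof -
    have "continuous_on S (\<lambda>s. cnj (g (r s) x))" using r[of x] by (intro continuous_intros)
    then have "continuous_on S (\<lambda>s. g x (r s))" by (simp flip: herm)
    moreover have "continuous_on S (\<lambda>s. g (r s) (r s))" by (rule weakly_continuous_inner[OF pos r r])
    ultimately show ?thesis unfolding \<rho>_def g_simps using \<pi>(1) r[of y] r0 by (intro continuous_intros) auto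
  qed
  moreover have "\<rho> s x \<in> span ((\<lambda>i. l i s) ` {..<Suc m}) \<and> (\<forall>k<Suc m. g (x - \<rho> s x) (l k s) = 0)" if s: "s \<in> S" for s x
  proof
    let ?B = "(\<lambda>i. l i s) ` {..<Suc m}"
    have sub: "span (?A s) \<subseteq> span ?B" by (rule span_mono) auto
    have "l m s \<in> span ?B" by (rule span_base) simp
    then have "r s \<in> span ?B" unfolding r_def using mem[OF s, of "l m s"] sub by (intro span_diff) auto
    then show "\<rho> s x \<in> span ?B" unfolding \<rho>_def using mem[OF s, of x] sub by (intro span_add span_scale) auto
    have o1: "g (x - \<rho> s x) z = 0" if z: "z \<in> span (?A s)" for z
      using orth[OF s z, of x] orth[OF s z, of "l m s"] by (simp add: \<rho>_def r_def g_simps)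
    have "g (\<pi> s x) (r s) = 0" using orth[OF s mem[OF s], of "l m s" x] herm[of "\<pi> s x" "r s"] by (simp add: r_def)
    then have "g (x - \<rho> s x) (r s) = 0" using r0[OF s] by (simp add: \<rho>_def g_simps)
    then have o2: "g (x - \<rho> s x) (l m s) = 0"
      using o1[OF mem[OF s, of "l m s"]] by (simp add: r_def g_diff(2)[of _ "l m s"])
    show "\<forall>k<Suc m. g (x - \<rho> s x) (l k s) = 0"
      using o1 o2 by (auto simp: less_Suc_eq intro: span_base)
  qed
  ultimately show ?case by (intro exI[of _ \<rho>]) simp
qed

end

context complex_symplectic_space begin

lemma inner_product_pos: "inner_product h \<Longrightarrow> x \<noteq> 0 \<Longrightarrow> 0 < Re (h x x)"
  unfolding inner_product_def by blast

lemma orth_proj_eq: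
  assumes h: "inner_product h" and L: "subspace L" and q: "q \<in> L" "\<And>z. z \<in> L \<Longrightarrow> h (x - q) z = 0"
  shows "orth_proj h L x = q"
  unfolding orth_proj_def
proof (rule the_equality)
  show "q \<in> L \<and> (\<forall>z\<in>L. h (x - q) z = 0)" using q by simp
  fix q' assume q': "q' \<in> L \<and> (\<forall>z\<in>L. h (x - q') z = 0)"
  have hadd: "h (u + v) z = h u z + h v z" for u v z
    using h unfolding inner_product_def sesquilinear_def by blast
  have d: "q' - q \<in> L" using q' q L subspace_diff by blast
  have "h (x - q) (q' - q) = h (x - q') (q' - q) + h (q' - q) (q' - q)"
    using hadd[of "x - q'" "q' - q" "q' - q"] by simp
  then have "h (q' - q) (q' - q) = 0" using q' d q(2)[OF d] by simp
  then have "\<not> 0 < Re (h (q' - q) (q' - q))" by simp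
  then have "q' - q = 0" using inner_product_pos[OF h] by blast
  then show "q' = q" by simp
qed

lemma lagrangian_path_const: "lagrangian L \<Longrightarrow> lagrangian_path a b (\<lambda>_. L)"
  by (simp add: lagrangian_path_def)

end

context symplectic_fdvs begin

lemma inner_product_hermitian:
  assumes "inner_product h"
  shows "hermitian_form scale Basis h"
proof
  show "sesquilinear scale h" using assms unfolding inner_product_def by (rule conjunct1)
  show "h y x = cnj (h x y)" for x y using assms unfolding inner_product_def by blast
qed

text \<open>A path must have continuous projections for every inner product, and these differ from
  one inner product to another. A continuous frame yields all of them by Gram-Schmidt.\<close>

lemma lagrangian_path_of_frame:
  fixes l :: "nat \<Rightarrow> real \<Rightarrow> 'v"
  assumes lag: "\<And>s. lagrangian (\<Lambda> s)" and span_l: "\<And>s. \<Lambda> s = span ((\<lambda>k. l k s) ` {..<n})"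
    and indep: "\<And>k s. k < n \<Longrightarrow> l k s \<notin> span ((\<lambda>i. l i s) ` {..<k})"
    and cont: "\<And>h k y. inner_product h \<Longrightarrow> k < n \<Longrightarrow> continuous_on {a..b} (\<lambda>s. h (l k s) y)"
  shows "lagrangian_path a b \<Lambda>"
proof -
  have "continuous_on {a..b} (\<lambda>s. h (orth_proj h (\<Lambda> s) x) y)" if h: "inner_product h" for h x y
  proof -
    interpret h: hermitian_form scale Basis h using h by (rule inner_product_hermitian)
    have posh: "h.positive_on UNIV" by (simp add: h.positive_on_def inner_product_pos[OF h])
    have "\<forall>k<n. \<forall>y. continuous_on {a..b} (\<lambda>s. h (l k s) y)" by (intro allI impI cont h)
    moreover have "\<forall>s\<in>{a..b}. \<forall>k<n. l k s \<notin> span ((\<lambda>i. l i s) ` {..<k})"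
      by (intro ballI allI impI indep)
    ultimately have "\<exists>\<pi>. (\<forall>x y. continuous_on {a..b} (\<lambda>s. h (\<pi> s x) y)) \<and>
      (\<forall>s\<in>{a..b}. \<forall>x. \<pi> s x \<in> span ((\<lambda>i. l i s) ` {..<n}) \<and> (\<forall>k<n. h (x - \<pi> s x) (l k s) = 0))"
      by (rule h.continuous_projection[OF posh])
    then obtain \<pi> where \<pi>: "\<forall>x y. continuous_on {a..b} (\<lambda>s. h (\<pi> s x) y)"
      "\<forall>s\<in>{a..b}. \<forall>x. \<pi> s x \<in> span ((\<lambda>i. l i s) ` {..<n}) \<and> (\<forall>k<n. h (x - \<pi> s x) (l k s) = 0)"
      by (elim exE conjE)
    have eq: "orth_proj h (\<Lambda> s) x = \<pi> s x" if s: "s \<in> {a..b}" for s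
    proof (rule orth_proj_eq[OF h lagrangian_subspace[OF lag]])
      show "\<pi> s x \<in> \<Lambda> s" using \<pi>(2) s by (simp add: span_l)
      show "h (x - \<pi> s x) z = 0" if "z \<in> \<Lambda> s" for z
        using that unfolding span_l by (rule h.orthogonal_span) (use \<pi>(2) s in auto)
    qed
    show ?thesis using \<pi>(1)
      by (subst continuous_on_cong[OF refl, of _ _ "\<lambda>s. h (\<pi> s x) y"]) (auto simp: eq)
  qed
  then show ?thesis unfolding lagrangian_path_def using lag by simp
qed

end

section \<open>Continuity of graph maps and of eigenangles\<close>

context polarization begin

lemma lagrangian_path_at: "lagrangian_path a b \<Lambda> \<Longrightarrow> s \<in> {a..b} \<Longrightarrow> lagrangian (\<Lambda> s)"
  by (simp add: lagrangian_path_def)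

definition proj_P :: "'v \<Rightarrow> 'v" where
  "proj_P x = opr p p x"

lemma proj_P_eq: "u \<in> N \<Longrightarrow> v \<in> P \<Longrightarrow> proj_P (u + v) = v"
proof -
  assume u: "u \<in> N" and v: "v \<in> P"
  have "proj_P (u + v) = (\<Sum>k<n. scale (herm_pos v (p k)) (p k))"
    using omega_NP[OF u p_mem] by (simp add: proj_P_def opr_def herm_pos_def omega_add)
  then show ?thesis using pos_form.orthobasis_expand[OF ob v] by simp
qed

lemma proj_P_add: "proj_P (x + y) = proj_P x + proj_P y"
  and proj_P_scale: "proj_P (scale c x) = scale c (proj_P x)"
  by (simp_all add: proj_P_def opr_def pos_form.g_simps scale_left_distrib sum.distrib scale_sum_right)

text \<open>The inner product adapted to the polarization: the halves are orthogonal and each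
  carries its own definite form. For it the projection to a Lagrangian subspace is explicit in terms
  of the graph map, so continuity of projections passes to \<open>U\<close>.\<close>

definition h0 :: "'v \<Rightarrow> 'v \<Rightarrow> complex" where
  "h0 x y = herm_pos (proj_P x) (proj_P y) + herm_neg (x - proj_P x) (y - proj_P y)"

lemma h0_eq:
  assumes "u \<in> N" "v \<in> P" "u' \<in> N" "v' \<in> P"
  shows "h0 (u + v) (u' + v') = herm_pos v v' + herm_neg u u'"
  using assms by (simp add: h0_def proj_P_eq)

lemma inner_product_h0: "inner_product h0"
  unfolding inner_product_def
proof (intro conjI allI impI)
  show "sesquilinear scale h0"
    unfolding sesquilinear_def h0_def proj_P_add proj_P_scale pos_form.g_simps neg_form.g_simps
    by (simp add: algebra_simps)
  show "h0 y x = cnj (h0 x y)" for x y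
    unfolding h0_def by (simp flip: pos_form.herm neg_form.herm)
  show "0 < Re (h0 x x)" if "x \<noteq> 0" for x
  proof -
    obtain u v where uv: "u \<in> N" "v \<in> P" "x = u + v" using decomposition[of x] by blast
    have 1: "Re (h0 x x) = Im (\<omega> v v) - Im (\<omega> u u)"
      using uv by (simp add: h0_eq herm_pos_def herm_neg_def)
    have "u \<noteq> 0 \<or> v \<noteq> 0" using uv that by auto
    then show ?thesis using omega_P[OF uv(2)] omega_N[OF uv(1)] unfolding 1
      by (cases "u = 0"; cases "v = 0") auto
  qed
qed

text \<open>Write z as half the sum of z + U z and z - U z. The first lies in \<open>L\<close>, and
  the second is orthogonal to the graph because \<open>U L\<close> is an isometry from
  \<open>herm_neg\<close> on \<open>N\<close> to \<open>herm_pos\<close> on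
  \<open>P\<close>.\<close>

lemma orth_proj_h0:
  assumes L: "lagrangian L" and z: "z \<in> N"
  shows "orth_proj h0 L z = scale (1 / 2) (z + U L z)"
proof (rule orth_proj_eq[OF inner_product_h0 lagrangian_subspace[OF L]])
  let ?q = "scale (1 / 2) (z + U L z)"
  note Uz = U[OF L z]
  show "?q \<in> L" by (rule subspace_scale[OF lagrangian_subspace[OF L] Uz(2)])
  fix l assume "l \<in> L"
  then obtain w where w: "w \<in> N" "l = w + U L w" using lagrangian_eq_graph[OF L] by blast
  have "z = scale (1 / 2) z + scale (1 / 2) z" by (simp flip: scale_left_distrib)
  then have "z - ?q = scale (1 / 2) z + scale (- 1 / 2) (U L z)"
    by (simp add: scale_right_distrib algebra_simps)
  moreover have "scale (1 / 2) z \<in> N" "scale (- 1 / 2) (U L z) \<in> P"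
    by (rule subspace_scale[OF N z], rule subspace_scale[OF P Uz(1)])
  ultimately have "h0 (z - ?q) l = herm_pos (scale (- 1 / 2) (U L z)) (U L w) + herm_neg (scale (1 / 2) z) w"
    using w U(1)[OF L w(1)] by (simp only: h0_eq)
  then show "h0 (z - ?q) l = 0"
    using U_isometry[OF L z w(1)] by (simp add: herm_pos_def herm_neg_def omega_scale omega_minus)
qed

lemma U_continuous:
  assumes \<Lambda>: "lagrangian_path a b \<Lambda>" and z: "z \<in> N" and y: "y \<in> P"
  shows "continuous_on {a..b} (\<lambda>s. herm_pos (U (\<Lambda> s) z) y)"
proof -
  have "continuous_on {a..b} (\<lambda>s. 2 * h0 (orth_proj h0 (\<Lambda> s) z) y)"
    using \<Lambda> inner_product_h0 unfolding lagrangian_path_def by (intro continuous_intros) blast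
  moreover have "herm_pos (U (\<Lambda> s) z) y = 2 * h0 (orth_proj h0 (\<Lambda> s) z) y" if "s \<in> {a..b}" for s
  proof -
    have L: "lagrangian (\<Lambda> s)" using lagrangian_path_at[OF \<Lambda> that] .
    have "h0 (scale (1 / 2) z + scale (1 / 2) (U (\<Lambda> s) z)) (0 + y) = herm_pos (scale (1 / 2) (U (\<Lambda> s) z)) y + herm_neg (scale (1 / 2) z) 0"
      by (rule h0_eq) (use z y subspace_scale[OF N z] subspace_scale[OF P U(1)[OF L z]] subspace_0[OF N] in auto)
    then show ?thesis unfolding orth_proj_h0[OF L z] scale_right_distrib by (simp add: pos_form.g_scale mult.commute)
  qed
  ultimately show ?thesis by (subst continuous_on_cong[OF refl, of _ _ "\<lambda>s. 2 * h0 (orth_proj h0 (\<Lambda> s) z) y"]) auto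
qed

lemma W_continuous_left:
  assumes "lagrangian_path a b \<Lambda>" "lagrangian D"
  shows "entries_continuous {a..b} (\<lambda>s. W (\<Lambda> s) D)"
  unfolding entries_continuous_def W_def
  using U_continuous[OF assms(1) V(1)[OF assms(2) p_mem] p_mem] by blast

lemma W_adjoint:
  assumes L: "lagrangian L" and M: "lagrangian M" and "x \<in> P" "y \<in> P"
  shows "herm_pos (W L M x) y = cnj (herm_pos (W M L y) x)"
proof -
  have "herm_pos (W M L (W L M x)) (W M L y) = herm_pos (W L M x) y"
    using unitary_W[OF M L] W_mem[OF L M assms(3)] assms(4) by (simp add: unitary_def)
  then show ?thesis using W_comp[OF L M assms(3), of M] W_refl[OF M assms(3)] by (simp flip: pos_form.herm)
qed

text \<open>Continuity of \<open>U\<close> controls the left argument of \<open>W\<close> only. The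
  right argument is reached through the adjoint, since \<open>W D M\<close> and \<open>W M D\<close>
  are inverse unitary operators.\<close>

lemma W_continuous_right:
  assumes M: "lagrangian_path a b M" and D: "lagrangian D"
  shows "entries_continuous {a..b} (\<lambda>s. W D (M s))"
  unfolding entries_continuous_def
proof (intro allI impI)
  fix i j assume ij: "i < n" "j < n"
  have "continuous_on {a..b} (\<lambda>s. cnj (herm_pos (W (M s) D (p i)) (p j)))"
    using W_continuous_left[OF M D] ij unfolding entries_continuous_def by (intro continuous_intros) auto
  moreover have "herm_pos (W D (M s) (p j)) (p i) = cnj (herm_pos (W (M s) D (p i)) (p j))" if "s \<in> {a..b}" for s
    by (rule W_adjoint[OF D lagrangian_path_at[OF M that] p_mem[OF ij(2)] p_mem[OF ij(1)]])
  ultimately show "continuous_on {a..b} (\<lambda>s. herm_pos (W D (M s) (p j)) (p i))"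
    by (subst continuous_on_cong[OF refl, of _ _ "\<lambda>s. cnj (herm_pos (W (M s) D (p i)) (p j))"]) auto
qed

definition angle_path :: "real \<Rightarrow> real \<Rightarrow> (real \<Rightarrow> 'v set) \<Rightarrow> (real \<Rightarrow> 'v set) \<Rightarrow> (nat \<Rightarrow> real \<Rightarrow> real) \<Rightarrow> bool" where
  "angle_path a b \<Lambda> M \<theta> \<longleftrightarrow> (\<forall>j<n. continuous_on {a..b} (\<theta> j)) \<and>
     (\<forall>s\<in>{a..b}. angles (W (\<Lambda> s) (M s)) (\<lambda>j. \<theta> j s))"

lemma angle_path_exists:
  assumes ab: "a \<le> b" and \<Lambda>: "lagrangian_path a b \<Lambda>" and M: "lagrangian_path a b M"
  shows "\<exists>\<theta>. angle_path a b \<Lambda> M \<theta>"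
  unfolding angle_path_def
proof (rule entries_continuous_angles[OF ab])
  show "unitary (W (\<Lambda> s) (M s))" if "s \<in> {a..b}" for s
    using unitary_W lagrangian_path_at[OF \<Lambda> that] lagrangian_path_at[OF M that] by blast
  \<comment> \<open>A fixed intermediate subspace separates the two moving arguments of
    \<open>W\<close>; \<open>\<Lambda> a\<close> serves as one.\<close>
  define D where "D = \<Lambda> a"
  have D: "lagrangian D" unfolding D_def by (rule lagrangian_path_at[OF \<Lambda>]) (use ab in simp)
  have "entries_continuous {a..b} (\<lambda>s x. W (\<Lambda> s) D (W D (M s) x))"
    by (rule entries_continuous_comp[OF W_continuous_left[OF \<Lambda> D] W_continuous_right[OF M D]])
      (use endo_W D lagrangian_path_at[OF \<Lambda>] lagrangian_path_at[OF M] in auto)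
  moreover have "W (\<Lambda> s) D (W D (M s) (p j)) = W (\<Lambda> s) (M s) (p j)" if "s \<in> {a..b}" "j < n" for s j
    by (rule W_comp[OF D lagrangian_path_at[OF M that(1)] p_mem[OF that(2)]])
  ultimately show "entries_continuous {a..b} (\<lambda>s. W (\<Lambda> s) (M s))"
    unfolding entries_continuous_def by (simp cong: continuous_on_cong_simp)
qed

lemma Det_W_comp:
  assumes "lagrangian L" "lagrangian M" "lagrangian K"
  shows "Det (W L K) = Det (W L M) * Det (W M K)"
proof -
  have "Det (W L K) = Det (\<lambda>x. W L M (W M K x))"
    by (rule Det_cong) (simp add: W_comp[OF assms(2,3)] p_mem)
  also have "\<dots> = Det (W L M) * Det (W M K)"
    by (rule Det_comp[OF endo_W[OF assms(1,2)]]) (simp add: W_mem assms p_mem)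
  finally show ?thesis .
qed

lemma no_fixed_iff:
  assumes "angles F t"
  shows "(\<forall>y\<in>P. F y = y \<longrightarrow> y = 0) \<longleftrightarrow> (\<forall>j<n. cis (t j) \<noteq> 1)"
proof -
  have "card {j \<in> {..<n}. cis (t j) = 1} = dim {y \<in> P. F y = scale 1 y}"
    using assms unfolding angles_def by (rule spec)
  then have c: "card {j \<in> {..<n}. cis (t j) = 1} = dim {y \<in> P. F y = y}" by (simp only: scale_one)
  have "{j \<in> {..<n}. cis (t j) = 1} = {} \<longleftrightarrow> {y \<in> P. F y = y} \<subseteq> {0}"
    unfolding dim_eq_0[symmetric] c[symmetric] by (simp only: card_eq_0_iff) simp
  then show ?thesis by auto
qed

lemma transversal_angles:
  assumes "lagrangian L" "lagrangian M" "angles (W L M) t"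
  shows "L \<inter> M = {0} \<longleftrightarrow> (\<forall>j<n. cis (t j) \<noteq> 1)"
  unfolding transversal_iff[OF assms(1,2)] by (rule no_fixed_iff[OF assms(3)])

text \<open>By \<open>m_Q_eq\<close> the difference on either side equals the ceiling sums of the
  pairs with \<open>D\<close>, up to a constant; the total angles drop out by multiplicativity of
  \<open>Det\<close>. At \<open>s0\<close> these two pairs are transversal, so their angles avoid 2
  pi Z and their ceilings are locally constant, even where those of \<open>\<theta>\<close>
  jump.\<close>

lemma ceiling_sum_locally:
  assumes ab: "a \<le> b" and \<Lambda>: "lagrangian_path a b \<Lambda>" and M: "lagrangian_path a b M"
    and \<theta>: "angle_path a b \<Lambda> M \<theta>" and s0: "s0 \<in> {a..b}"
    and D: "lagrangian D" "D \<inter> \<Lambda> s0 = {0}" "D \<inter> M s0 = {0}"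
  shows "\<forall>\<^sub>F s in at s0 within {a..b}.
    (\<Sum>j<n. \<lceil>\<theta> j s / (2 * pi)\<rceil>) - int (m_Q (\<Lambda> s) D (M s)) =
    (\<Sum>j<n. \<lceil>\<theta> j s0 / (2 * pi)\<rceil>) - int (m_Q (\<Lambda> s0) D (M s0))"
proof -
  have cD: "lagrangian_path a b (\<lambda>_. D)" by (rule lagrangian_path_const[OF D(1)])
  obtain \<psi> where \<psi>: "angle_path a b \<Lambda> (\<lambda>_. D) \<psi>" using angle_path_exists[OF ab \<Lambda> cD] by (rule exE)
  obtain \<kappa> where \<kappa>: "angle_path a b (\<lambda>_. D) M \<kappa>" using angle_path_exists[OF ab cD M] by (rule exE)
  have lag: "lagrangian (\<Lambda> s)" "lagrangian (M s)" if "s \<in> {a..b}" for s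
    using lagrangian_path_at[OF \<Lambda> that] lagrangian_path_at[OF M that] by simp_all
  have ang: "angles (W (\<Lambda> s) (M s)) (\<lambda>j. \<theta> j s)" "angles (W (\<Lambda> s) D) (\<lambda>j. \<psi> j s)"
      "angles (W D (M s)) (\<lambda>j. \<kappa> j s)" if "s \<in> {a..b}" for s
    using \<theta> \<psi> \<kappa> that by (simp_all add: angle_path_def)
  have cont: "continuous_on {a..b} (\<theta> j)" "continuous_on {a..b} (\<psi> j)" "continuous_on {a..b} (\<kappa> j)" if "j < n" for j
    using \<theta> \<psi> \<kappa> that by (simp_all add: angle_path_def)
  define F where "F s = (\<Sum>j<n. \<psi> j s) + (\<Sum>j<n. \<kappa> j s) - (\<Sum>j<n. \<theta> j s)" for s
  have F: "F s = F a" if "s \<in> {a..b}" for s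
  proof (rule cis_constant_imp_constant[where f = F and c = 1 and b = b, OF _ _ that])
    show "continuous_on {a..b} F" unfolding F_def by (intro continuous_intros) (use cont in auto)
    show "cis (F s) = 1" if s: "s \<in> {a..b}" for s
    proof -
      have "Det (W (\<Lambda> s) (M s)) = Det (W (\<Lambda> s) D) * Det (W D (M s))"
        by (rule Det_W_comp[OF lag(1)[OF s] D(1) lag(2)[OF s]])
      then have "cis (\<Sum>j<n. \<theta> j s) = cis (\<Sum>j<n. \<psi> j s) * cis (\<Sum>j<n. \<kappa> j s)"
        using angles_Det[OF unitary_W[OF lag[OF s]] ang(1)[OF s]]
          angles_Det[OF unitary_W[OF lag(1)[OF s] D(1)] ang(2)[OF s]]
          angles_Det[OF unitary_W[OF D(1) lag(2)[OF s]] ang(3)[OF s]] by simp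
      then show ?thesis unfolding F_def by (simp add: cis_divide[symmetric] cis_mult[symmetric])
    qed
  qed
  have key: "real_of_int ((\<Sum>j<n. \<lceil>\<theta> j s / (2 * pi)\<rceil>) - int (m_Q (\<Lambda> s) D (M s))) =
      real_of_int ((\<Sum>j<n. \<lceil>\<psi> j s / (2 * pi)\<rceil>) + (\<Sum>j<n. \<lceil>\<kappa> j s / (2 * pi)\<rceil>)) - n - F a / (2 * pi)"
    if s: "s \<in> {a..b}" and tr: "\<forall>j<n. cis (\<psi> j s) \<noteq> 1" "\<forall>j<n. cis (\<kappa> j s) \<noteq> 1" for s
  proof -
    have "D \<inter> \<Lambda> s = {0}" "D \<inter> M s = {0}"
      using transversal_angles[OF lag(1)[OF s] D(1) ang(2)[OF s]] transversal_angles[OF D(1) lag(2)[OF s] ang(3)[OF s]] tr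
      by (simp_all add: Int_commute)
    then have "real (m_Q (\<Lambda> s) D (M s)) = n - (tau (W (\<Lambda> s) D) + tau (W D (M s)) - tau (W (\<Lambda> s) (M s)))"
      by (rule m_Q_eq[OF lag(1)[OF s] D(1) lag(2)[OF s]])
    moreover have "F a / (2 * pi) = (\<Sum>j<n. \<psi> j s) / (2 * pi) + (\<Sum>j<n. \<kappa> j s) / (2 * pi) - (\<Sum>j<n. \<theta> j s) / (2 * pi)"
    proof -
      have "F a / (2 * pi) = F s / (2 * pi)" using F[OF s] by simp
      also have "F s / (2 * pi) = (\<Sum>j<n. \<psi> j s) / (2 * pi) + (\<Sum>j<n. \<kappa> j s) / (2 * pi) - (\<Sum>j<n. \<theta> j s) / (2 * pi)"
        by (simp add: F_def add_divide_distrib diff_divide_distrib)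
      finally show ?thesis .
    qed
    ultimately show ?thesis
      using sum_ceiling_angles[OF ang(1)[OF s]] sum_ceiling_angles[OF ang(2)[OF s]] sum_ceiling_angles[OF ang(3)[OF s]]
      by simp
  qed
  have tr0: "\<forall>j<n. cis (\<psi> j s0) \<noteq> 1" "\<forall>j<n. cis (\<kappa> j s0) \<noteq> 1"
    using transversal_angles[OF lag(1)[OF s0] D(1) ang(2)[OF s0]] transversal_angles[OF D(1) lag(2)[OF s0] ang(3)[OF s0]] D
    by (simp_all add: Int_commute)
  have ev: "\<forall>\<^sub>F s in at s0 within {a..b}. \<forall>j\<in>{..<n}. \<lceil>f j s / (2 * pi)\<rceil> = \<lceil>f j s0 / (2 * pi)\<rceil> \<and> cis (f j s) \<noteq> 1"
    if "\<And>j. j < n \<Longrightarrow> continuous_on {a..b} (f j)" "\<forall>j<n. cis (f j s0) \<noteq> 1" for f :: "nat \<Rightarrow> real \<Rightarrow> real"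
    by (intro eventually_ball_finite ballI eventually_ceiling_eq) (use that s0 in \<open>auto simp: continuous_on_def\<close>)
  have "\<forall>\<^sub>F s in at s0 within {a..b}. s \<in> {a..b}" by (simp add: eventually_at_filter)
  moreover have "\<forall>\<^sub>F s in at s0 within {a..b}. \<forall>j\<in>{..<n}. \<lceil>\<psi> j s / (2 * pi)\<rceil> = \<lceil>\<psi> j s0 / (2 * pi)\<rceil> \<and> cis (\<psi> j s) \<noteq> 1"
    by (rule ev[of \<psi>, OF _ tr0(1)]) (rule cont(2))
  moreover have "\<forall>\<^sub>F s in at s0 within {a..b}. \<forall>j\<in>{..<n}. \<lceil>\<kappa> j s / (2 * pi)\<rceil> = \<lceil>\<kappa> j s0 / (2 * pi)\<rceil> \<and> cis (\<kappa> j s) \<noteq> 1"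
    by (rule ev[of \<kappa>, OF _ tr0(2)]) (rule cont(3))
  ultimately show ?thesis
  proof eventually_elim
    case (elim s)
    have "real_of_int ((\<Sum>j<n. \<lceil>\<theta> j s / (2 * pi)\<rceil>) - int (m_Q (\<Lambda> s) D (M s))) =
      real_of_int ((\<Sum>j<n. \<lceil>\<theta> j s0 / (2 * pi)\<rceil>) - int (m_Q (\<Lambda> s0) D (M s0)))"
      using key[OF elim(1)] key[OF s0 tr0] elim(2,3) by simp
    then show ?case by linarith
  qed
qed

text \<open>In the Hoermander index two paths are compared whose operators differ by a fixed factor,
  so the determinants differ by a constant \<open>c\<close>. The difference of the total angles then
  has constant \<open>cis\<close>, and only the terms in \<open>tau\<close> remain.\<close>

lemma ceiling_sum_difference:
  assumes ab: "a \<le> b"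
    and \<Lambda>: "lagrangian_path a b \<Lambda>" and M: "lagrangian_path a b M" and \<theta>: "angle_path a b \<Lambda> M \<theta>"
    and \<Lambda>': "lagrangian_path a b \<Lambda>'" and M': "lagrangian_path a b M'" and \<theta>': "angle_path a b \<Lambda>' M' \<theta>'"
    and c: "\<And>s. s \<in> {a..b} \<Longrightarrow> Det (W (\<Lambda> s) (M s)) = c * Det (W (\<Lambda>' s) (M' s))"
  shows "real_of_int ((\<Sum>j<n. \<lceil>\<theta> j b / (2 * pi)\<rceil> - \<lceil>\<theta> j a / (2 * pi)\<rceil>) - (\<Sum>j<n. \<lceil>\<theta>' j b / (2 * pi)\<rceil> - \<lceil>\<theta>' j a / (2 * pi)\<rceil>)) =
    (tau (W (\<Lambda> b) (M b)) - tau (W (\<Lambda> a) (M a))) - (tau (W (\<Lambda>' b) (M' b)) - tau (W (\<Lambda>' a) (M' a)))"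
proof -
  have ang: "angles (W (\<Lambda> s) (M s)) (\<lambda>j. \<theta> j s)" "angles (W (\<Lambda>' s) (M' s)) (\<lambda>j. \<theta>' j s)"
    "unitary (W (\<Lambda> s) (M s))" "unitary (W (\<Lambda>' s) (M' s))" if "s \<in> {a..b}" for s
    using \<theta> \<theta>' that unitary_W lagrangian_path_at[OF \<Lambda>] lagrangian_path_at[OF M] lagrangian_path_at[OF \<Lambda>'] lagrangian_path_at[OF M']
    by (simp_all add: angle_path_def)
  define F where "F s = (\<Sum>j<n. \<theta> j s) - (\<Sum>j<n. \<theta>' j s)" for s
  have "F b = F a"
  proof (rule cis_constant_imp_constant[where f = F and c = c and a = a and b = b])
    show "continuous_on {a..b} F" unfolding F_def
      by (intro continuous_intros) (use \<theta> \<theta>' in \<open>auto simp: angle_path_def\<close>)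
    show "cis (F s) = c" if s: "s \<in> {a..b}" for s
    proof -
      have "cis (\<Sum>j<n. \<theta> j s) = c * cis (\<Sum>j<n. \<theta>' j s)"
        using c[OF s] angles_Det[OF ang(3)[OF s] ang(1)[OF s]] angles_Det[OF ang(4)[OF s] ang(2)[OF s]] by simp
      then show ?thesis unfolding F_def by (simp add: cis_divide[symmetric])
    qed
  qed (use ab in simp)
  then have "(\<Sum>j<n. \<theta> j b) / (2 * pi) - (\<Sum>j<n. \<theta>' j b) / (2 * pi) = (\<Sum>j<n. \<theta> j a) / (2 * pi) - (\<Sum>j<n. \<theta>' j a) / (2 * pi)"
    by (simp add: F_def flip: diff_divide_distrib)
  moreover have "a \<in> {a..b}" "b \<in> {a..b}" using ab by simp_all
  ultimately show ?thesis
    using sum_ceiling_angles[OF ang(1)[of a]] sum_ceiling_angles[OF ang(2)[of a]]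
      sum_ceiling_angles[OF ang(1)[of b]] sum_ceiling_angles[OF ang(2)[of b]]
    by (simp add: sum_subtractf)
qed

text \<open>\<open>W L2 L1\<close> is diagonalized and its angles are scaled linearly from 0 to
  \<open>t k\<close>; twisting \<open>L1\<close> by these unitary operators leads from
  \<open>L1\<close> to \<open>L2\<close>.\<close>

lemma lagrangian_path_exists:
  assumes L1: "lagrangian L1" and L2: "lagrangian L2"
  shows "\<exists>\<Lambda>. lagrangian_path 0 1 \<Lambda> \<and> \<Lambda> 0 = L1 \<and> \<Lambda> 1 = L2"
proof -
  obtain e t where e: "pos_form.orthobasis P e n" and t: "\<forall>k<n. W L2 L1 (e k) = scale (cis (t k)) (e k)"
    using unitary_eigenbasis[OF unitary_W[OF L2 L1]] by (elim exE conjE)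
  have eP: "e k \<in> P" if "k < n" for k by (rule pos_form.orthobasis_mem[OF e that])
  define F where "F s = diag e (\<lambda>k. cis (s * t k))" for s
  have FF: "F s (F (- s) y) = y" if "y \<in> P" for s y
    unfolding F_def
    by (rule endo_eqI[where T = "\<lambda>y. y", OF endo_comp[OF endo_diag[OF e] endo_diag[OF e]] _ e _ that])
      (use endo_diag[OF e, of "\<lambda>k. cis (s * t k)"] eP in \<open>auto simp: F_def endo_def diag_basis[OF e] cis_mult\<close>)
  have endF: "endo P (F s)" for s unfolding F_def by (rule endo_diag[OF e])
  define \<Lambda> where "\<Lambda> s = {x + F s (U L1 x) | x. x \<in> N}" for s
  have lag: "lagrangian (\<Lambda> s)" for s
  proof -
    have "\<exists>x\<in>P. F s x = y" if "y \<in> P" for y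
      using FF[OF that] endF[of "- s"] that by (intro bexI[of _ "F (- s) y"]) (auto simp: endo_def)
    then show ?thesis
      using twisted_lagrangian[OF L1 unitary_diag[OF e, of "\<lambda>k. cis (s * t k)"]] unfolding \<Lambda>_def F_def by auto
  qed
  have F0: "F 0 y = y" if "y \<in> P" for y
    by (rule endo_eqI[OF endF _ e _ that]) (auto simp: endo_def F_def diag_basis[OF e])
  have \<Lambda>0: "\<Lambda> 0 = L1"
    by (subst lagrangian_eq_graph[OF L1], unfold \<Lambda>_def Setcompr_eq_image)
      (intro image_cong refl, simp add: F0 U(1)[OF L1])
  have F1: "F 1 y = W L2 L1 y" if "y \<in> P" for y
    by (rule endo_eqI[OF endF endo_W[OF L2 L1] e _ that]) (use t in \<open>auto simp: F_def diag_basis[OF e]\<close>)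
  have F1U: "F 1 (U L1 x) = U L2 x" if "x \<in> N" for x
    using F1[OF U(1)[OF L1 that]] VU[OF L1 that] by (simp add: W_def)
  have \<Lambda>1: "\<Lambda> 1 = L2"
    by (subst lagrangian_eq_graph[OF L2], unfold \<Lambda>_def Setcompr_eq_image)
      (intro image_cong refl, simp add: F1U)
  \<comment> \<open>The twisted graph map sends \<open>V L1 (e k)\<close> to
    \<open>cis (s * t k)\<close> times \<open>e k\<close>, so this frame of
    \<open>\<Lambda> s\<close> moves only by phases.\<close>
  define l where "l k s = V L1 (e k) + scale (cis (s * t k)) (e k)" for k s
  have l_mem: "l k s \<in> \<Lambda> s" if "k < n" for k s
    unfolding \<Lambda>_def l_def using V(1)[OF L1 eP[OF that]] L1 eP[OF that]
    by (intro CollectI exI[of _ "V L1 (e k)"]) (simp add: F_def diag_basis[OF e that])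
  have span_l: "\<Lambda> s = span ((\<lambda>k. l k s) ` {..<n})" for s
  proof
    show "span ((\<lambda>k. l k s) ` {..<n}) \<subseteq> \<Lambda> s"
      using l_mem lagrangian_subspace[OF lag] by (intro span_minimal) auto
    show "\<Lambda> s \<subseteq> span ((\<lambda>k. l k s) ` {..<n})"
    proof
      fix v assume "v \<in> \<Lambda> s"
      then obtain x where x: "x \<in> N" "v = x + F s (U L1 x)" by (auto simp: \<Lambda>_def)
      define \<phi> where "\<phi> y = V L1 y + F s y" for y
      have y: "U L1 x \<in> P" by (rule U(1)[OF L1 x(1)])
      have "v = \<phi> (U L1 x)" using x L1 by (simp add: \<phi>_def)
      also have "\<dots> = \<phi> (\<Sum>k<n. scale (herm_pos (U L1 x) (e k)) (e k))"
        by (rule arg_cong[where f = \<phi>]) (rule pos_form.orthobasis_expand[OF e y])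
      also have "\<dots> = (\<Sum>k<n. \<phi> (scale (herm_pos (U L1 x) (e k)) (e k)))"
        by (rule additive_sum[OF P])
          (use endF[of s] in \<open>simp_all add: \<phi>_def subspace_scale[OF P] eP V_add[OF L1] endo_def add_ac\<close>)
      also have "\<dots> = (\<Sum>k<n. scale (herm_pos (U L1 x) (e k)) (l k s))"
        using endF[of s] eP
        by (intro sum.cong) (auto simp: \<phi>_def l_def V_scale[OF L1] endo_def scale_right_distrib F_def diag_basis[OF e])
      also have "\<dots> \<in> span ((\<lambda>k. l k s) ` {..<n})" by (intro span_sum span_scale span_base) auto
      finally show "v \<in> span ((\<lambda>k. l k s) ` {..<n})" .
    qed
  qed
  have coeff: "herm_pos (l i s) (e k) = (if i = k then cis (s * t k) else 0)" if "i < n" "k < n" for i k s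
  proof -
    have "herm_pos (V L1 (e i)) (e k) = 0"
      using omega_NP[OF V(1)[OF L1 eP[OF that(1)]] eP[OF that(2)]] by (simp add: herm_pos_def)
    then show ?thesis
      using pos_form.orthobasis_orthonormal[OF e that] by (simp add: l_def pos_form.g_add pos_form.g_scale)
  qed
  \<comment> \<open>The components in \<open>P\<close> are pairwise orthogonal and of length 1, so
    no frame vector lies in the span of the earlier ones.\<close>
  have indep: "l k s \<notin> span ((\<lambda>i. l i s) ` {..<k})" if k: "k < n" for k s
  proof
    assume *: "l k s \<in> span ((\<lambda>i. l i s) ` {..<k})"
    have "herm_pos (e k) (l k s) = 0"
    proof (rule pos_form.orthogonal_span[OF *])
      fix v assume "v \<in> (\<lambda>i. l i s) ` {..<k}"
      then obtain i where i: "i < k" "v = l i s" by auto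
      then have "herm_pos v (e k) = 0" using coeff[of i k s] k by simp
      then show "herm_pos (e k) v = 0" using pos_form.herm[of "e k" v] by simp
    qed
    then have "herm_pos (l k s) (e k) = 0" using pos_form.herm[of "l k s" "e k"] by simp
    then show False using coeff[OF k k, of s] by simp
  qed
  have "lagrangian_path 0 1 \<Lambda>"
  proof (rule lagrangian_path_of_frame[OF lag span_l indep])
    fix h k y assume h: "inner_product h" and k: "k < n"
    have "sesquilinear scale h" using h unfolding inner_product_def by (rule conjunct1)
    then have "h (l k s) y = h (V L1 (e k)) y + cis (s * t k) * h (e k) y" for s
      by (simp add: sesquilinear_def l_def)
    then show "continuous_on {0..1} (\<lambda>s. h (l k s) y)"
      by (simp add: cis_conv_exp) (intro continuous_intros)
  qed
  then show ?thesis using \<Lambda>0 \<Lambda>1 by blast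
qed

end

section \<open>The Maslov and Hoermander indices\<close>

context polarization begin

text \<open>The Maslov index is defined with half the dimension of the space, the frame with the
  dimension of \<open>P\<close>. They agree because a Lagrangian subspace is the graph of a
  bijection between the halves.\<close>

lemma dim_UNIV_eq:
  assumes L: "lagrangian L"
  shows "dim UNIV = 2 * n"
proof -
  have "V L ` P = N"
  proof
    show "V L ` P \<subseteq> N" using V(1)[OF L] by blast
    show "N \<subseteq> V L ` P"
    proof
      fix x assume "x \<in> N"
      then show "x \<in> V L ` P" using U(1)[OF L] VU[OF L] by (intro image_eqI[of _ _ "U L x"]) auto
    qed
  qed
  moreover have "dim (V L ` P) = dim P"
  proof (rule dim_image_injective[OF V_add[OF L] V_scale[OF L] P order_refl])
    fix u assume u: "u \<in> P" "V L u = 0"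
    have "V L 0 = 0" using V_scale[OF L subspace_0[OF P], of 0] by simp
    then have "U L (V L u) = U L (V L 0)" using u(2) by simp
    then show "u = 0" using UV[OF L u(1)] UV[OF L subspace_0[OF P]] by simp
  qed
  moreover have "{x + y |x y. x \<in> N \<and> y \<in> P} = UNIV" using decomposition by blast
  moreover have "N \<inter> P = {0}" using NP_trivial subspace_0[OF N] subspace_0[OF P] by blast
  ultimately show ?thesis using dim_sums_Int[OF N P] dim_P by simp
qed

lemma graph_map_U: "lagrangian L \<Longrightarrow> N = V_minus J \<Longrightarrow> P = V_plus J \<Longrightarrow> graph_map J L (U L)"
  unfolding graph_map_def using U(1)[of L] U_add[of L] U_scale[of L] lagrangian_eq_graph[of L] by auto

text \<open>The graph maps in \<open>maslov_value\<close> are thus no real choice: on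
  \<open>N\<close> the subspace determines them.\<close>

lemma graph_map_unique:
  assumes L: "lagrangian L" and NP: "N = V_minus J" "P = V_plus J" and F: "graph_map J L F" and x: "x \<in> N"
  shows "F x = U L x"
proof -
  have "F ` N \<subseteq> P" "L = {x + F x |x. x \<in> N}" using F unfolding graph_map_def NP by blast+
  then have "F x \<in> P" "x + F x \<in> L" using x by blast+
  then show ?thesis using U_unique[OF L x] by simp
qed

lemma eigenangles_iff:
  assumes L: "lagrangian L" and M: "lagrangian M" and NP: "N = V_minus J" "P = V_plus J"
    and F: "graph_map J L F" and G: "graph_map J M G"
  shows "eigenangles J (F \<circ> inv_into (V_minus J) G) n t \<longleftrightarrow> angles (W L M) t"
proof -
  have "(F \<circ> inv_into N G) y = W L M y" if y: "y \<in> P" for y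
  proof -
    have inj: "inj_on G N"
    proof (rule inj_onI)
      fix x x' assume x: "x \<in> N" "x' \<in> N" "G x = G x'"
      then have "U M x = U M x'" using graph_map_unique[OF M NP G] by simp
      then have "V M (U M x) = V M (U M x')" by simp
      then show "x = x'" using VU[OF M] x by simp
    qed
    have GV: "G (V M y) = y" using graph_map_unique[OF M NP G V(1)[OF M y]] UV[OF M y] by simp
    have "inv_into N G y = V M y" by (rule inv_into_f_eq[OF inj V(1)[OF M y] GV])
    then show ?thesis using graph_map_unique[OF L NP F V(1)[OF M y]] by (simp add: W_def)
  qed
  then have "angles (F \<circ> inv_into N G) t \<longleftrightarrow> angles (W L M) t" by (rule angles_cong)
  then show ?thesis unfolding eigenangles_def angles_def NP(1)[symmetric] NP(2)[symmetric] .
qed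

lemma angle_path_iff:
  assumes \<Lambda>: "lagrangian_path a b \<Lambda>" and M: "lagrangian_path a b M" and NP: "N = V_minus J" "P = V_plus J"
    and F: "\<forall>s\<in>{a..b}. graph_map J (\<Lambda> s) (F s) \<and> graph_map J (M s) (G s)"
  shows "angle_path a b \<Lambda> M \<theta> \<longleftrightarrow> (\<forall>j<n. continuous_on {a..b} (\<theta> j)) \<and>
    (\<forall>s\<in>{a..b}. eigenangles J (F s \<circ> inv_into (V_minus J) (G s)) n (\<lambda>j. \<theta> j s))"
  unfolding angle_path_def
  using eigenangles_iff[OF lagrangian_path_at[OF \<Lambda>] lagrangian_path_at[OF M] NP] F by simp

end

section \<open>Polarizations from inner products\<close>

context symplectic_fdvs begin

definition compatible :: "('v \<Rightarrow> 'v \<Rightarrow> complex) \<Rightarrow> ('v \<Rightarrow> 'v) \<Rightarrow> bool" where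
  "compatible h J \<longleftrightarrow> inner_product h \<and> Vector_Spaces.linear scale scale J \<and> bij J \<and> (\<forall>x y. \<omega> x y = h (J x) y)"

text \<open>Skewness of \<omega> makes i J self-adjoint for \<open>h\<close>, and nondegeneracy
  excludes the eigenvalue 0. The last conjunct says that J is diagonal on coefficients, which allows
  \<omega> to be expanded in \<open>e\<close>.\<close>

lemma compatible_eigenbasis:
  assumes hJ: "compatible h J"
  shows "\<exists>e r. hermitian_form.orthobasis scale h UNIV e (dim UNIV) \<and>
    (\<forall>k<dim UNIV. scale \<i> (J (e k)) = scale (of_real (r k)) (e k) \<and> r k \<noteq> (0::real)) \<and>
    (\<forall>x. \<forall>k<dim UNIV. h (J x) (e k) = - \<i> * of_real (r k) * h x (e k))"
proof -
  have h: "inner_product h" and lin: "Vector_Spaces.linear scale scale J" and om: "\<And>x y. \<omega> x y = h (J x) y"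
    using hJ by (simp_all add: compatible_def)
  interpret h: hermitian_form scale Basis h using h by (rule inner_product_hermitian)
  interpret J: Vector_Spaces.linear scale scale J by (rule lin)
  have posh: "h.positive_on UNIV" by (simp add: h.positive_on_def inner_product_pos[OF h])
  let ?T = "\<lambda>x. scale \<i> (J x)"
  have T: "endo UNIV ?T" by (simp add: endo_def J.add J.scale scale_right_distrib)
  have adj: "h (?T x) y = h x (?T y)" for x y
  proof -
    have "h x (?T y) = cnj (h (?T y) x)" by (rule h.herm)
    also have "\<dots> = - \<i> * cnj (\<omega> y x)" by (simp add: h.g_scale om)
    also have "cnj (\<omega> y x) = - \<omega> x y" using omega_skew[of x y] by simp
    finally show ?thesis by (simp add: h.g_scale om)
  qed
  have orth: "h (?T y) x = 0" if "x \<in> UNIV" "y \<in> UNIV" "x \<noteq> 0" "?T x = scale c x" "h y x = 0" for x y c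
    using adj[of y x] that(4,5) by (simp add: h.g_scale)
  have "\<exists>e r. h.orthobasis UNIV e (dim UNIV) \<and> (\<forall>k<dim UNIV. ?T (e k) = scale (r k) (e k))"
    by (rule h.spectral[OF posh T orth])
  then obtain e r where e: "h.orthobasis UNIV e (dim UNIV)" and r: "\<forall>k<dim UNIV. ?T (e k) = scale (r k) (e k)"
    by (elim exE conjE)
  have real: "of_real (Re (r k)) = r k" and nz: "r k \<noteq> 0" if k: "k < dim UNIV" for k
  proof -
    have n1: "h (e k) (e k) = 1" using h.orthobasis_orthonormal[OF e k k] by simp
    have rk: "?T (e k) = scale (r k) (e k)" using r k by blast
    have "r k = cnj (r k)" using adj[of "e k" "e k"] n1 unfolding rk by (simp add: h.g_scale)
    then show "of_real (Re (r k)) = r k" by (simp add: complex_eq_iff)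
    show "r k \<noteq> 0"
    proof
      assume "r k = 0"
      then have "?T (e k) = 0" unfolding rk by simp
      then have "J (e k) = 0" by (simp only: scale_eq_0_iff) simp
      then have "\<omega> (e k) y = 0" for y by (simp add: om)
      then have "e k = 0" using omega_nondegenerate by blast
      then show False using n1 by simp
    qed
  qed
  have coeff: "h (J x) (e k) = - \<i> * of_real (Re (r k)) * h x (e k)" if k: "k < dim UNIV" for x k
  proof -
    have rk: "?T (e k) = scale (r k) (e k)" using r k by blast
    have 1: "\<i> * h (J x) (e k) = cnj (r k) * h x (e k)"
      using adj[of x "e k"] unfolding rk by (simp add: h.g_scale)
    have 2: "cnj (r k) = of_real (Re (r k))" using arg_cong[OF real[OF k], of cnj] by simp
    have 3: "h (J x) (e k) = - \<i> * (\<i> * h (J x) (e k))" by simp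
    show ?thesis by (subst 3, subst 1, subst 2) simp
  qed
  show ?thesis
  proof (intro exI[of _ e] exI[of _ "\<lambda>k. Re (r k)"] conjI allI impI)
    fix k assume k: "k < dim UNIV"
    show "scale \<i> (J (e k)) = scale (of_real (Re (r k))) (e k)" using r k real[OF k] by simp
    show "Re (r k) \<noteq> 0" using real[OF k] nz[OF k] by (metis of_real_0)
  next
    fix x k assume k: "k < dim UNIV"
    show "h (J x) (e k) = - \<i> * of_real (Re (r k)) * h x (e k)" by (rule coeff[OF k])
  qed (rule e)
qed

text \<open>In the eigenbasis \<omega> is -i times a real diagonal form with entries
  \<open>r k\<close>. So a positive \<open>r k\<close> contributes negatively to the imaginary part
  of \<open>\<omega> x x\<close>, which is why \<open>V_minus\<close> belongs to the positive
  eigenvalues.\<close>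

lemma compatible_polarization:
  assumes hJ: "compatible h J"
  shows "\<exists>p. polarization scale \<omega> Basis (V_minus J) (V_plus J) p (dim (V_plus J))"
proof -
  have h: "inner_product h" and lin: "Vector_Spaces.linear scale scale J" and om: "\<And>x y. \<omega> x y = h (J x) y"
    using hJ by (simp_all add: compatible_def)
  interpret h: hermitian_form scale Basis h using h by (rule inner_product_hermitian)
  let ?m = "dim UNIV"
  obtain e r where e: "h.orthobasis UNIV e ?m"
    and er: "\<forall>k<?m. scale \<i> (J (e k)) = scale (of_real (r k)) (e k) \<and> r k \<noteq> 0"
    and cf: "\<forall>x. \<forall>k<?m. h (J x) (e k) = - \<i> * of_real (r k) * h x (e k)"
    using compatible_eigenbasis[OF hJ] by (elim exE conjE)
  have om_e: "\<omega> x y = - \<i> * (\<Sum>k<?m. of_real (r k) * (h x (e k) * cnj (h y (e k))))" for x y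
  proof -
    have "\<omega> x y = (\<Sum>k<?m. h (J x) (e k) * h (e k) y)"
      unfolding om by (rule h.orthobasis_inner[OF e UNIV_I])
    also have "\<dots> = (\<Sum>k<?m. - \<i> * (of_real (r k) * (h x (e k) * cnj (h y (e k)))))"
    proof (rule sum.cong[OF refl])
      fix k assume "k \<in> {..<?m}"
      then have "h (J x) (e k) = - \<i> * of_real (r k) * h x (e k)" using cf by simp
      moreover have "h (e k) y = cnj (h y (e k))" by (rule h.herm)
      ultimately show "h (J x) (e k) * h (e k) y = - \<i> * (of_real (r k) * (h x (e k) * cnj (h y (e k))))"
        by (simp only: mult.assoc)
    qed
    finally show ?thesis by (simp only: sum_distrib_left)
  qed
  have eig: "x \<in> span (e ` {k \<in> {..<?m}. r k = c})" if x: "scale \<i> (J x) = scale (of_real c) x" for x c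
  proof -
    have "h x (e k) = 0" if k: "k < ?m" "r k \<noteq> c" for k
    proof -
      have "\<i> * h (J x) (e k) = of_real c * h x (e k)"
        using arg_cong[OF x, of "\<lambda>z. h z (e k)"] by (simp add: h.g_scale)
      moreover have "\<i> * h (J x) (e k) = of_real (r k) * h x (e k)" using cf k(1) by (simp add: mult.assoc)
      ultimately show ?thesis using k(2) by auto
    qed
    then have "(\<Sum>k<?m. scale (h x (e k)) (e k)) = (\<Sum>k\<in>{k \<in> {..<?m}. r k = c}. scale (h x (e k)) (e k))"
      by (intro sum.mono_neutral_right) auto
    then have "x = (\<Sum>k\<in>{k \<in> {..<?m}. r k = c}. scale (h x (e k)) (e k))"
      using h.orthobasis_expand[OF e UNIV_I, of x] by simp
    also have "\<dots> \<in> span (e ` {k \<in> {..<?m}. r k = c})" by (intro span_sum span_scale span_base) auto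
    finally show ?thesis .
  qed
  have ene: "e k \<noteq> 0" if "k < ?m" for k using h.orthobasis_orthonormal[OF e that that] by auto
  \<comment> \<open>\<open>V_minus\<close> and \<open>V_plus\<close> are spans of all eigenvectors
    with the given sign; by \<open>eig\<close> those in the basis suffice.\<close>
  have eigspan: "span {x. x \<noteq> 0 \<and> (\<exists>c::real. R c \<and> scale \<i> (J x) = scale (of_real c) x)} =
      span (e ` {k \<in> {..<?m}. R (r k)})" for R
  proof
    show "span {x. x \<noteq> 0 \<and> (\<exists>c::real. R c \<and> scale \<i> (J x) = scale (of_real c) x)} \<subseteq> span (e ` {k \<in> {..<?m}. R (r k)})"
    proof (rule span_minimal[OF _ subspace_span], rule subsetI)
      fix x assume "x \<in> {x. x \<noteq> 0 \<and> (\<exists>c::real. R c \<and> scale \<i> (J x) = scale (of_real c) x)}"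
      then obtain c :: real where c: "R c" "scale \<i> (J x) = scale (of_real c) x" by blast
      have "span (e ` {k \<in> {..<?m}. r k = c}) \<subseteq> span (e ` {k \<in> {..<?m}. R (r k)})"
        using c(1) by (intro span_mono image_mono) auto
      then show "x \<in> span (e ` {k \<in> {..<?m}. R (r k)})" using eig[OF c(2)] by blast
    qed
    show "span (e ` {k \<in> {..<?m}. R (r k)}) \<subseteq> span {x. x \<noteq> 0 \<and> (\<exists>c::real. R c \<and> scale \<i> (J x) = scale (of_real c) x)}"
    proof (rule span_mono, rule subsetI)
      fix x assume "x \<in> e ` {k \<in> {..<?m}. R (r k)}"
      then obtain k where k: "k < ?m" "R (r k)" "x = e k" by auto
      have "scale \<i> (J x) = scale (of_real (r k)) x" "x \<noteq> 0" using er ene k by simp_all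
      then show "x \<in> {x. x \<noteq> 0 \<and> (\<exists>c::real. R c \<and> scale \<i> (J x) = scale (of_real c) x)}"
        using k(2) by (intro CollectI conjI exI[of _ "r k"])
    qed
  qed
  have Vm: "V_minus J = span (e ` {k \<in> {..<?m}. 0 < r k})" unfolding V_minus_def by (rule eigspan)
  have Vp: "V_plus J = span (e ` {k \<in> {..<?m}. r k < 0})" unfolding V_plus_def by (rule eigspan)
  have coeff0: "h u (e k) = 0" if "u \<in> span (e ` A)" "A \<subseteq> {..<?m}" "k < ?m" "k \<notin> A" for u A k
  proof -
    have "h (e k) u = 0"
      by (rule h.orthogonal_span[OF that(1)]) (use that in \<open>auto simp: h.orthobasis_orthonormal[OF e] subset_iff\<close>)
    then show ?thesis using h.herm[of u "e k"] by simp
  qed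
  have Im_om: "Im (\<omega> x x) = (\<Sum>k<?m. - r k * (norm (h x (e k)))\<^sup>2)" for x
  proof -
    have "\<omega> x x = - \<i> * (\<Sum>k<?m. of_real (r k * (norm (h x (e k)))\<^sup>2))"
      unfolding om_e[of x x] of_real_mult complex_norm_square ..
    then show ?thesis by (simp add: sum_negf flip: of_real_sum)
  qed
  have some: "\<exists>k<?m. h x (e k) \<noteq> 0" if "x \<noteq> 0" for x
    using h.orthobasis_eqI[OF e UNIV_I UNIV_I, of x 0] that by auto
  \<comment> \<open>The factor \<open>\<sigma>\<close> is taken to be -1 for \<open>V_plus J\<close>
    and 1 for \<open>V_minus J\<close>, so one argument covers both signs.\<close>
  have definite: "0 < (\<Sum>k<?m. \<sigma> * r k * (norm (h v (e k)))\<^sup>2)"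
    if v: "v \<in> span (e ` {k \<in> {..<?m}. 0 < \<sigma> * r k})" "v \<noteq> 0" for v \<sigma>
  proof -
    have z: "h v (e k) = 0" if "k < ?m" "\<not> 0 < \<sigma> * r k" for k
      by (rule coeff0[OF v(1) _ that(1)]) (use that in auto)
    obtain k where k: "k < ?m" "h v (e k) \<noteq> 0" using some[OF v(2)] by blast
    show ?thesis
    proof (rule sum_pos2[of _ k])
      have "0 < \<sigma> * r k" using z[OF k(1)] k(2) by blast
      then show "0 < \<sigma> * r k * (norm (h v (e k)))\<^sup>2"
        by (rule mult_pos_pos) (use k(2) in simp)
      fix j assume j: "j \<in> {..<?m}"
      show "0 \<le> \<sigma> * r j * (norm (h v (e j)))\<^sup>2"
      proof (cases "0 < \<sigma> * r j")
        case True
        then show ?thesis by (intro mult_nonneg_nonneg[OF less_imp_le]) simp_all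
      next
        case False
        then show ?thesis using z[of j] j by simp
      qed
    qed (use k in auto)
  qed
  have posP: "0 < Im (\<omega> v v)" if "v \<in> V_plus J" "v \<noteq> 0" for v
    using definite[of v "-1"] that by (simp add: Vp Im_om)
  have negN: "Im (\<omega> v v) < 0" if "v \<in> V_minus J" "v \<noteq> 0" for v
    using definite[of v 1] that by (simp add: Vm Im_om sum_negf)
  have sP: "subspace (V_plus J)" and sN: "subspace (V_minus J)" by (simp_all add: V_plus_def V_minus_def)
  have posV: "pos_form.positive_on (V_plus J)"
    using sP posP by (simp add: pos_form.positive_on_def herm_pos_def)
  obtain p where p: "pos_form.orthobasis (V_plus J) p (dim (V_plus J))"
    using pos_form.orthobasis_exists[OF posV] by (rule exE)
  have dec: "\<exists>u\<in>V_minus J. \<exists>v\<in>V_plus J. x = u + v" for x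
  proof -
    let ?f = "\<lambda>k. scale (h x (e k)) (e k)"
    have U: "{..<?m} = {k \<in> {..<?m}. 0 < r k} \<union> {k \<in> {..<?m}. r k < 0}"
    proof (rule Set.set_eqI)
      fix k
      have "k < ?m \<Longrightarrow> r k \<noteq> 0" using er by blast
      then show "k \<in> {..<?m} \<longleftrightarrow> k \<in> {k \<in> {..<?m}. 0 < r k} \<union> {k \<in> {..<?m}. r k < 0}"
        by (cases "r k" "0::real" rule: linorder_cases) auto
    qed
    have "(\<Sum>k<?m. ?f k) = (\<Sum>k\<in>{k \<in> {..<?m}. 0 < r k} \<union> {k \<in> {..<?m}. r k < 0}. ?f k)"
      by (rule sum.cong[OF U refl])
    also have "\<dots> = (\<Sum>k\<in>{k \<in> {..<?m}. 0 < r k}. ?f k) + (\<Sum>k\<in>{k \<in> {..<?m}. r k < 0}. ?f k)"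
      by (rule sum.union_disjoint) auto
    finally have "x = (\<Sum>k\<in>{k \<in> {..<?m}. 0 < r k}. ?f k) + (\<Sum>k\<in>{k \<in> {..<?m}. r k < 0}. ?f k)"
      using h.orthobasis_expand[OF e UNIV_I, of x] by simp
    moreover have "(\<Sum>k\<in>{k \<in> {..<?m}. 0 < r k}. ?f k) \<in> V_minus J"
      unfolding Vm by (intro span_sum span_scale span_base) auto
    moreover have "(\<Sum>k\<in>{k \<in> {..<?m}. r k < 0}. ?f k) \<in> V_plus J"
      unfolding Vp by (intro span_sum span_scale span_base) auto
    ultimately show ?thesis by blast
  qed
  have om0: "\<omega> u v = 0" if "u \<in> V_minus J" "v \<in> V_plus J" for u v
  proof -
    have "h u (e k) * cnj (h v (e k)) = 0" if k: "k < ?m" for k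
    proof (cases "0 < r k")
      case True
      then have "h v (e k) = 0" by (intro coeff0[OF \<open>v \<in> V_plus J\<close>[unfolded Vp] _ k]) auto
      then show ?thesis by simp
    next
      case False
      then have "h u (e k) = 0" by (intro coeff0[OF \<open>u \<in> V_minus J\<close>[unfolded Vm] _ k]) auto
      then show ?thesis by simp
    qed
    then have "(\<Sum>k<?m. of_real (r k) * (h u (e k) * cnj (h v (e k)))) = 0"
      by (intro sum.neutral ballI) (simp only: lessThan_iff mult_zero_right)
    then show ?thesis unfolding om_e by simp
  qed
  have p_sp: "V_plus J = span (p ` {..<dim (V_plus J)})" using p unfolding pos_form.orthobasis_def by (rule conjunct2)
  have p_or: "\<omega> (p i) (p j) = (if i = j then \<i> else 0)" if "i < dim (V_plus J)" "j < dim (V_plus J)" for i j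
  proof -
    have "\<i> * herm_pos (p i) (p j) = (if i = j then \<i> else 0)"
      using pos_form.orthobasis_orthonormal[OF p that] by simp
    then show ?thesis unfolding herm_pos_def mult.assoc[symmetric] by simp
  qed
  have "polarization scale \<omega> Basis (V_minus J) (V_plus J) p (dim (V_plus J))"
    by (intro polarization.intro polarization_axioms.intro symplectic_fdvs_axioms sN sP dec om0 posP negN p_sp p_or)
  then show ?thesis by (rule exI[of "\<lambda>p. polarization scale \<omega> Basis (V_minus J) (V_plus J) p (dim (V_plus J))" p])
qed

lemma compatible_exists: "\<exists>h J. compatible h J"
proof -
  define h where "h x y = (\<Sum>b\<in>Basis. representation Basis x b * cnj (representation Basis y b))" for x y
  have rep: "representation Basis (x + y) = (\<lambda>b. representation Basis x b + representation Basis y b)"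
    "representation Basis (scale c x) = (\<lambda>b. c * representation Basis x b)" for x y c
    by (simp_all add: representation_add[OF independent_Basis] representation_scale[OF independent_Basis] span_Basis)
  have h: "inner_product h"
    unfolding inner_product_def
  proof (intro conjI allI impI)
    show "sesquilinear scale h"
      by (simp add: sesquilinear_def h_def rep algebra_simps sum.distrib sum_distrib_left)
    show "h y x = cnj (h x y)" for x y by (simp add: h_def mult.commute)
    show "0 < Re (h x x)" if "x \<noteq> 0" for x
    proof -
      have "\<exists>b\<in>Basis. representation Basis x b \<noteq> 0"
      proof (rule ccontr)
        assume "\<not> ?thesis"
        then have "(\<Sum>b\<in>Basis. scale (representation Basis x b) b) = 0" by simp
        then show False
          using that sum_representation_eq[OF independent_Basis, of x Basis] finite_Basis by (simp add: span_Basis)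
      qed
      then obtain b where b: "b \<in> Basis" "representation Basis x b \<noteq> 0" by blast
      have "0 < (\<Sum>b\<in>Basis. (norm (representation Basis x b))\<^sup>2)"
        by (rule sum_pos2[OF finite_Basis b(1)]) (use b(2) in auto)
      moreover have "h x x = of_real (\<Sum>b\<in>Basis. (norm (representation Basis x b))\<^sup>2)"
        by (simp only: h_def of_real_sum complex_norm_square)
      ultimately show ?thesis by simp
    qed
  qed
  interpret h: hermitian_form scale Basis h using h by (rule inner_product_hermitian)
  have "h.positive_on UNIV" by (simp add: h.positive_on_def inner_product_pos[OF h])
  from h.orthobasis_exists[OF this] obtain e where e: "h.orthobasis UNIV e (dim UNIV)" by (rule exE)
  \<comment> \<open>The Riesz representation of the conjugate-linear functional
    \<open>\<omega> x\<close> in an orthonormal basis of \<open>h\<close>.\<close>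
  define J where "J x = (\<Sum>k<dim UNIV. scale (\<omega> x (e k)) (e k))" for x
  have lin: "Vector_Spaces.linear scale scale J"
    by unfold_locales (simp_all add: J_def omega_simps scale_left_distrib sum.distrib scale_sum_right)
  have om: "\<omega> x y = h (J x) y" for x y
  proof -
    have "\<omega> x (\<Sum>k<m. scale (f k) (e k)) = (\<Sum>k<m. cnj (f k) * \<omega> x (e k))" for f and m :: nat
      by (induction m) (simp_all add: omega_simps)
    from this[of "\<lambda>k. h y (e k)" "dim UNIV"]
    have "\<omega> x y = (\<Sum>k<dim UNIV. cnj (h y (e k)) * \<omega> x (e k))"
      using h.orthobasis_expand[OF e UNIV_I, of y] by simp
    also have "\<dots> = (\<Sum>k<dim UNIV. \<omega> x (e k) * h (e k) y)"
      by (simp add: mult.commute flip: h.herm)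
    also have "\<dots> = h (J x) y" by (simp add: J_def h.g_simps)
    finally show ?thesis .
  qed
  have "inj J"
  proof (rule injI)
    fix x y assume "J x = J y"
    then have "\<omega> (x - y) z = 0" for z unfolding omega_diff unfolding om by simp
    then have "x - y = 0" using omega_nondegenerate by blast
    then show "x = y" by simp
  qed
  then have "bij J" using linear_inj_imp_surj[OF lin] by (simp add: bij_def)
  then have "compatible h J" using h lin om by (simp add: compatible_def)
  then show ?thesis by blast
qed

text \<open>
  Both ceiling sums differ from \<open>m_Q (\<Lambda> s) D (M s)\<close> by a locally constant function of \<open>s\<close>, hence
  their difference is locally constant, although the two polarizations may be different.
\<close>
lemma maslov_unique:
  assumes ab: "a \<le> b" and \<Lambda>: "lagrangian_path a b \<Lambda>" and M: "lagrangian_path a b M"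
    and k: "maslov_value a b \<Lambda> M k" and k': "maslov_value a b \<Lambda> M k'"
  shows "k = k'"
proof -
  let ?n = "dim UNIV div 2"
  have "\<exists>h J F G \<theta>. compatible h J \<and> (\<forall>s\<in>{a..b}. graph_map J (\<Lambda> s) (F s) \<and> graph_map J (M s) (G s)) \<and>
      (\<forall>j<?n. continuous_on {a..b} (\<theta> j)) \<and>
      (\<forall>s\<in>{a..b}. eigenangles J (F s \<circ> inv_into (V_minus J) (G s)) ?n (\<lambda>j. \<theta> j s)) \<and>
      k = (\<Sum>j<?n. \<lceil>\<theta> j b / (2 * pi)\<rceil> - \<lceil>\<theta> j a / (2 * pi)\<rceil>)"
    if "maslov_value a b \<Lambda> M k" for k
    using that unfolding maslov_value_def Let_def compatible_def conj_assoc .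
  note data = this
  obtain h J F G \<theta> where A: "compatible h J" "\<forall>s\<in>{a..b}. graph_map J (\<Lambda> s) (F s) \<and> graph_map J (M s) (G s)"
    "\<forall>j<?n. continuous_on {a..b} (\<theta> j)"
    "\<forall>s\<in>{a..b}. eigenangles J (F s \<circ> inv_into (V_minus J) (G s)) ?n (\<lambda>j. \<theta> j s)"
    "k = (\<Sum>j<?n. \<lceil>\<theta> j b / (2 * pi)\<rceil> - \<lceil>\<theta> j a / (2 * pi)\<rceil>)"
    using data[OF k] by (elim exE conjE)
  obtain h' J' F' G' \<theta>' where B: "compatible h' J'" "\<forall>s\<in>{a..b}. graph_map J' (\<Lambda> s) (F' s) \<and> graph_map J' (M s) (G' s)"
    "\<forall>j<?n. continuous_on {a..b} (\<theta>' j)"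
    "\<forall>s\<in>{a..b}. eigenangles J' (F' s \<circ> inv_into (V_minus J') (G' s)) ?n (\<lambda>j. \<theta>' j s)"
    "k' = (\<Sum>j<?n. \<lceil>\<theta>' j b / (2 * pi)\<rceil> - \<lceil>\<theta>' j a / (2 * pi)\<rceil>)"
    using data[OF k'] by (elim exE conjE)
  obtain p where p: "polarization scale \<omega> Basis (V_minus J) (V_plus J) p (dim (V_plus J))"
    using compatible_polarization[OF A(1)] by (rule exE)
  obtain p' where p': "polarization scale \<omega> Basis (V_minus J') (V_plus J') p' (dim (V_plus J'))"
    using compatible_polarization[OF B(1)] by (rule exE)
  interpret A: polarization scale \<omega> Basis "V_minus J" "V_plus J" p "dim (V_plus J)" by (rule p)
  interpret B: polarization scale \<omega> Basis "V_minus J'" "V_plus J'" p' "dim (V_plus J')" by (rule p')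
  have "lagrangian (\<Lambda> a)" using \<Lambda> ab by (simp add: lagrangian_path_def)
  then have n: "dim (V_plus J) = ?n" "dim (V_plus J') = ?n"
    using A.dim_UNIV_eq B.dim_UNIV_eq by auto
  have \<theta>: "A.angle_path a b \<Lambda> M \<theta>"
    unfolding n by (rule A.angle_path_iff[OF \<Lambda> M refl refl A(2), THEN iffD2, unfolded n]) (intro conjI A(3) A(4))
  have \<theta>': "B.angle_path a b \<Lambda> M \<theta>'"
    unfolding n by (rule B.angle_path_iff[OF \<Lambda> M refl refl B(2), THEN iffD2, unfolded n]) (intro conjI B(3) B(4))
  define f where "f s = (\<Sum>j<?n. \<lceil>\<theta> j s / (2 * pi)\<rceil>) - (\<Sum>j<?n. \<lceil>\<theta>' j s / (2 * pi)\<rceil>)" for s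
  have "f b = f a"
  proof (rule locally_constant_on_interval[where f = f and a = a and b = b])
    fix s0 assume s0: "s0 \<in> {a..b}"
    have "lagrangian (\<Lambda> s0)" "lagrangian (M s0)" using \<Lambda> M s0 by (simp_all add: lagrangian_path_def)
    \<comment> \<open>Transversality mentions no polarization, so one \<open>D\<close> serves both,
      and the same value of \<open>m_Q\<close> cancels between them.\<close>
    then have "\<exists>D. lagrangian D \<and> (\<forall>L\<in>{\<Lambda> s0, M s0}. D \<inter> L = {0})"
      by (intro A.transversal_exists) auto
    then obtain D where D: "lagrangian D" "D \<inter> \<Lambda> s0 = {0}" "D \<inter> M s0 = {0}" by auto
    show "\<forall>\<^sub>F s in at s0 within {a..b}. f s = f s0"
      using A.ceiling_sum_locally[OF ab \<Lambda> M \<theta> s0 D] B.ceiling_sum_locally[OF ab \<Lambda> M \<theta>' s0 D]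
    proof eventually_elim
      case (elim s)
      then show ?case unfolding f_def n by linarith
    qed
  qed (use ab in simp)
  then show ?thesis unfolding A(5) B(5) f_def by (simp add: sum_subtractf)
qed

lemma maslov_index_eq:
  assumes hJ: "compatible h J" and pol: "polarization scale \<omega> Basis (V_minus J) (V_plus J) p n"
    and ab: "a \<le> b" and \<Lambda>: "lagrangian_path a b \<Lambda>" and M: "lagrangian_path a b M"
    and \<theta>: "polarization.angle_path scale (V_minus J) (V_plus J) n a b \<Lambda> M \<theta>"
  shows "maslov_index a b \<Lambda> M = (\<Sum>j<n. \<lceil>\<theta> j b / (2 * pi)\<rceil> - \<lceil>\<theta> j a / (2 * pi)\<rceil>)"
proof -
  interpret A: polarization scale \<omega> Basis "V_minus J" "V_plus J" p n by (rule pol)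
  have lag: "lagrangian (\<Lambda> s)" "lagrangian (M s)" if "s \<in> {a..b}" for s
    using \<Lambda> M that by (simp_all add: lagrangian_path_def)
  have "lagrangian (\<Lambda> a)" using lag ab by simp
  then have n: "dim UNIV div 2 = n" using A.dim_UNIV_eq by auto
  have G: "\<forall>s\<in>{a..b}. graph_map J (\<Lambda> s) (A.U (\<Lambda> s)) \<and> graph_map J (M s) (A.U (M s))"
    using A.graph_map_U[OF _ refl refl] lag by simp
  have c: "inner_product h" "Vector_Spaces.linear scale scale J" "bij J" "\<forall>x y. \<omega> x y = h (J x) y"
    using hJ unfolding compatible_def by blast+
  have t: "\<forall>j<n. continuous_on {a..b} (\<theta> j)"
    "\<forall>s\<in>{a..b}. eigenangles J (A.U (\<Lambda> s) \<circ> inv_into (V_minus J) (A.U (M s))) n (\<lambda>j. \<theta> j s)"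
    using \<theta> unfolding A.angle_path_iff[OF \<Lambda> M refl refl G] by (rule conjunct1, rule conjunct2)
  have v: "maslov_value a b \<Lambda> M (\<Sum>j<n. \<lceil>\<theta> j b / (2 * pi)\<rceil> - \<lceil>\<theta> j a / (2 * pi)\<rceil>)"
    unfolding maslov_value_def Let_def n
    by (intro exI[of _ h] exI[of _ J] exI[of _ "\<lambda>s. A.U (\<Lambda> s)"] exI[of _ "\<lambda>s. A.U (M s)"] exI[of _ \<theta>]
        conjI c G t refl)
  show ?thesis unfolding maslov_index_def
    by (rule the_equality[where P = "maslov_value a b \<Lambda> M", OF v]) (rule maslov_unique[OF ab \<Lambda> M _ v])
qed

text \<open>Either expression in the definition equals the same alternating sum, in which no path
  occurs. This gives both the agreement of the two expressions and the uniqueness that the definite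
  description asks for.\<close>

lemma hormander_index_eq:
  assumes hJ: "compatible h J" and pol: "polarization scale \<omega> Basis (V_minus J) (V_plus J) p n"
    and L1: "lagrangian L1" and L2: "lagrangian L2" and M1: "lagrangian M1" and M2: "lagrangian M2"
  defines "tau2 \<equiv> \<lambda>L M. frame.tau scale (V_plus J) n (polarization.W (V_minus J) (V_plus J) L M)"
  shows "real_of_int (hormander_index L1 L2 M1 M2) = tau2 L2 M2 - tau2 L1 M2 - tau2 L2 M1 + tau2 L1 M1"
proof -
  interpret A: polarization scale \<omega> Basis "V_minus J" "V_plus J" p n by (rule pol)
  have tau2: "tau2 L M = A.tau (A.W L M)" for L M by (simp add: tau2_def)
  let ?X = "tau2 L2 M2 - tau2 L1 M2 - tau2 L2 M1 + tau2 L1 M1"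
  note cp = lagrangian_path_const
  have left: "real_of_int (maslov_index a b \<Lambda> (\<lambda>_. M2) - maslov_index a b \<Lambda> (\<lambda>_. M1)) = ?X"
    if ab: "a \<le> b" and \<Lambda>: "lagrangian_path a b \<Lambda>" "\<Lambda> a = L1" "\<Lambda> b = L2" for a b \<Lambda>
  proof -
    obtain \<theta> where \<theta>: "A.angle_path a b \<Lambda> (\<lambda>_. M2) \<theta>" using A.angle_path_exists[OF ab \<Lambda>(1) cp[OF M2]] by (rule exE)
    obtain \<psi> where \<psi>: "A.angle_path a b \<Lambda> (\<lambda>_. M1) \<psi>" using A.angle_path_exists[OF ab \<Lambda>(1) cp[OF M1]] by (rule exE)
    have D: "A.Det (A.W (\<Lambda> s) M2) = A.Det (A.W M1 M2) * A.Det (A.W (\<Lambda> s) M1)" if "s \<in> {a..b}" for s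
      using A.Det_W_comp[OF A.lagrangian_path_at[OF \<Lambda>(1) that] M1 M2] by (simp only: mult.commute)
    have "maslov_index a b \<Lambda> (\<lambda>_. M2) = (\<Sum>j<n. \<lceil>\<theta> j b / (2 * pi)\<rceil> - \<lceil>\<theta> j a / (2 * pi)\<rceil>)"
      by (rule maslov_index_eq[OF hJ pol ab \<Lambda>(1) cp[OF M2] \<theta>])
    moreover have "maslov_index a b \<Lambda> (\<lambda>_. M1) = (\<Sum>j<n. \<lceil>\<psi> j b / (2 * pi)\<rceil> - \<lceil>\<psi> j a / (2 * pi)\<rceil>)"
      by (rule maslov_index_eq[OF hJ pol ab \<Lambda>(1) cp[OF M1] \<psi>])
    moreover have "real_of_int ((\<Sum>j<n. \<lceil>\<theta> j b / (2 * pi)\<rceil> - \<lceil>\<theta> j a / (2 * pi)\<rceil>) -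
        (\<Sum>j<n. \<lceil>\<psi> j b / (2 * pi)\<rceil> - \<lceil>\<psi> j a / (2 * pi)\<rceil>)) =
      (A.tau (A.W (\<Lambda> b) M2) - A.tau (A.W (\<Lambda> a) M2)) - (A.tau (A.W (\<Lambda> b) M1) - A.tau (A.W (\<Lambda> a) M1))"
      by (rule A.ceiling_sum_difference[OF ab \<Lambda>(1) cp[OF M2] \<theta> \<Lambda>(1) cp[OF M1] \<psi>, where c = "A.Det (A.W M1 M2)"]) (rule D)
    ultimately show ?thesis unfolding tau2 \<Lambda>(2,3) by (simp only:)
  qed
  have right: "real_of_int (maslov_index a b (\<lambda>_. L2) M - maslov_index a b (\<lambda>_. L1) M) = ?X"
    if ab: "a \<le> b" and M: "lagrangian_path a b M" "M a = M1" "M b = M2" for a b M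
  proof -
    obtain \<theta> where \<theta>: "A.angle_path a b (\<lambda>_. L2) M \<theta>" using A.angle_path_exists[OF ab cp[OF L2] M(1)] by (rule exE)
    obtain \<psi> where \<psi>: "A.angle_path a b (\<lambda>_. L1) M \<psi>" using A.angle_path_exists[OF ab cp[OF L1] M(1)] by (rule exE)
    have D: "A.Det (A.W L2 (M s)) = A.Det (A.W L2 L1) * A.Det (A.W L1 (M s))" if "s \<in> {a..b}" for s
      by (rule A.Det_W_comp[OF L2 L1 A.lagrangian_path_at[OF M(1) that]])
    have "maslov_index a b (\<lambda>_. L2) M = (\<Sum>j<n. \<lceil>\<theta> j b / (2 * pi)\<rceil> - \<lceil>\<theta> j a / (2 * pi)\<rceil>)"
      by (rule maslov_index_eq[OF hJ pol ab cp[OF L2] M(1) \<theta>])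
    moreover have "maslov_index a b (\<lambda>_. L1) M = (\<Sum>j<n. \<lceil>\<psi> j b / (2 * pi)\<rceil> - \<lceil>\<psi> j a / (2 * pi)\<rceil>)"
      by (rule maslov_index_eq[OF hJ pol ab cp[OF L1] M(1) \<psi>])
    moreover have "real_of_int ((\<Sum>j<n. \<lceil>\<theta> j b / (2 * pi)\<rceil> - \<lceil>\<theta> j a / (2 * pi)\<rceil>) -
        (\<Sum>j<n. \<lceil>\<psi> j b / (2 * pi)\<rceil> - \<lceil>\<psi> j a / (2 * pi)\<rceil>)) =
      (A.tau (A.W L2 (M b)) - A.tau (A.W L2 (M a))) - (A.tau (A.W L1 (M b)) - A.tau (A.W L1 (M a)))"
      by (rule A.ceiling_sum_difference[OF ab cp[OF L2] M(1) \<theta> cp[OF L1] M(1) \<psi>, where c = "A.Det (A.W L2 L1)"]) (rule D)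
    ultimately show ?thesis unfolding tau2 M(2,3) by (simp only:)
  qed
  obtain \<Lambda> where \<Lambda>: "lagrangian_path 0 1 \<Lambda>" "\<Lambda> 0 = L1" "\<Lambda> 1 = L2"
    using A.lagrangian_path_exists[OF L1 L2] by (elim exE conjE)
  obtain M where M: "lagrangian_path 0 1 M" "M 0 = M1" "M 1 = M2"
    using A.lagrangian_path_exists[OF M1 M2] by (elim exE conjE)
  define k where "k = maslov_index 0 1 \<Lambda> (\<lambda>_. M2) - maslov_index 0 1 \<Lambda> (\<lambda>_. M1)"
  have k: "real_of_int k = ?X" unfolding k_def by (rule left[OF zero_le_one \<Lambda>])
  have "real_of_int k = real_of_int (maslov_index 0 1 (\<lambda>_. L2) M - maslov_index 0 1 (\<lambda>_. L1) M)"
    using k right[OF zero_le_one M] by simp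
  then have k2: "k = maslov_index 0 1 (\<lambda>_. L2) M - maslov_index 0 1 (\<lambda>_. L1) M" by (simp only: of_int_eq_iff)
  have "hormander_index L1 L2 M1 M2 = k"
    unfolding hormander_index_def
  proof (rule the_equality)
    show "\<exists>a b \<Lambda> M. a < b \<and> lagrangian_path a b \<Lambda> \<and> lagrangian_path a b M \<and>
        \<Lambda> a = L1 \<and> \<Lambda> b = L2 \<and> M a = M1 \<and> M b = M2 \<and>
        k = maslov_index a b \<Lambda> (\<lambda>_. M2) - maslov_index a b \<Lambda> (\<lambda>_. M1) \<and>
        k = maslov_index a b (\<lambda>_. L2) M - maslov_index a b (\<lambda>_. L1) M"
      using \<Lambda> M k_def k2
      by (intro exI[of _ 0] exI[of _ 1] exI[of _ \<Lambda>] exI[of _ M] conjI) simp_all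
    fix k' assume "\<exists>a b \<Lambda> M. a < b \<and> lagrangian_path a b \<Lambda> \<and> lagrangian_path a b M \<and>
        \<Lambda> a = L1 \<and> \<Lambda> b = L2 \<and> M a = M1 \<and> M b = M2 \<and>
        k' = maslov_index a b \<Lambda> (\<lambda>_. M2) - maslov_index a b \<Lambda> (\<lambda>_. M1) \<and>
        k' = maslov_index a b (\<lambda>_. L2) M - maslov_index a b (\<lambda>_. L1) M"
    then obtain a b \<Lambda>' where *: "a < b" "lagrangian_path a b \<Lambda>'" "\<Lambda>' a = L1" "\<Lambda>' b = L2"
      "k' = maslov_index a b \<Lambda>' (\<lambda>_. M2) - maslov_index a b \<Lambda>' (\<lambda>_. M1)" by (elim exE conjE)
    have "real_of_int (maslov_index a b \<Lambda>' (\<lambda>_. M2) - maslov_index a b \<Lambda>' (\<lambda>_. M1)) = ?X"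
      by (rule left[OF less_imp_le[OF *(1)] *(2,3,4)])
    then have "real_of_int k' = real_of_int k" using *(5) k by simp
    then show "k' = k" by (simp only: of_int_eq_iff)
  qed
  then show ?thesis using k by simp
qed

end

lemma (in complex_symplectic_space) symplectic_fdvs_exists: "\<exists>Basis. symplectic_fdvs scale \<omega> Basis"
proof -
  obtain B where B: "finite B" "span B = UNIV" using finite_dim by blast
  obtain C where C: "C \<subseteq> B" "independent C" "B \<subseteq> span C" using maximal_independent_subset[of B] by blast
  have "span B \<subseteq> span C" using C(3) by (intro span_minimal) simp_all
  then have "symplectic_fdvs scale \<omega> C" using B C finite_subset by unfold_locales auto
  then show ?thesis by blast
qed

theorem theorem1p1:
  fixes scale :: "complex \<Rightarrow> 'v::ab_group_add \<Rightarrow> 'v"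
    and \<omega> :: "'v \<Rightarrow> 'v \<Rightarrow> complex"
    and n :: nat
    and L\<^sub>1 L\<^sub>2 M\<^sub>1 M\<^sub>2 :: "'v set"
  assumes "complex_symplectic_space scale \<omega>"
    and "vector_space.dim scale (UNIV :: 'v set) = 2 * n"
    and "complex_symplectic_space.lagrangian scale \<omega> L\<^sub>1"
    and "complex_symplectic_space.lagrangian scale \<omega> L\<^sub>2"
    and "complex_symplectic_space.lagrangian scale \<omega> M\<^sub>1"
    and "complex_symplectic_space.lagrangian scale \<omega> M\<^sub>2"
  shows "complex_symplectic_space.hormander_index scale \<omega> L\<^sub>1 L\<^sub>2 M\<^sub>1 M\<^sub>2 =
           complex_symplectic_space.triple_index scale \<omega> L\<^sub>1 L\<^sub>2 M\<^sub>2
           - complex_symplectic_space.triple_index scale \<omega> L\<^sub>1 L\<^sub>2 M\<^sub>1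
       \<and> complex_symplectic_space.triple_index scale \<omega> L\<^sub>1 L\<^sub>2 M\<^sub>2
           - complex_symplectic_space.triple_index scale \<omega> L\<^sub>1 L\<^sub>2 M\<^sub>1 =
           complex_symplectic_space.triple_index scale \<omega> L\<^sub>1 M\<^sub>1 M\<^sub>2
           - complex_symplectic_space.triple_index scale \<omega> L\<^sub>2 M\<^sub>1 M\<^sub>2"
proof -
  interpret complex_symplectic_space scale \<omega> by (rule assms(1))
  obtain Basis where "symplectic_fdvs scale \<omega> Basis" using symplectic_fdvs_exists by (rule exE)
  then interpret symplectic_fdvs scale \<omega> Basis .
  obtain h J where hJ: "compatible h J" using compatible_exists by (elim exE)
  obtain p where pol: "polarization scale \<omega> Basis (V_minus J) (V_plus J) p (dim (V_plus J))"
    using compatible_polarization[OF hJ] by (rule exE)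
  interpret A: polarization scale \<omega> Basis "V_minus J" "V_plus J" p "dim (V_plus J)" by (rule pol)
  note lag = assms(3-6)
  \<comment> \<open>In the first difference of triple indices \<open>tau\<close> of the pair
    \<open>L\<^sub>1\<close>, \<open>L\<^sub>2\<close> cancels, in the second one \<open>tau\<close>
    of the pair \<open>M\<^sub>1\<close>, \<open>M\<^sub>2\<close>. Both leave the alternating sum
    over the four mixed pairs.\<close>
  have "real_of_int (hormander_index L\<^sub>1 L\<^sub>2 M\<^sub>1 M\<^sub>2) =
      real_of_int (triple_index L\<^sub>1 L\<^sub>2 M\<^sub>2 - triple_index L\<^sub>1 L\<^sub>2 M\<^sub>1)"
    using hormander_index_eq[OF hJ pol lag] A.triple_index_eq[OF lag(1,2,4)] A.triple_index_eq[OF lag(1,2,3)] by simp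
  moreover have "real_of_int (triple_index L\<^sub>1 L\<^sub>2 M\<^sub>2 - triple_index L\<^sub>1 L\<^sub>2 M\<^sub>1) =
      real_of_int (triple_index L\<^sub>1 M\<^sub>1 M\<^sub>2 - triple_index L\<^sub>2 M\<^sub>1 M\<^sub>2)"
    using A.triple_index_eq[OF lag(1,2,4)] A.triple_index_eq[OF lag(1,2,3)]
      A.triple_index_eq[OF lag(1,3,4)] A.triple_index_eq[OF lag(2,3,4)] by simp
  ultimately show ?thesis by (simp only: of_int_eq_iff)
qed

end
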